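(* Let $d\ge 1$, $s\in(0,1)$, and let $\Omega\subset\mathbb{R}^d$ be a bounded Lipschitz domain satisfying the uniform exterior ball condition. Let $\mu$ be a nonnegative finite measure on $S^{d-1}$ satisfying the nondegeneracy condition $$0<C\le \inf_{\omega\in S^{d-1}}\int_{S^{d-1}}|\omega\cdot\theta|^{2s}\,\mu(d\theta)$$ for some constant $C$. Let $A_s$ and $\nu^\star$ be as defined in the context. If $u\in L^1(\Omega)\cap L^1(\mathbb{R}^d,\nu^\star(x)\,dx)$ satisfies (1) $\int_{\mathbb{R}^d} u(x)\,A_s\eta(x)\,dx\le 0$ for all $\eta\in C_c^\infty(\Omega)$ with $\eta\ge 0$, (2) $u\le 0$ a.e. on $\Omega^c=\mathbb{R}^d\setminus\Omega$, (3) $\displaystyle\lim_{\varepsilon\to 0+}\varepsilon^{-s}\int_{\{x\in\Omega:\ \mathrm{dist}(x,\Omega^c)<\varepsilon\}} u^+(x)\,dx=0$, then $u\le 0$ a.e. in $\Omega$.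
   Context: The Lévy measure $\nu$ is given by $\nu(U)=\int_{\mathbb{R}}\int_{S^{d-1}}\mathbf{1}_U(r\theta)|r|^{-1-2s}\,\mu(d\theta)\,dr$ for Borel $U\subset\mathbb{R}^d$. The operator is $A_s u(x)=\mathrm{p.v.}\int_{\mathbb{R}^d}(u(x)-u(x+h))\,\nu(dh)=\lim_{\kappa\to0+}\int_{\{|r|\ge\kappa\}}\int_{S^{d-1}}\frac{u(x)-u(x+r\theta)}{|r|^{1+2s}}\,\mu(d\theta)\,dr$. The tail weight is $\nu^\star(x)=\int_{\mathbb{R}}\int_{S^{d-1}}\mathbf{1}_\Omega(x+r\theta)(1+|r|)^{-1-2s}\,\mu(d\theta)\,dr$. A domain satisfies the uniform exterior ball condition if there is $\rho>0$ such that for every $x\in\partial\Omega$ there is a ball $B$ of radius $\rho$ with $B\subset\overline{\Omega}^c$ and $\overline B\cap\overline\Omega=\{x\}$. $u^+=\max\{u,0\}$. *)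

theory Defs
  imports "HOL-Analysis.Analysis"
begin

fun iter_dderiv :: "('a::euclidean_space \<Rightarrow> real) \<Rightarrow> 'a list \<Rightarrow> 'a \<Rightarrow> real" where
  "iter_dderiv f [] = f"
| "iter_dderiv f (v # vs) = (\<lambda>x. frechet_derivative (iter_dderiv f vs) (at x) v)"

definition smooth_fun :: "('a::euclidean_space \<Rightarrow> real) \<Rightarrow> bool" where
  "smooth_fun f \<longleftrightarrow> (\<forall>vs. iter_dderiv f vs differentiable_on UNIV)"

definition test_fun :: "'a::euclidean_space set \<Rightarrow> ('a \<Rightarrow> real) \<Rightarrow> bool" where
  "test_fun \<Omega> \<eta> \<longleftrightarrow> smooth_fun \<eta> \<and> compact (closure {x. \<eta> x \<noteq> 0})
      \<and> closure {x. \<eta> x \<noteq> 0} \<subseteq> \<Omega>"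

definition lipschitz_domain :: "'a::euclidean_space set \<Rightarrow> bool" where
  "lipschitz_domain \<Omega> \<longleftrightarrow> open \<Omega> \<and> connected \<Omega> \<and> \<Omega> \<noteq> {} \<and>
     (\<forall>x\<in>frontier \<Omega>. \<exists>r>0. \<exists>e g L. norm e = 1 \<and>
        L-lipschitz_on {v. v \<bullet> e = 0} g \<and>
        \<Omega> \<inter> ball x r = {y \<in> ball x r. y \<bullet> e > g (y - (y \<bullet> e) *\<^sub>R e)})"

definition uniform_exterior_ball :: "'a::euclidean_space set \<Rightarrow> bool" where
  "uniform_exterior_ball \<Omega> \<longleftrightarrow> (\<exists>\<rho>>0. \<forall>x\<in>frontier \<Omega>. \<exists>c.
     ball c \<rho> \<subseteq> - closure \<Omega> \<and> cball c \<rho> \<inter> closure \<Omega> = {x})"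

definition sphere_measure :: "'a::euclidean_space measure \<Rightarrow> bool" where
  "sphere_measure \<mu> \<longleftrightarrow> finite_measure \<mu> \<and>
     sets \<mu> = sets (restrict_space borel (sphere (0::'a) 1))"

definition A_op :: "real \<Rightarrow> 'a::euclidean_space measure \<Rightarrow> ('a \<Rightarrow> real) \<Rightarrow> 'a \<Rightarrow> real" where
  "A_op s \<mu> u x = Lim (at_right 0) (\<lambda>\<kappa>::real.
     LINT r|lborel. indicator {r. \<kappa> \<le> \<bar>r\<bar>} r *
       (LINT \<theta>|\<mu>. (u x - u (x + r *\<^sub>R \<theta>)) / \<bar>r\<bar> powr (1 + 2 * s)))"

definition nu_star :: "real \<Rightarrow> 'a::euclidean_space measure \<Rightarrow> 'a set \<Rightarrow> 'a \<Rightarrow> real" where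
  "nu_star s \<mu> \<Omega> x = (LINT r|lborel. LINT \<theta>|\<mu>.
     indicator \<Omega> (x + r *\<^sub>R \<theta>) * (1 + \<bar>r\<bar>) powr (- 1 - 2 * s))"

end

theory Submission
  imports Defs
begin

text \<open>Write \<open>d\<close> for the distance to the complement of \<open>\<Omega>\<close>. The dual problem is not solved; an explicit
  approximate supersolution built from \<open>d\<close> takes its place, so no regularity theory for general
  stable operators is needed.

  Testing the hypothesis only with translated bumps shows that the mollification \<open>u\<^sub>\<delta>\<close> of \<open>u\<close>, cut off outside
  \<open>\<Omega>\<close>, satisfies \<open>A u\<^sub>\<delta> \<le> 0\<close> where \<open>d > 2 \<delta>\<close>, and by Kato's inequality so does its positive part \<open>v\<close>.
  The exterior ball at the point of the boundary nearest to \<open>x\<close> gives a unit vector \<open>e\<close> with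
  \<open>d (x + h) \<le> max 0 (d x + e \<bullet> h + \<bar>h\<bar>\<^sup>2 / (2 \<rho>))\<close> for all \<open>h\<close>. On every line through \<open>x\<close> the power \<open>d\<^sup>s\<close> is
  therefore dominated by the \<open>s\<close>-th power of the positive part of an affine function, which is
  annihilated by the one-dimensional operator where it is positive, up to an error of order
  \<open>d powr (- s / 2)\<close>. Composing \<open>d\<^sup>s\<close> with a sufficiently concave function absorbs this error, because
  the nondegeneracy of \<open>\<mu>\<close> bounds the mean square increment of \<open>d\<^sup>s\<close> near \<open>x\<close> from below; the result has
  \<open>A \<ge> c > 0\<close> in \<open>\<Omega>\<close>. Cutting it off smoothly at height \<open>\<delta>\<^sup>s\<close> yields \<open>\<eta> \<ge> 0\<close>, vanishing for
  \<open>d \<le> 2 \<delta>\<close>, with \<open>A \<eta> \<ge> c - E \<delta>\<^sup>s max(\<delta>, d) powr (- 2 s)\<close>. Pairing \<open>\<eta>\<close> with \<open>v\<close> bounds the integral of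
  \<open>v\<close> by that of \<open>v \<delta>\<^sup>s max(\<delta>, d) powr (- 2 s)\<close>, which tends to \<open>0\<close> with \<open>\<delta>\<close> by the boundary growth condition.
  Except on the bumps, principal values are avoided by working with the operators truncated at \<open>\<bar>r\<bar> \<ge> \<kappa>\<close>,
  which are bounded and symmetric, at the price of errors \<open>O(\<kappa> powr (2 - 2 s))\<close> for fixed \<open>\<delta>\<close>.\<close>

subsection \<open>Power weights on the half-line\<close>

text \<open>The growth condition is exactly critical for this argument. By layer cake, the error
  \<open>\<delta> powr s * max \<delta> d powr (- 2 * s)\<close> integrated against \<open>v\<close>
  is \<open>2 * s * \<delta> powr s\<close> times the integral over \<open>r \<ge> \<delta>\<close>
  of \<open>r powr (- 1 - 2 * s)\<close> times the mass of \<open>v\<close> in the strip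
  \<open>d \<le> r\<close>. A strip mass of order \<open>o(r powr s)\<close> makes this vanish, one
  of order \<open>O(r powr s)\<close> would merely keep it bounded. Since \<mu> may be singular,
  estimates are made on single lines. A line nearly tangent to the boundary sees almost no change of
  \<open>d\<close>, so the gain from concavity carries a power of the cosine
  \<open>e \<bullet> \<theta>\<close> and is bounded below only after averaging over \<mu>; the loss
  is therefore bounded uniformly in the direction, and the concavity parameter is chosen after
  averaging. Two limits are taken in a fixed order: \<kappa> to 0 for fixed \<delta>, then \<delta>
  to 0. Constants in front of \<open>\<kappa> powr (2 - 2 * s)\<close> may thus depend on \<delta>
  in any way, whereas those in front of the boundary error may not.\<close>

lemma integrable_mult_bounded:
  fixes f g :: "'b \<Rightarrow> real"
  assumes f: "integrable M f" and g: "g \<in> borel_measurable M" and B: "\<And>x. \<bar>g x\<bar> \<le> B"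
  shows "integrable M (\<lambda>x. f x * g x)"
proof (rule Bochner_Integration.integrable_bound[OF integrable_mult_left[OF f, of B]])
  show "(\<lambda>x. f x * g x) \<in> borel_measurable M"
    by (intro borel_measurable_times borel_measurable_integrable[OF f] g)
  show "AE x in M. norm (f x * g x) \<le> norm (f x * B)"
  proof (rule AE_I2)
    fix x
    have "\<bar>f x\<bar> * \<bar>g x\<bar> \<le> \<bar>f x\<bar> * \<bar>B\<bar>" using B[of x] by (intro mult_left_mono) auto
    then show "norm (f x * g x) \<le> norm (f x * B)" by (simp add: abs_mult)
  qed
qed

lemma nonneg_has_integral_lborel:
  fixes f :: "real \<Rightarrow> real"
  assumes [measurable]: "f \<in> borel_measurable borel" "A \<in> sets borel"
    and nonneg: "\<And>x. x \<in> A \<Longrightarrow> 0 \<le> f x" and I: "(f has_integral I) A"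
  shows "integrable lborel (\<lambda>x. indicator A x * f x)" "(LINT x|lborel. indicator A x * f x) = I"
proof -
  have "0 \<le> I" using has_integral_nonneg[OF I] nonneg by blast
  have "(\<integral>\<^sup>+x. ennreal (indicator A x * f x) \<partial>lborel) = ennreal I"
    using nn_integral_has_integral_lebesgue[OF nonneg I] by simp
  then have "has_bochner_integral lborel (\<lambda>x. indicator A x * f x) I"
    using nonneg \<open>0 \<le> I\<close> by (intro has_bochner_integral_nn_integral) (auto simp: indicator_def)
  then show "integrable lborel (\<lambda>x. indicator A x * f x)" "(LINT x|lborel. indicator A x * f x) = I"
    by (auto simp: has_bochner_integral_iff)
qed

text \<open>The radial part of the kernel on one half-line. The cutoff sits in the density and not
  in the carrier, so Borel measurability on \<open>real\<close> carries over unchanged.\<close>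

definition power_tail :: "real \<Rightarrow> real \<Rightarrow> real measure" where
  "power_tail s \<kappa> = density lborel (\<lambda>r. ennreal (indicator {\<kappa>..} r * r powr (- 1 - 2 * s)))"

lemma sets_power_tail [measurable_cong, simp]: "sets (power_tail s \<kappa>) = sets borel"
  by (simp add: power_tail_def)

lemma space_power_tail [simp]: "space (power_tail s \<kappa>) = UNIV"
  by (simp add: power_tail_def)

lemma measurable_power_tail [simp]: "borel_measurable (power_tail s \<kappa>) = borel_measurable borel"
  by (rule measurable_cong_sets) simp_all

lemma AE_power_tail: "AE r in power_tail s \<kappa>. \<kappa> \<le> r"
  unfolding power_tail_def by (subst AE_density) (auto intro!: AE_I2 simp: indicator_def)

lemma integrable_power_tail_iff:
  fixes f :: "real \<Rightarrow> real"
  assumes [measurable]: "f \<in> borel_measurable borel"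
  shows "integrable (power_tail s \<kappa>) f \<longleftrightarrow>
    integrable lborel (\<lambda>r. indicator {\<kappa>..} r * r powr (- 1 - 2 * s) * f r)"
  unfolding power_tail_def by (subst integrable_density) auto

lemma integral_power_tail:
  fixes f :: "real \<Rightarrow> real"
  assumes [measurable]: "f \<in> borel_measurable borel"
  shows "(LINT r|power_tail s \<kappa>. f r) =
    (LINT r|lborel. indicator {\<kappa>..} r * r powr (- 1 - 2 * s) * f r)"
  unfolding power_tail_def by (subst integral_density) auto

text \<open>Needed with \<open>p = s\<close> for the growth of \<open>d powr s\<close> and with
  \<open>p = 0\<close> for bounded quantities. Truncation at \<kappa> can only remove mass, so
  \<kappa> and \<open>a\<close> stay unrelated and the bound is an inequality.\<close>

lemma power_tail_upper:
  assumes "0 < \<kappa>" "0 < a" "p < 2 * s"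
  shows "integrable (power_tail s \<kappa>) (\<lambda>r. indicator {a..} r * r powr p)"
    and "(LINT r|power_tail s \<kappa>. indicator {a..} r * r powr p) \<le> a powr (p - 2 * s) / (2 * s - p)"
proof -
  have hi: "((\<lambda>r. r powr (p - 2 * s - 1)) has_integral a powr (p - 2 * s) / (2 * s - p)) {a..}"
    using has_integral_powr_to_inf[of "p - 2 * s - 1" a] assms by (simp add: minus_divide_right)
  have L: "integrable lborel (\<lambda>r. indicator {a..} r * r powr (p - 2 * s - 1))"
    "(LINT r|lborel. indicator {a..} r * r powr (p - 2 * s - 1)) = a powr (p - 2 * s) / (2 * s - p)"
    using nonneg_has_integral_lborel[OF _ _ _ hi] by auto
  have le: "\<bar>indicator {\<kappa>..} r * r powr (- 1 - 2 * s) * (indicator {a..} r * r powr p)\<bar>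
      \<le> indicator {a..} r * r powr (p - 2 * s - 1)" for r
  proof (cases "a \<le> r")
    case True
    then have "r powr (- 1 - 2 * s) * r powr p = r powr (p - 2 * s - 1)"
      using assms by (simp flip: powr_add add: algebra_simps)
    then show ?thesis using True by (auto simp: indicator_def abs_mult)
  qed simp
  have int: "integrable lborel (\<lambda>r. indicator {\<kappa>..} r * r powr (- 1 - 2 * s) * (indicator {a..} r * r powr p))"
    by (rule Bochner_Integration.integrable_bound[OF L(1)]) (use le in auto)
  then show "integrable (power_tail s \<kappa>) (\<lambda>r. indicator {a..} r * r powr p)"
    by (subst integrable_power_tail_iff) auto
  have "(LINT r|power_tail s \<kappa>. indicator {a..} r * r powr p) \<le>
      (LINT r|lborel. indicator {a..} r * r powr (p - 2 * s - 1))"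
    by (subst integral_power_tail, simp)
      (intro integral_mono int L(1) order.trans[OF abs_ge_self le])
  also have "\<dots> = a powr (p - 2 * s) / (2 * s - p)" by (rule L(2))
  finally show "(LINT r|power_tail s \<kappa>. indicator {a..} r * r powr p) \<le> a powr (p - 2 * s) / (2 * s - p)" .
qed

lemma finite_measure_power_tail:
  assumes "0 < \<kappa>" "0 < s" shows "finite_measure (power_tail s \<kappa>)"
proof
  have "integrable (power_tail s \<kappa>) (\<lambda>r. 1::real)"
  proof (subst integrable_cong_AE)
    show "AE x in power_tail s \<kappa>. 1 = indicator {\<kappa>..} x * x powr 0"
      using AE_power_tail by eventually_elim (use assms in auto)
    show "integrable (power_tail s \<kappa>) (\<lambda>r. indicator {\<kappa>..} r * r powr 0)"
      using assms by (intro power_tail_upper) auto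
  qed auto
  then show "emeasure (power_tail s \<kappa>) (space (power_tail s \<kappa>)) \<noteq> \<infinity>"
    by (simp add: integrable_iff_bounded)
qed

text \<open>The lower bound is what truncation leaves of the integral down to \<open>0\<close>; with
  \<open>p = 2\<close> its defect is one source of the \<open>\<kappa> powr (2 - 2 * s)\<close>
  errors. For \<open>\<kappa> > a\<close> its left side is negative and it still holds.\<close>

lemma power_tail_lower:
  assumes "0 < \<kappa>" "0 < a" "2 * s < p"
  shows "integrable (power_tail s \<kappa>) (\<lambda>r. indicator {..a} r * r powr p)"
    and "(LINT r|power_tail s \<kappa>. indicator {..a} r * r powr p) \<le> a powr (p - 2 * s) / (p - 2 * s)"
    and "(a powr (p - 2 * s) - \<kappa> powr (p - 2 * s)) / (p - 2 * s) \<le>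
      (LINT r|power_tail s \<kappa>. indicator {..a} r * r powr p)"
proof -
  have hi: "((\<lambda>r. r powr (p - 2 * s - 1)) has_integral c powr (p - 2 * s) / (p - 2 * s)) {0..c}" if "0 \<le> c" for c
    using has_integral_powr_from_0[of "p - 2 * s - 1" c] assms that by (simp add: minus_divide_right)
  have L: "integrable lborel (\<lambda>r. indicator {0..c} r * r powr (p - 2 * s - 1))"
    "(LINT r|lborel. indicator {0..c} r * r powr (p - 2 * s - 1)) = c powr (p - 2 * s) / (p - 2 * s)"
    if "0 \<le> c" for c
    using nonneg_has_integral_lborel[OF _ _ _ hi[OF that]] by auto
  have eq: "indicator {\<kappa>..} r * r powr (- 1 - 2 * s) * (indicator {..a} r * r powr p)
      = indicator {\<kappa>..} r * (indicator {0..a} r * r powr (p - 2 * s - 1))" for r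
  proof (cases "\<kappa> \<le> r")
    case True
    then have "r powr (- 1 - 2 * s) * r powr p = r powr (p - 2 * s - 1)"
      using assms by (simp flip: powr_add add: algebra_simps)
    then show ?thesis using True assms by (auto simp: indicator_def)
  qed simp
  have le: "\<bar>indicator {\<kappa>..} r * r powr (- 1 - 2 * s) * (indicator {..a} r * r powr p)\<bar>
      \<le> indicator {0..a} r * r powr (p - 2 * s - 1)" for r
    unfolding eq by (auto simp: indicator_def abs_mult)
  have int: "integrable lborel (\<lambda>r. indicator {\<kappa>..} r * r powr (- 1 - 2 * s) * (indicator {..a} r * r powr p))"
    by (rule Bochner_Integration.integrable_bound[OF L(1)[of a]]) (use le assms in auto)
  then show "integrable (power_tail s \<kappa>) (\<lambda>r. indicator {..a} r * r powr p)"
    by (subst integrable_power_tail_iff) auto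
  have "(LINT r|power_tail s \<kappa>. indicator {..a} r * r powr p) \<le>
      (LINT r|lborel. indicator {0..a} r * r powr (p - 2 * s - 1))"
    by (subst integral_power_tail, simp)
      (intro integral_mono int L(1) order.trans[OF abs_ge_self le], use assms in auto)
  also have "\<dots> = a powr (p - 2 * s) / (p - 2 * s)" using assms by (intro L(2)) auto
  finally show "(LINT r|power_tail s \<kappa>. indicator {..a} r * r powr p) \<le> a powr (p - 2 * s) / (p - 2 * s)" .
  have "(a powr (p - 2 * s) - \<kappa> powr (p - 2 * s)) / (p - 2 * s) =
     (LINT r|lborel. indicator {0..a} r * r powr (p - 2 * s - 1) - indicator {0..\<kappa>} r * r powr (p - 2 * s - 1))"
    using assms L by (simp add: diff_divide_distrib)
  also have "\<dots> \<le> (LINT r|lborel. indicator {\<kappa>..} r * r powr (- 1 - 2 * s) * (indicator {..a} r * r powr p))"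
  proof (rule integral_mono[OF _ int])
    show "integrable lborel (\<lambda>r. indicator {0..a} r * r powr (p - 2 * s - 1) - indicator {0..\<kappa>} r * r powr (p - 2 * s - 1))"
      using assms by (intro Bochner_Integration.integrable_diff L) auto
    show "indicator {0..a} r * r powr (p - 2 * s - 1) - indicator {0..\<kappa>} r * r powr (p - 2 * s - 1)
        \<le> indicator {\<kappa>..} r * r powr (- 1 - 2 * s) * (indicator {..a} r * r powr p)" for r
      unfolding eq by (auto simp: indicator_def)
  qed
  finally show "(a powr (p - 2 * s) - \<kappa> powr (p - 2 * s)) / (p - 2 * s) \<le>
      (LINT r|power_tail s \<kappa>. indicator {..a} r * r powr p)"
    by (subst integral_power_tail) auto
qed

subsection \<open>One-dimensional second differences of powers\<close>

lemma one_minus_powr_bounds: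
  fixes s x :: real
  assumes "0 < s" "s < 1" "0 \<le> x" "x \<le> 1"
  shows "x \<le> x powr s" "x powr s \<le> 1"
  using assms powr_mono'[of s 1 x] powr_mono2[of s x 1] by (auto simp: powr_one)

text \<open>That \<open>t \<mapsto> (max 0 t) powr s\<close> is annihilated by the one-dimensional fractional Laplacian on
  \<open>{0<..}\<close> comes from two elementary facts: the substitution \<open>x = r / (1 + r)\<close> moves the
  part of the principal value integral over the far side onto \<open>{0<..<1}\<close>, and the resulting
  combined integrand is the derivative of \<open>(1 - (1 - x) powr s)\<^sup>2 * x powr (- 2 * s) / (2 * s)\<close>.\<close>
lemma integral_stretch_le:
  fixes s \<kappa> B :: real
  assumes s: "0 < s" "s < 1" and k: "0 < \<kappa>" "\<kappa> < B / (1 + B)" and B: "0 < B"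
  defines "q \<equiv> \<lambda>r. (1 - r) powr (s - 1) * (1 - (1 - r) powr s) * r powr (- 1 - 2 * s)"
  shows "((\<lambda>r. ((1 + r) powr s - 1) * r powr (- 1 - 2 * s)) has_integral
      (integral {\<kappa> / (1 + \<kappa>)..B / (1 + B)} q)) {\<kappa>..B}"
    and "(q has_integral
      (integral {\<kappa>..B / (1 + B)} (\<lambda>r. (1 - (1 - r) powr s) * r powr (- 1 - 2 * s))
        + (1 - (1 - B / (1 + B)) powr s)\<^sup>2 * (B / (1 + B)) powr (- 2 * s) / (2 * s)
        - (1 - (1 - \<kappa>) powr s)\<^sup>2 * \<kappa> powr (- 2 * s) / (2 * s))) {\<kappa>..B / (1 + B)}"
proof -
  have B1: "B / (1 + B) < 1" using B by simp
  have "B / (1 + B) < B" using B by (simp add: divide_simps)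
  then have kB: "\<kappa> < B" using k by linarith
  define g where "g = (\<lambda>r::real. r / (1 + r))"
  have gmono: "g x \<le> g y" if "0 < x" "x \<le> y" for x y
    using that by (simp add: g_def divide_simps algebra_simps)
  have gpos: "0 < g x" "g x < 1" if "0 < x" for x using that by (auto simp: g_def)
  have cont: "continuous_on {g \<kappa>..g B} q"
    unfolding q_def using gpos[of \<kappa>] gpos[of B] k B
    by (intro continuous_intros) auto
  have "((\<lambda>r. (1 / (1 + r)\<^sup>2) *\<^sub>R q (g r)) has_integral integral {g \<kappa>..g B} q) {\<kappa>..B}"
  proof (rule has_integral_substitution[OF _ _ _ cont])
    show "\<kappa> \<le> B" "g \<kappa> \<le> g B" using kB k by (auto intro: gmono)
    show "g ` {\<kappa>..B} \<subseteq> {g \<kappa>..g B}" using k by (auto intro!: gmono)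
    show "(g has_real_derivative 1 / (1 + x)\<^sup>2) (at x within {\<kappa>..B})" if "x \<in> {\<kappa>..B}" for x
      using that k unfolding g_def
      by (auto intro!: derivative_eq_intros simp: power2_eq_square field_simps)
  qed
  moreover have "(1 / (1 + r)\<^sup>2) *\<^sub>R q (g r) = ((1 + r) powr s - 1) * r powr (- 1 - 2 * s)"
    if "r \<in> {\<kappa>..B}" for r
  proof -
    have r: "0 < r" using that k by simp
    have 1: "1 - g r = inverse (1 + r)" using r by (simp add: g_def field_simps)
    define R where "R = 1 + r"
    have R: "0 < R" using r by (simp add: R_def)
    have i: "inverse R powr a = R powr (- a)" for a
      using R by (simp add: inverse_powr powr_minus)
    have d: "(r / R) powr a = r powr a * R powr (- a)" for a
      using R r by (simp add: powr_divide powr_minus field_simps)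
    have p2: "1 / R\<^sup>2 = R powr (- 2)"
      using R by (simp add: powr_minus powr_numeral divide_inverse)
    have "(1 / R\<^sup>2) * (inverse R powr (s - 1) * (1 - inverse R powr s) * (r / R) powr (- 1 - 2 * s)) =
       R powr (-2) * (R powr (1 - s) * (1 - R powr (- s)) * (r powr (- 1 - 2 * s) * R powr (1 + 2 * s)))"
      unfolding i d p2 by (simp add: algebra_simps)
    also have "\<dots> = (R powr (-2 + (1 - s) + (1 + 2 * s)) - R powr (-2 + (1 - s) + (- s) + (1 + 2 * s))) * r powr (- 1 - 2 * s)"
      by (simp only: powr_add) (simp add: algebra_simps)
    also have "\<dots> = (R powr s - 1) * r powr (- 1 - 2 * s)" using R by simp
    finally show ?thesis unfolding q_def 1 real_scaleR_def by (simp add: R_def g_def)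
  qed
  ultimately have "((\<lambda>r. ((1 + r) powr s - 1) * r powr (- 1 - 2 * s)) has_integral
      (integral {g \<kappa>..g B} q)) {\<kappa>..B}"
    by (rule has_integral_eq[rotated])
  then show "((\<lambda>r. ((1 + r) powr s - 1) * r powr (- 1 - 2 * s)) has_integral
      (integral {\<kappa> / (1 + \<kappa>)..B / (1 + B)} q)) {\<kappa>..B}"
    by (simp add: g_def)
  define G where "G = (\<lambda>r. (1 - (1 - r) powr s)\<^sup>2 * r powr (- 2 * s) / (2 * s))"
  have dG: "(G has_real_derivative (q r - (1 - (1 - r) powr s) * r powr (- 1 - 2 * s))) (at r)"
    if "0 < r" "r < 1" for r
  proof -
    define y where "y = 1 - r"
    have y: "0 < y" using that by (simp add: y_def)
    have "(G has_real_derivative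
        (2 * (1 - y powr s) * (s * y powr (s - 1)) * r powr (- 2 * s)
          + (1 - y powr s)\<^sup>2 * ((- 2 * s) * r powr (- 2 * s - 1))) / (2 * s)) (at r)"
      unfolding G_def y_def using that s
      by (auto intro!: derivative_eq_intros) (simp add: field_simps)
    moreover have "(2 * (1 - y powr s) * (s * y powr (s - 1)) * r powr (- 2 * s)
          + (1 - y powr s)\<^sup>2 * ((- 2 * s) * r powr (- 2 * s - 1))) / (2 * s)
       = (1 - y powr s) * (y powr (s - 1) * r powr (- 2 * s) - (1 - y powr s) * r powr (- 2 * s - 1))"
      using s by (simp add: field_simps power2_eq_square)
    moreover have "\<dots> = q r - (1 - (1 - r) powr s) * r powr (- 1 - 2 * s)"
    proof -
      have 1: "r powr (- 2 * s) = r * r powr (- 1 - 2 * s)"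
        using that powr_add[of r 1 "- 1 - 2 * s"] by simp
      have 2: "y powr s = y * y powr (s - 1)"
        using y powr_add[of y 1 "s - 1"] by simp
      have 3: "- 2 * s - 1 = - 1 - 2 * s" by simp
      have 4: "r = 1 - y" by (simp add: y_def)
      show ?thesis unfolding q_def y_def[symmetric] 3 1 unfolding 2
        by (simp add: 4) (simp add: algebra_simps)
    qed
    ultimately show ?thesis by simp
  qed
  have "((\<lambda>r. q r - (1 - (1 - r) powr s) * r powr (- 1 - 2 * s)) has_integral (G (B / (1 + B)) - G \<kappa>))
      {\<kappa>..B / (1 + B)}"
  proof (rule fundamental_theorem_of_calculus)
    fix x assume "x \<in> {\<kappa>..B / (1 + B)}"
    then have "0 < x" "x < 1" using k B1 by auto
    from dG[OF this] show "(G has_vector_derivative (q x - (1 - (1 - x) powr s) * x powr (- 1 - 2 * s)))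
        (at x within {\<kappa>..B / (1 + B)})"
      using has_vector_derivative_at_within by (simp add: has_real_derivative_iff_has_vector_derivative)
  qed (use k in simp)
  moreover have "(\<lambda>r. (1 - (1 - r) powr s) * r powr (- 1 - 2 * s)) integrable_on {\<kappa>..B / (1 + B)}"
    using k B1 by (intro integrable_continuous_interval continuous_intros) auto
  then have "((\<lambda>r. (1 - (1 - r) powr s) * r powr (- 1 - 2 * s)) has_integral
      integral {\<kappa>..B / (1 + B)} (\<lambda>r. (1 - (1 - r) powr s) * r powr (- 1 - 2 * s))) {\<kappa>..B / (1 + B)}"
    by (rule integrable_integral)
  ultimately have "((\<lambda>r. q r - (1 - (1 - r) powr s) * r powr (- 1 - 2 * s)
        + (1 - (1 - r) powr s) * r powr (- 1 - 2 * s)) has_integral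
      (G (B / (1 + B)) - G \<kappa> + integral {\<kappa>..B / (1 + B)} (\<lambda>r. (1 - (1 - r) powr s) * r powr (- 1 - 2 * s))))
      {\<kappa>..B / (1 + B)}"
    by (rule has_integral_add)
  then show "(q has_integral
      (integral {\<kappa>..B / (1 + B)} (\<lambda>r. (1 - (1 - r) powr s) * r powr (- 1 - 2 * s))
        + (1 - (1 - B / (1 + B)) powr s)\<^sup>2 * (B / (1 + B)) powr (- 2 * s) / (2 * s)
        - (1 - (1 - \<kappa>) powr s)\<^sup>2 * \<kappa> powr (- 2 * s) / (2 * s))) {\<kappa>..B / (1 + B)}"
    unfolding G_def diff_add_cancel by (simp only: add.commute add_diff_eq)
qed

lemma powr_add_subadditive:
  fixes x y s :: real
  assumes "0 < s" "s < 1" "0 \<le> x" "0 \<le> y"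
  shows "(x + y) powr s \<le> x powr s + y powr s"
proof (cases "x + y = 0")
  case False
  then have p: "0 < x + y" using assms by linarith
  have "1 = x / (x + y) + y / (x + y)" using p by (simp flip: add_divide_distrib)
  also have "\<dots> \<le> (x / (x + y)) powr s + (y / (x + y)) powr s"
    using assms p by (intro add_mono one_minus_powr_bounds) auto
  also have "\<dots> = (x powr s + y powr s) / (x + y) powr s"
    using assms p by (simp add: powr_divide add_divide_distrib)
  finally show ?thesis using p by (simp add: field_simps)
qed (use assms in auto)

text \<open>The far side \<open>(1 + r) powr s - 1\<close> becomes the integral of \<open>q\<close>,
  which equals the near side \<open>h\<close> on the common interval up to boundary terms. What does
  not cancel is explicit or has a sign: \<open>h\<close> on \<open>{B'..1}\<close> is nonnegative,
  \<open>h\<close> on \<open>{1..B}\<close> is a pure power, and a thin strip next to \<kappa> costs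
  the last term. The first fraction tends to 0 as \<open>B\<close> grows.\<close>

lemma integral_truncated_second_difference_ge:
  fixes s \<kappa> B :: real
  assumes s: "0 < s" "s < 1" and k: "0 < \<kappa>" "\<kappa> \<le> 1 / 2" and B: "1 < B"
  defines "f \<equiv> \<lambda>r. (2 - (1 + r) powr s - max 0 (1 - r) powr s) * r powr (- 1 - 2 * s)"
  shows "integral {\<kappa>..B} f \<ge>
    (1 - B powr (- 2 * s) - (B / (1 + B)) powr (- 2 * s)) / (2 * s) - 8 * \<kappa> powr (2 - 2 * s)"
proof -
  define q where "q = (\<lambda>r. (1 - r) powr (s - 1) * (1 - (1 - r) powr s) * r powr (- 1 - 2 * s))"
  define B' where "B' = B / (1 + B)"
  define k' where "k' = \<kappa> / (1 + \<kappa>)"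
  define h where "h = (\<lambda>r. (1 - max 0 (1 - r) powr s) * r powr (- 1 - 2 * s))"
  have B': "1 / 2 < B'" "B' < 1" using B by (auto simp: B'_def field_simps)
  have k': "0 < k'" "k' < \<kappa>" "\<kappa> / 2 \<le> k'" "\<kappa> - k' \<le> \<kappa>\<^sup>2"
    using k by (auto simp: k'_def field_simps power2_eq_square)
  have kB: "\<kappa> < B / (1 + B)" using B' k unfolding B'_def by linarith
  have B0: "0 < B" using B by simp
  note S = integral_stretch_le[OF s k(1) kB B0, folded q_def B'_def k'_def]
  have contq: "continuous_on {k'..B'} q"
    unfolding q_def using k' B' by (intro continuous_intros) auto
  have conth: "continuous_on {\<kappa>..B} h"
    unfolding h_def using k s by (intro continuous_intros continuous_on_powr') auto
  have intq: "q integrable_on {k'..B'}" using contq by (rule integrable_continuous_interval)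
  have inth: "h integrable_on {\<kappa>..B}" using conth by (rule integrable_continuous_interval)
  have q1: "integral {k'..B'} q = integral {k'..\<kappa>} q + integral {\<kappa>..B'} q"
    using k k' B' by (intro Henstock_Kurzweil_Integration.integral_combine[symmetric] intq) auto
  \<comment> \<open>The substitution moves the truncation point from \<kappa> to
    \<open>\<kappa> / (1 + \<kappa>)\<close>. The mismatch has width at most
    \<open>\<kappa>\<^sup>2\<close>, and there \<open>q\<close> is of size
    \<open>r powr (- 2 * s)\<close>.\<close>
  have "integral {k'..\<kappa>} q \<le> integral {k'..\<kappa>} (\<lambda>r. 2 * k' powr (- 2 * s))"
  proof (rule integral_le)
    show "q integrable_on {k'..\<kappa>}" using intq k B' by (rule_tac integrable_on_subinterval) auto
    fix r assume r: "r \<in> {k'..\<kappa>}"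
    then have r': "0 < r" "r \<le> 1 / 2" using k k' by auto
    have 1: "(1 - r) powr (s - 1) \<le> 2"
    proof -
      have "(1 - r) powr (s - 1) \<le> (1 / 2) powr (s - 1)"
        using r' s by (intro powr_mono2') auto
      also have "\<dots> \<le> (1 / 2) powr (- 1)" using s by (intro powr_mono') auto
      also have "\<dots> = 2" by (simp add: powr_minus)
      finally show ?thesis .
    qed
    have 2: "0 \<le> 1 - (1 - r) powr s" "1 - (1 - r) powr s \<le> r"
      using one_minus_powr_bounds[OF s, of "1 - r"] r' by auto
    have "q r \<le> 2 * r * r powr (- 1 - 2 * s)"
      unfolding q_def using 1 2 r' by (intro mult_right_mono mult_mono) auto
    also have "\<dots> = 2 * r powr (- 2 * s)"
      using r' powr_add[of r 1 "- 1 - 2 * s"] by simp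
    also have "\<dots> \<le> 2 * k' powr (- 2 * s)"
      using r k' s by (intro mult_left_mono powr_mono2') auto
    finally show "q r \<le> 2 * k' powr (- 2 * s)" .
  qed auto
  also have "\<dots> = (\<kappa> - k') * (2 * k' powr (- 2 * s))" using k' by simp
  also have "\<dots> \<le> \<kappa>\<^sup>2 * (2 * (\<kappa> / 2) powr (- 2 * s))"
    using k k' s by (intro mult_mono mult_left_mono powr_mono2') auto
  also have "\<dots> = 2 * 2 powr (2 * s) * \<kappa> powr (2 - 2 * s)"
  proof -
    have "(\<kappa> / 2) powr (- 2 * s) = \<kappa> powr (- 2 * s) * 2 powr (2 * s)"
      using k by (simp add: powr_divide powr_minus field_simps)
    moreover have "\<kappa>\<^sup>2 * \<kappa> powr (- 2 * s) = \<kappa> powr (2 - 2 * s)"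
      using k by (simp add: powr_diff powr_minus powr_numeral field_simps)
    ultimately show ?thesis by (simp add: algebra_simps)
  qed
  also have "\<dots> \<le> 2 * 2 powr 2 * \<kappa> powr (2 - 2 * s)"
    using s by (intro mult_right_mono mult_left_mono powr_mono) auto
  finally have q2: "integral {k'..\<kappa>} q \<le> 8 * \<kappa> powr (2 - 2 * s)" by simp
  have hB: "integral {\<kappa>..B'} (\<lambda>r. (1 - (1 - r) powr s) * r powr (- 1 - 2 * s)) = integral {\<kappa>..B'} h"
    unfolding h_def using B' by (intro Henstock_Kurzweil_Integration.integral_cong) auto
  have G1: "(1 - (1 - B') powr s)\<^sup>2 * B' powr (- 2 * s) / (2 * s) \<le> B' powr (- 2 * s) / (2 * s)"
    using one_minus_powr_bounds[OF s, of "1 - B'"] B' s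
    by (intro divide_right_mono mult_left_le_one_le power_le_one) auto
  have G2: "0 \<le> (1 - (1 - \<kappa>) powr s)\<^sup>2 * \<kappa> powr (- 2 * s) / (2 * s)" using s by simp
  have q3: "integral {\<kappa>..B'} q \<le> integral {\<kappa>..B'} h + B' powr (- 2 * s) / (2 * s)"
    using integral_unique[OF S(2)] G1 G2 unfolding hB by linarith
  have h1: "integral {\<kappa>..B} h = integral {\<kappa>..B'} h + integral {B'..1} h + integral {1..B} h"
  proof -
    have "integral {\<kappa>..B} h = integral {\<kappa>..1} h + integral {1..B} h"
      using k B by (intro Henstock_Kurzweil_Integration.integral_combine[symmetric] inth) auto
    also have "integral {\<kappa>..1} h = integral {\<kappa>..B'} h + integral {B'..1} h"
      using k B B' integrable_on_subinterval[OF inth]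
      by (intro Henstock_Kurzweil_Integration.integral_combine[symmetric]) auto
    finally show ?thesis .
  qed
  have h2: "0 \<le> integral {B'..1} h"
  proof (rule Henstock_Kurzweil_Integration.integral_nonneg)
    show "h integrable_on {B'..1}" using integrable_on_subinterval[OF inth] B' B k by auto
    show "0 \<le> h x" if "x \<in> {B'..1}" for x
      using that B' one_minus_powr_bounds[OF s, of "1 - x"] by (auto simp: h_def)
  qed
  have h3: "integral {1..B} h = (1 - B powr (- 2 * s)) / (2 * s)"
  proof (rule integral_unique)
    have "((\<lambda>r. r powr (- 1 - 2 * s)) has_integral
        (B powr (- 2 * s) / (- 2 * s) - 1 powr (- 2 * s) / (- 2 * s))) {1..B}"
      using B s
      by (intro fundamental_theorem_of_calculus)
        (auto intro!: derivative_eq_intros simp flip: has_real_derivative_iff_has_vector_derivative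
          simp: algebra_simps, rule arg_cong2[where f = "(powr)"], simp_all)
    then have "((\<lambda>r. r powr (- 1 - 2 * s)) has_integral (1 - B powr (- 2 * s)) / (2 * s)) {1..B}"
      by (simp add: diff_divide_distrib)
    then show "(h has_integral (1 - B powr (- 2 * s)) / (2 * s)) {1..B}"
      by (rule has_integral_eq[rotated]) (auto simp: h_def)
  qed
  have "((\<lambda>r. h r - ((1 + r) powr s - 1) * r powr (- 1 - 2 * s)) has_integral
     (integral {\<kappa>..B} h - integral {k'..B'} q)) {\<kappa>..B}"
    by (intro has_integral_diff integrable_integral inth S(1))
  moreover have "(\<lambda>r. h r - ((1 + r) powr s - 1) * r powr (- 1 - 2 * s)) = f"
    by (auto simp: h_def f_def algebra_simps)
  ultimately have "integral {\<kappa>..B} f = integral {\<kappa>..B} h - integral {k'..B'} q"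
    by (simp add: integral_unique)
  then show ?thesis
    unfolding B'_def[symmetric] diff_divide_distrib using q1 q2 q3 h1 h2 h3[unfolded diff_divide_distrib] by linarith
qed

text \<open>The normalised case, obtained for small \<kappa> by letting \<open>B\<close> tend to
  infinity in the truncated estimate, whose bracket then tends to \<open>1 - 0 - 1 = 0\<close>. The
  summand \<open>4 / s\<close> comes from large \<kappa>.\<close>

lemma power_tail_second_difference_ge_aux:
  fixes s \<kappa> :: real
  assumes s: "0 < s" "s < 1" and k: "0 < \<kappa>"
  defines "f \<equiv> \<lambda>r. 2 - (1 + r) powr s - max 0 (1 - r) powr s"
  shows "integrable (power_tail s \<kappa>) f"
    and "- (8 + 4 / s) * \<kappa> powr (2 - 2 * s) \<le> (LINT r|power_tail s \<kappa>. f r)"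
proof -
  interpret finite_measure "power_tail s \<kappa>" by (rule finite_measure_power_tail) (use s k in auto)
  have [measurable]: "f \<in> borel_measurable borel" unfolding f_def by measurable
  have tail: "integrable (power_tail s \<kappa>) (\<lambda>r. indicator {\<kappa>..} r * r powr s)"
    "(LINT r|power_tail s \<kappa>. indicator {\<kappa>..} r * r powr s) \<le> \<kappa> powr (- s) / s"
    using power_tail_upper[of \<kappa> \<kappa> s s] s k by auto
  have lower: "- (r powr s) \<le> f r" and upper: "f r \<le> 2" if "0 < r" for r
  proof -
    have "(1 + r) powr s \<le> 1 + r powr s" using powr_add_subadditive[OF s, of 1 r] that by simp
    moreover have "max 0 (1 - r) powr s \<le> 1" using that s by (intro powr_le1) auto
    moreover have "0 \<le> (1 + r) powr s" "0 \<le> max 0 (1 - r) powr s" by auto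
    ultimately show "- (r powr s) \<le> f r" "f r \<le> 2" unfolding f_def by linarith+
  qed
  show int: "integrable (power_tail s \<kappa>) f"
  proof (rule Bochner_Integration.integrable_bound)
    show "integrable (power_tail s \<kappa>) (\<lambda>r. 2 + indicator {\<kappa>..} r * r powr s)"
      using tail by (intro Bochner_Integration.integrable_add) auto
    show "AE r in power_tail s \<kappa>. norm (f r) \<le> norm (2 + indicator {\<kappa>..} r * r powr s)"
      using AE_power_tail
    proof eventually_elim
      case (elim r)
      then show ?case using lower[of r] upper[of r] k by (simp add: abs_le_iff) (smt (verit) powr_ge_zero)
    qed
  qed auto
  show "- (8 + 4 / s) * \<kappa> powr (2 - 2 * s) \<le> (LINT r|power_tail s \<kappa>. f r)"
  proof (cases "\<kappa> \<le> 1 / 2")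
    case True
    define L where "L = (\<lambda>B. (1 - B powr (- 2 * s) - (B / (1 + B)) powr (- 2 * s)) / (2 * s)
      - 8 * \<kappa> powr (2 - 2 * s))"
    have ev: "eventually (\<lambda>B. L B \<le> (LINT r|power_tail s \<kappa>. indicator {..B} r *\<^sub>R f r)) at_top"
      using eventually_gt_at_top[of 1]
    proof eventually_elim
      case (elim B)
      have "continuous_on {\<kappa>..B} (\<lambda>r. f r * r powr (- 1 - 2 * s))"
        unfolding f_def using k s by (intro continuous_intros continuous_on_powr') auto
      then have "set_integrable lborel {\<kappa>..B} (\<lambda>r. f r * r powr (- 1 - 2 * s))"
        by (intro borel_integrable_compact[unfolded set_integrable_def[symmetric]]) auto
      then have "integral {\<kappa>..B} (\<lambda>r. f r * r powr (- 1 - 2 * s)) =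
          (LINT r:{\<kappa>..B}|lborel. f r * r powr (- 1 - 2 * s))"
        using set_borel_integral_eq_integral(2) by metis
      also have "\<dots> = (LINT r|power_tail s \<kappa>. indicator {..B} r *\<^sub>R f r)"
        unfolding set_lebesgue_integral_def
        by (subst integral_power_tail) (auto intro!: Bochner_Integration.integral_cong simp: indicator_def)
      finally show ?case
        using integral_truncated_second_difference_ge[OF s k True elim] unfolding L_def f_def by simp
    qed
    have "(L \<longlongrightarrow> (1 - 0 - 1 powr (- 2 * s)) / (2 * s) - 8 * \<kappa> powr (2 - 2 * s)) at_top"
      unfolding L_def
    proof (intro tendsto_intros)
      show "((\<lambda>B. B powr (- 2 * s)) \<longlongrightarrow> 0) at_top"
        using s by (intro tendsto_neg_powr filterlim_ident) auto
      show "((\<lambda>B::real. B / (1 + B)) \<longlongrightarrow> 1) at_top"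
      proof (rule Lim_transform_eventually)
        show "((\<lambda>B::real. 1 - inverse (1 + B)) \<longlongrightarrow> 1) at_top"
          by (rule tendsto_eq_intros tendsto_inverse_0_at_top
              filterlim_tendsto_add_at_top[OF tendsto_const filterlim_ident] | simp)+
        show "eventually (\<lambda>B::real. 1 - inverse (1 + B) = B / (1 + B)) at_top"
          using eventually_gt_at_top[of 0] by eventually_elim (simp add: field_simps)
      qed
    qed (use s in auto)
    then have "- 8 * \<kappa> powr (2 - 2 * s) \<le> (LINT r|power_tail s \<kappa>. f r)"
      using tendsto_le[OF _ tendsto_integral_at_top[OF _ int] _ ev] by simp
    moreover have "0 \<le> 4 / s * \<kappa> powr (2 - 2 * s)" using s by simp
    ultimately show ?thesis by (simp add: algebra_simps)
  next
    case False
    have "\<kappa> powr (- s) = \<kappa> powr (s - 2) * \<kappa> powr (2 - 2 * s)" by (simp flip: powr_add)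
    also have "\<dots> \<le> (1 / 2) powr (s - 2) * \<kappa> powr (2 - 2 * s)"
      using False s by (intro mult_right_mono powr_mono2') auto
    also have "\<dots> \<le> (1 / 2) powr (- 2) * \<kappa> powr (2 - 2 * s)"
      using s by (intro mult_right_mono powr_mono') auto
    also have "\<dots> = 4 * \<kappa> powr (2 - 2 * s)" by (simp add: powr_minus powr_numeral power2_eq_square)
    finally have "\<kappa> powr (- s) / s \<le> 4 / s * \<kappa> powr (2 - 2 * s)"
      using s by (simp add: divide_right_mono)
    moreover have "- (LINT r|power_tail s \<kappa>. f r) \<le> (LINT r|power_tail s \<kappa>. indicator {\<kappa>..} r * r powr s)"
      unfolding Bochner_Integration.integral_minus[symmetric]
    proof (rule integral_mono_AE)
      show "AE r in power_tail s \<kappa>. - f r \<le> indicator {\<kappa>..} r * r powr s"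
        using AE_power_tail by eventually_elim (use lower k in \<open>force simp: minus_le_iff\<close>)
    qed (use tail int in auto)
    moreover have "0 \<le> 8 * \<kappa> powr (2 - 2 * s)" by simp
    moreover have "- (8 + 4 / s) * \<kappa> powr (2 - 2 * s) = - (8 * \<kappa> powr (2 - 2 * s)) - 4 / s * \<kappa> powr (2 - 2 * s)"
      by (simp add: algebra_simps)
    ultimately show ?thesis using tail(2) by linarith
  qed
qed

text \<open>The density has degree \<open>- 1 - 2 * s\<close> and \<open>dr\<close> has degree
  \<open>1\<close>, whence the factor \<open>a powr (2 * s)\<close>.\<close>

lemma power_tail_stretch:
  fixes f :: "real \<Rightarrow> real"
  assumes "0 < a" and [measurable]: "f \<in> borel_measurable borel"
  shows "integrable (power_tail s (a * \<kappa>)) f \<Longrightarrow> integrable (power_tail s \<kappa>) (\<lambda>r. f (a * r))"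
    and "(LINT r|power_tail s \<kappa>. f (a * r)) = a powr (2 * s) * (LINT r|power_tail s (a * \<kappa>). f r)"
proof -
  define g where "g = (\<lambda>r. indicator {a * \<kappa>..} r * r powr (- 1 - 2 * s) * f r)"
  have eq: "g (0 + a * r) = a powr (- 1 - 2 * s) * (indicator {\<kappa>..} r * r powr (- 1 - 2 * s) * f (a * r))" for r
    using assms by (auto simp: g_def indicator_def powr_mult)
  show "integrable (power_tail s \<kappa>) (\<lambda>r. f (a * r))" if "integrable (power_tail s (a * \<kappa>)) f"
  proof -
    have "integrable lborel g" using that by (subst (asm) integrable_power_tail_iff) (auto simp: g_def)
    then have "integrable lborel (\<lambda>r. g (0 + a * r))" by (rule lborel_integrable_real_affine) (use assms in auto)
    then show ?thesis unfolding eq using assms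
      by (subst integrable_power_tail_iff) auto
  qed
  have "(LINT r|power_tail s (a * \<kappa>). f r) = (LINT r|lborel. g r)"
    by (subst integral_power_tail) (auto simp: g_def)
  also have "\<dots> = a * (LINT r|lborel. g (0 + a * r))"
    using assms by (subst lborel_integral_real_affine[of a _ 0]) auto
  also have "\<dots> = a * a powr (- 1 - 2 * s) * (LINT r|power_tail s \<kappa>. f (a * r))"
    unfolding eq by (subst integral_power_tail) auto
  finally have *: "(LINT r|power_tail s (a * \<kappa>). f r) = a * a powr (- 1 - 2 * s) * (LINT r|power_tail s \<kappa>. f (a * r))" .
  have "a * a powr (- 1 - 2 * s) = a powr (- 2 * s)"
    using assms powr_add[of a 1 "- 1 - 2 * s"] by simp
  then have "a powr (2 * s) * (a * a powr (- 1 - 2 * s)) = 1"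
    using assms by (simp flip: powr_add)
  then show "(LINT r|power_tail s \<kappa>. f (a * r)) = a powr (2 * s) * (LINT r|power_tail s (a * \<kappa>). f r)"
    unfolding * by (simp flip: mult.assoc)
qed

text \<open>Stretching by \<open>c / t\<close> reduces to \<open>t = c = 1\<close> with the
  truncation moved to \<open>c / t * \<kappa>\<close>. The powers of \<open>c\<close> that come out
  combine to \<open>c\<^sup>2 \<le> 1\<close>, so the error is uniform in the slope;
  \<open>c = 0\<close> admits no stretching and is trivial.\<close>

lemma power_tail_second_difference_ge:
  fixes s \<kappa> t c :: real
  assumes s: "0 < s" "s < 1" and k: "0 < \<kappa>" and t: "0 < t" and c: "0 \<le> c" "c \<le> 1"
  defines "f \<equiv> \<lambda>r. 2 * t powr s - (t + c * r) powr s - max 0 (t - c * r) powr s"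
  shows "integrable (power_tail s \<kappa>) f"
    and "- (8 + 4 / s) * t powr (s - 2) * \<kappa> powr (2 - 2 * s) \<le> (LINT r|power_tail s \<kappa>. f r)"
proof -
  have "integrable (power_tail s \<kappa>) f \<and>
    - (8 + 4 / s) * t powr (s - 2) * \<kappa> powr (2 - 2 * s) \<le> (LINT r|power_tail s \<kappa>. f r)"
  proof (cases "c = 0")
    case True
    then have "f = (\<lambda>_. 0)" using t by (auto simp: f_def)
    moreover have "0 \<le> (8 + 4 / s) * t powr (s - 2) * \<kappa> powr (2 - 2 * s)" using s by auto
    ultimately show ?thesis unfolding mult_minus_left by simp
  next
    case False
    then have c0: "0 < c" using c by simp
    define a where "a = c / t"
    have a: "0 < a" using t c0 by (simp add: a_def)
    define g where "g = (\<lambda>r. 2 - (1 + r) powr s - max 0 (1 - r) powr s)"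
    have [measurable]: "g \<in> borel_measurable borel" unfolding g_def by measurable
    have ak: "0 < a * \<kappa>" using a k by simp
    note A = power_tail_second_difference_ge_aux[OF s ak, folded g_def]
    have f: "f r = t powr s * g (a * r)" if r: "0 < r" for r
    proof -
      have "t + c * r = t * (1 + a * r)" "max 0 (t - c * r) = t * max 0 (1 - a * r)"
        using t by (auto simp: a_def field_simps max_def)
      then have "(t + c * r) powr s = t powr s * (1 + a * r) powr s"
        "max 0 (t - c * r) powr s = t powr s * max 0 (1 - a * r) powr s"
        using t r a by (simp_all only: powr_mult)
      then show ?thesis unfolding f_def g_def by (simp only: right_diff_distrib mult.commute)
    qed
    have ae: "AE r in power_tail s \<kappa>. f r = t powr s * g (a * r)"
      using AE_power_tail by eventually_elim (use f k in auto)
    have [measurable]: "f \<in> borel_measurable borel" unfolding f_def by measurable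
    have int: "integrable (power_tail s \<kappa>) (\<lambda>r. t powr s * g (a * r))"
      using power_tail_stretch(1)[OF a _ A(1)] by auto
    define K where "K = 8 + 4 / s"
    have K: "0 \<le> K" using s by (simp add: K_def)
    define X where "X = t powr (s - 2) * \<kappa> powr (2 - 2 * s)"
    have X: "0 \<le> X" by (simp add: X_def)
    have eq: "t powr s * (a powr (2 * s) * (a * \<kappa>) powr (2 - 2 * s)) = X * c\<^sup>2"
    proof -
      have "a powr (2 * s) * (a * \<kappa>) powr (2 - 2 * s) = a\<^sup>2 * \<kappa> powr (2 - 2 * s)"
        using a k by (simp add: powr_mult powr_diff powr_numeral)
      then show ?thesis using t by (simp add: X_def a_def powr_diff powr_numeral power_divide)
    qed
    have "- K * X \<le> - K * (X * c\<^sup>2)"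
      using K X c by (auto intro!: mult_left_mono mult_left_le power_le_one)
    also have "\<dots> = t powr s * (a powr (2 * s) * (- K * (a * \<kappa>) powr (2 - 2 * s)))"
      unfolding eq[symmetric] by (simp only: ac_simps)
    also have "\<dots> \<le> t powr s * (LINT r|power_tail s \<kappa>. g (a * r))"
      unfolding power_tail_stretch(2)[OF a \<open>g \<in> borel_measurable borel\<close>] using A(2)
      by (intro mult_left_mono) (auto simp: K_def)
    also have "\<dots> = (LINT r|power_tail s \<kappa>. f r)"
      by (subst integral_cong_AE[OF _ _ ae]) auto
    finally have "- K * X \<le> (LINT r|power_tail s \<kappa>. f r)" .
    moreover have "integrable (power_tail s \<kappa>) f"
      using int by (subst integrable_cong_AE[OF _ _ ae]) auto
    ultimately show ?thesis by (simp add: K_def X_def mult.assoc)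
  qed
  then show "integrable (power_tail s \<kappa>) f"
    "- (8 + 4 / s) * t powr (s - 2) * \<kappa> powr (2 - 2 * s) \<le> (LINT r|power_tail s \<kappa>. f r)" by auto
qed

subsection \<open>Smooth bumps\<close>

text \<open>The classical flat function is the case \<open>k = 0\<close>. The powers of
  \<open>inverse t\<close> are included because derivatives then stay in the span of the
  family.\<close>

definition exp_inv :: "nat \<Rightarrow> real \<Rightarrow> real" where
  "exp_inv k t = (if 0 < t then inverse t ^ k * exp (- inverse t) else 0)"

lemma exp_inv_nonneg: "0 \<le> exp_inv k t"
  by (simp add: exp_inv_def)

lemma exp_inv_le: "exp_inv k t \<le> fact k"
proof (cases "0 < t")
  case True
  define x where "x = inverse t"
  have x: "0 < x" using True by (simp add: x_def)
  have "x ^ k / fact k \<le> exp x"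
  proof -
    have "(\<Sum>n\<in>{k}. inverse (fact n) * x ^ n) \<le> (\<Sum>n. inverse (fact n) * x ^ n)"
      using x by (intro sum_le_suminf summable_exp) auto
    then show ?thesis by (simp add: exp_def field_simps)
  qed
  then show ?thesis using True by (simp add: exp_inv_def flip: x_def) (simp add: exp_minus field_simps)
qed (simp add: exp_inv_def)

text \<open>Trading an index for a factor \<open>t\<close> expresses flatness at \<open>0\<close>:
  two trades turn the difference quotient at \<open>0\<close> into
  \<open>h * exp_inv (k + 2) h\<close>, which is small because the family is bounded.\<close>

lemma exp_inv_shift: "exp_inv k t = t * exp_inv (Suc k) t"
  by (simp add: exp_inv_def)

lemma exp_inv_has_derivative:
  "(exp_inv k has_real_derivative exp_inv (k + 2) t - real k * exp_inv (k + 1) t) (at t)"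
proof -
  consider "0 < t" | "t < 0" | "t = 0" by linarith
  then show ?thesis
  proof cases
    case 1
    have "((\<lambda>t. inverse t ^ k * exp (- inverse t)) has_real_derivative
        exp_inv (k + 2) t - real k * exp_inv (k + 1) t) (at t)"
      using 1 by (cases k) (auto intro!: derivative_eq_intros simp: exp_inv_def field_simps power2_eq_square,
          metis One_nat_def power_eq_if)
    then show ?thesis
      by (rule has_field_derivative_transform_within_open[where S = "{0<..}"]) (use 1 in \<open>auto simp: exp_inv_def\<close>)
  next
    case 2
    have "((\<lambda>t. 0) has_real_derivative exp_inv (k + 2) t - real k * exp_inv (k + 1) t) (at t)"
      using 2 by (simp add: exp_inv_def)
    then show ?thesis
      by (rule has_field_derivative_transform_within_open[where S = "{..<0}"]) (use 2 in \<open>auto simp: exp_inv_def\<close>)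
  next
    case 3
    have "((\<lambda>h. (exp_inv k (0 + h) - exp_inv k 0) / h) \<longlongrightarrow> 0) (at 0)"
    proof (rule Lim_null_comparison)
      show "eventually (\<lambda>h. norm ((exp_inv k (0 + h) - exp_inv k 0) / h) \<le> \<bar>h\<bar> * fact (k + 2)) (at 0)"
      proof (rule always_eventually, rule allI)
        fix h
        have "exp_inv k h / h = h * exp_inv (k + 2) h"
          using exp_inv_shift[of k h] exp_inv_shift[of "Suc k" h] by (cases "h = 0") auto
        then show "norm ((exp_inv k (0 + h) - exp_inv k 0) / h) \<le> \<bar>h\<bar> * fact (k + 2)"
          using exp_inv_le[of "k + 2" h] exp_inv_nonneg[of "k + 2" h]
          by (simp add: exp_inv_def[of k 0] abs_mult mult_left_mono)
      qed
      show "((\<lambda>h::real. \<bar>h\<bar> * fact (k + 2)) \<longlongrightarrow> 0) (at 0)"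
        by (auto intro!: tendsto_eq_intros)
    qed
    then show ?thesis unfolding 3 has_field_derivative_def DERIV_def[symmetric]
      by (simp add: DERIV_def exp_inv_def)
  qed
qed

inductive bump_algebra :: "('a::euclidean_space \<Rightarrow> real) \<Rightarrow> bool" where
  exp_inv: "bump_algebra (\<lambda>y. exp_inv k (a - (y - c) \<bullet> (y - c)))"
| const: "bump_algebra (\<lambda>y. b)"
| inner: "bump_algebra (\<lambda>y. y \<bullet> v)"
| add: "bump_algebra f \<Longrightarrow> bump_algebra g \<Longrightarrow> bump_algebra (\<lambda>y. f y + g y)"
| mult: "bump_algebra f \<Longrightarrow> bump_algebra g \<Longrightarrow> bump_algebra (\<lambda>y. f y * g y)"

lemma bump_algebra_has_derivative:
  "bump_algebra f \<Longrightarrow> \<exists>f'. (\<forall>x. (f has_derivative (\<lambda>v. f' v x)) (at x)) \<and> (\<forall>v. bump_algebra (f' v))"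
proof (induction rule: bump_algebra.induct)
  case (exp_inv k a c)
  define f' where "f' = (\<lambda>v y. (exp_inv (k + 2) (a - (y - c) \<bullet> (y - c)) +
    (- real k) * exp_inv (k + 1) (a - (y - c) \<bullet> (y - c))) * (- 2 * (y \<bullet> v + - (c \<bullet> v))))"
  have "((\<lambda>y. exp_inv k (a - (y - c) \<bullet> (y - c))) has_derivative (\<lambda>v. f' v x)) (at x)" for x
  proof -
    have "((\<lambda>y. a - (y - c) \<bullet> (y - c)) has_derivative (\<lambda>v. - 2 * (x \<bullet> v + - (c \<bullet> v)))) (at x)"
      by (auto intro!: derivative_eq_intros simp: inner_simps inner_commute algebra_simps)
    from has_derivative_compose[OF this exp_inv_has_derivative[unfolded has_field_derivative_def]]
    show ?thesis by (simp add: f'_def mult.commute)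
  qed
  moreover have "bump_algebra (f' v)" for v
    unfolding f'_def by (intro bump_algebra.intros)
  ultimately show ?case by blast
next
  case (const b)
  then show ?case by (intro exI[of _ "\<lambda>v y. 0"]) (auto intro: bump_algebra.intros)
next
  case (inner v)
  then show ?case
    by (intro exI[of _ "\<lambda>w y. w \<bullet> v"]) (auto intro!: bump_algebra.intros derivative_eq_intros)
next
  case (add f g)
  then obtain f' g' where
    "\<And>x. (f has_derivative (\<lambda>v. f' v x)) (at x)" "\<And>v. bump_algebra (f' v)"
    "\<And>x. (g has_derivative (\<lambda>v. g' v x)) (at x)" "\<And>v. bump_algebra (g' v)" by blast
  then show ?case
    by (intro exI[of _ "\<lambda>v y. f' v y + g' v y"]) (auto intro!: bump_algebra.intros has_derivative_add)
next
  case (mult f g)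
  then obtain f' g' where
    "\<And>x. (f has_derivative (\<lambda>v. f' v x)) (at x)" "\<And>v. bump_algebra (f' v)"
    "\<And>x. (g has_derivative (\<lambda>v. g' v x)) (at x)" "\<And>v. bump_algebra (g' v)" by blast
  with mult.hyps show ?case
    by (intro exI[of _ "\<lambda>v y. f y * g' v y + f' v y * g y"]) (auto intro!: bump_algebra.intros has_derivative_mult)
qed

lemma bump_algebra_iter_dderiv: "bump_algebra f \<Longrightarrow> bump_algebra (iter_dderiv f vs)"
proof (induction vs)
  case (Cons v vs)
  then obtain g' where g': "\<And>x. (iter_dderiv f vs has_derivative (\<lambda>v. g' v x)) (at x)" "\<And>v. bump_algebra (g' v)"
    using bump_algebra_has_derivative by blast
  have "iter_dderiv f (v # vs) = g' v"
    by (simp flip: frechet_derivative_at[OF g'(1)])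
  then show ?case using g'(2) by simp
qed simp

lemma bump_algebra_smooth: "bump_algebra f \<Longrightarrow> smooth_fun f"
  unfolding smooth_fun_def
proof
  fix vs assume "bump_algebra f"
  then obtain g' where g': "\<And>x. (iter_dderiv f vs has_derivative (\<lambda>v. g' v x)) (at x)"
    using bump_algebra_has_derivative[OF bump_algebra_iter_dderiv] by blast
  then show "iter_dderiv f vs differentiable_on UNIV"
    unfolding differentiable_on_def differentiable_def by blast
qed

text \<open>Left unnormalised: its integral appears as a common factor on both sides of the final
  estimate and cancels.\<close>

definition bump :: "real \<Rightarrow> 'a::euclidean_space \<Rightarrow> real" where
  "bump \<delta> y = exp_inv 0 (\<delta>\<^sup>2 - y \<bullet> y)"

lemma bump_nonneg: "0 \<le> bump \<delta> y" and bump_le_1: "bump \<delta> y \<le> 1"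
  using exp_inv_nonneg[of 0 "\<delta>\<^sup>2 - y \<bullet> y"] exp_inv_le[of 0 "\<delta>\<^sup>2 - y \<bullet> y"] by (auto simp: bump_def)

lemma bump_minus [simp]: "bump \<delta> (- y) = bump \<delta> y"
  by (simp add: bump_def)

lemma bump_pos_iff: "0 < \<delta> \<Longrightarrow> 0 < bump \<delta> y \<longleftrightarrow> norm y < \<delta>"
  using power_mono_iff[of \<delta> "norm y" 2] by (simp add: bump_def exp_inv_def dot_square_norm not_le[symmetric])

lemma bump_eq_0_iff: "0 < \<delta> \<Longrightarrow> bump \<delta> y = 0 \<longleftrightarrow> \<delta> \<le> norm y"
  using bump_pos_iff[of \<delta> y] bump_nonneg[of \<delta> y] by linarith

lemma continuous_on_exp_inv: "continuous_on S (exp_inv k)"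
  using exp_inv_has_derivative[of k] by (meson DERIV_isCont continuous_at_imp_continuous_on)

lemma continuous_on_bump: "continuous_on S (bump \<delta>)"
  unfolding bump_def by (intro continuous_on_compose2[OF continuous_on_exp_inv[of UNIV]] continuous_intros) auto

lemma borel_measurable_bump [measurable]: "bump \<delta> \<in> borel_measurable borel"
  by (rule borel_measurable_continuous_onI[OF continuous_on_bump])

lemma test_fun_bump:
  fixes x :: "'a::euclidean_space"
  assumes "0 < \<delta>" "cball x \<delta> \<subseteq> \<Omega>"
  shows "test_fun \<Omega> (\<lambda>y. bump \<delta> (y - x))"
proof -
  have "{y. bump \<delta> (y - x) \<noteq> 0} = ball x \<delta>"
    using assms by (auto simp: bump_eq_0_iff dist_norm norm_minus_commute not_le)
  moreover have "smooth_fun (\<lambda>y. bump \<delta> (y - x))"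
    unfolding bump_def by (intro bump_algebra_smooth bump_algebra.intros)
  ultimately show ?thesis using assms by (simp add: test_fun_def)
qed

text \<open>On the segment from \<open>y - h\<close> to \<open>y + h\<close> the mean value theorem
  is applied three times, to the two first differences and then to the derivative. The two
  intermediate points are at distance at most 2, which doubles the bound on the second
  derivative.\<close>

lemma bump_second_difference:
  fixes y h :: "'a::euclidean_space"
  assumes "0 < \<delta>"
  shows "\<bar>2 * bump \<delta> y - bump \<delta> (y + h) - bump \<delta> (y - h)\<bar> \<le> (288 * \<delta>\<^sup>2 + 8) * (norm h)\<^sup>2"
proof -
  define z where "z = (\<lambda>\<tau>::real. \<delta>\<^sup>2 - (y + \<tau> *\<^sub>R h) \<bullet> (y + \<tau> *\<^sub>R h))"
  define p where "p = (\<lambda>\<tau>. (y + \<tau> *\<^sub>R h) \<bullet> h)"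
  define \<phi> where "\<phi> = (\<lambda>\<tau>. bump \<delta> (y + \<tau> *\<^sub>R h))"
  define \<phi>1 where "\<phi>1 = (\<lambda>\<tau>. exp_inv 2 (z \<tau>) * (- 2 * p \<tau>))"
  define \<phi>2 where "\<phi>2 = (\<lambda>\<tau>. (exp_inv 4 (z \<tau>) - 2 * exp_inv 3 (z \<tau>)) * (- 2 * p \<tau>) * (- 2 * p \<tau>)
    + exp_inv 2 (z \<tau>) * (- 2 * (h \<bullet> h)))"
  have dz: "(z has_real_derivative - 2 * p \<tau>) (at \<tau>)" for \<tau>
    unfolding z_def p_def inner_simps
    by (auto intro!: derivative_eq_intros simp: inner_simps inner_commute algebra_simps)
  have dp: "(p has_real_derivative h \<bullet> h) (at \<tau>)" for \<tau>
    unfolding p_def inner_simps by (auto intro!: derivative_eq_intros)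
  have d1: "(\<phi> has_real_derivative \<phi>1 \<tau>) (at \<tau>)" for \<tau>
  proof -
    have "\<phi> = (\<lambda>\<tau>. exp_inv 0 (z \<tau>))" by (simp add: \<phi>_def z_def bump_def)
    moreover have "((\<lambda>\<tau>. exp_inv 0 (z \<tau>)) has_real_derivative \<phi>1 \<tau>) (at \<tau>)"
      using DERIV_chain2[OF exp_inv_has_derivative[of 0 "z \<tau>"] dz[of \<tau>]] by (simp add: \<phi>1_def numeral_2_eq_2)
    ultimately show ?thesis by simp
  qed
  have d2: "(\<phi>1 has_real_derivative \<phi>2 \<tau>) (at \<tau>)" for \<tau>
  proof -
    have "((\<lambda>\<tau>. exp_inv 2 (z \<tau>)) has_real_derivative
        (exp_inv 4 (z \<tau>) - 2 * exp_inv 3 (z \<tau>)) * (- 2 * p \<tau>)) (at \<tau>)"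
      using DERIV_chain2[OF exp_inv_has_derivative[of 2 "z \<tau>"] dz[of \<tau>]] by (simp add: numeral_eq_Suc)
    from DERIV_mult[OF this DERIV_cmult[OF dp, of "- 2"]] show ?thesis
      unfolding \<phi>1_def \<phi>2_def by (rule DERIV_cong) (simp add: algebra_simps)
  qed
  have b2: "\<bar>\<phi>2 \<tau>\<bar> \<le> (144 * \<delta>\<^sup>2 + 4) * (norm h)\<^sup>2" for \<tau>
  proof (cases "0 < z \<tau>")
    case True
    define w where "w = y + \<tau> *\<^sub>R h"
    have "(norm w)\<^sup>2 \<le> \<delta>\<^sup>2" using True by (simp add: z_def w_def power2_norm_eq_inner)
    then have w: "norm w \<le> \<delta>" using assms by (simp add: power_mono_iff)
    have p: "\<bar>p \<tau>\<bar> \<le> \<delta> * norm h"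
      using Cauchy_Schwarz_ineq2[of w h] mult_right_mono[OF w, of "norm h"] by (simp add: p_def w_def)
    have p2: "(p \<tau>)\<^sup>2 \<le> \<delta>\<^sup>2 * (norm h)\<^sup>2"
      using power_mono[OF p, of 2] by (simp add: power_mult_distrib)
    \<comment> \<open>\<open>36 = fact 4 + 2 * fact 3\<close>.\<close>
    have e: "\<bar>exp_inv 4 (z \<tau>) - 2 * exp_inv 3 (z \<tau>)\<bar> \<le> 36"
      using exp_inv_le[of 4 "z \<tau>"] exp_inv_le[of 3 "z \<tau>"] exp_inv_nonneg[of 4 "z \<tau>"] exp_inv_nonneg[of 3 "z \<tau>"]
      by (simp add: fact_numeral)
    have "\<phi>2 \<tau> = (exp_inv 4 (z \<tau>) - 2 * exp_inv 3 (z \<tau>)) * (4 * (p \<tau>)\<^sup>2)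
        + - (exp_inv 2 (z \<tau>) * (2 * (norm h)\<^sup>2))"
      unfolding \<phi>2_def power2_norm_eq_inner by (simp add: power2_eq_square)
    also have "\<bar>\<dots>\<bar> \<le> \<bar>exp_inv 4 (z \<tau>) - 2 * exp_inv 3 (z \<tau>)\<bar> * (4 * (p \<tau>)\<^sup>2)
        + exp_inv 2 (z \<tau>) * (2 * (norm h)\<^sup>2)"
      using exp_inv_nonneg[of 2 "z \<tau>"] by (intro order.trans[OF abs_triangle_ineq]) (simp add: abs_mult)
    also have "\<dots> \<le> 36 * (4 * (\<delta>\<^sup>2 * (norm h)\<^sup>2)) + 2 * (2 * (norm h)\<^sup>2)"
      using e p2 exp_inv_le[of 2 "z \<tau>"] by (intro add_mono mult_mono) (auto simp: numeral_2_eq_2)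
    finally show ?thesis by (simp add: algebra_simps)
  next
    case False
    then show ?thesis by (simp add: \<phi>2_def exp_inv_def)
  qed
  obtain a where a: "0 < a" "a < 1" "\<phi> 1 - \<phi> 0 = (1 - 0) * \<phi>1 a"
    using MVT2[of 0 1 \<phi> \<phi>1] d1 by auto
  obtain b where b: "- 1 < b" "b < 0" "\<phi> 0 - \<phi> (- 1) = (0 - (- 1)) * \<phi>1 b"
    using MVT2[of "- 1" 0 \<phi> \<phi>1] d1 by auto
  obtain c where c: "b < c" "c < a" "\<phi>1 a - \<phi>1 b = (a - b) * \<phi>2 c"
    using MVT2[of b a \<phi>1 \<phi>2] d2 a b by auto
  have "2 * bump \<delta> y - bump \<delta> (y + h) - bump \<delta> (y - h) = - ((a - b) * \<phi>2 c)"
    using a b c by (simp add: \<phi>_def)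
  then have "\<bar>2 * bump \<delta> y - bump \<delta> (y + h) - bump \<delta> (y - h)\<bar> = (a - b) * \<bar>\<phi>2 c\<bar>"
    using a b by (simp add: abs_mult)
  also have "\<dots> \<le> 2 * ((144 * \<delta>\<^sup>2 + 4) * (norm h)\<^sup>2)"
    using a b b2 by (intro mult_mono) auto
  finally show ?thesis by (simp add: algebra_simps)
qed

lemma integrable_bump:
  fixes x :: "'a::euclidean_space"
  assumes "0 < \<delta>" shows "integrable lborel (\<lambda>y. bump \<delta> (y - x))"
proof -
  have "integrable lborel (\<lambda>y. indicator (cball x \<delta>) y *\<^sub>R bump \<delta> (y - x))"
    by (rule borel_integrable_compact, simp, rule continuous_on_compose2[OF continuous_on_bump[of UNIV]])
      (auto intro!: continuous_intros)
  moreover have "(\<lambda>y. indicator (cball x \<delta>) y *\<^sub>R bump \<delta> (y - x)) = (\<lambda>y. bump \<delta> (y - x))"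
    
    by (intro ext) (auto simp: bump_eq_0_iff[OF assms] indicator_def dist_norm norm_minus_commute)
  ultimately show ?thesis by simp
qed

lemma integral_bump_pos:
  assumes "0 < \<delta>" shows "0 < (LINT y|lborel. bump \<delta> (y :: 'a::euclidean_space))"
proof -
  have int: "integrable lborel (bump \<delta> :: 'a \<Rightarrow> real)" using integrable_bump[OF assms, of 0] by simp
  have "(LINT y|lborel. bump \<delta> (y :: 'a)) \<noteq> 0"
  proof
    assume "(LINT y|lborel. bump \<delta> (y :: 'a)) = 0"
    then have "AE y in lborel. bump \<delta> (y :: 'a) = 0"
      by (subst (asm) integral_nonneg_eq_0_iff_AE[OF int]) (simp_all add: bump_nonneg)
    then have "AE y in lborel. (y :: 'a) \<notin> ball 0 \<delta>"
      by (rule AE_mp) (simp add: bump_eq_0_iff[OF assms] not_less)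
    then have "ball (0 :: 'a) \<delta> \<in> null_sets lborel"
      by (subst AE_iff_null_sets) auto
    then have "emeasure lborel (ball (0 :: 'a) \<delta>) = 0" by (rule null_setsD1)
    then have "measure lborel (ball (0 :: 'a) \<delta>) = 0" by (simp add: measure_def)
    then show False using content_ball_pos[OF assms, of "0 :: 'a"] by simp
  qed
  moreover have "0 \<le> (LINT y|lborel. bump \<delta> (y :: 'a))" by (simp add: bump_nonneg)
  ultimately show ?thesis by linarith
qed

subsection \<open>Truncated operators\<close>

lemma lborel_shift:
  fixes f :: "'a::euclidean_space \<Rightarrow> real" and c :: 'a
  assumes [measurable]: "f \<in> borel_measurable borel"
  shows "integrable lborel (\<lambda>x. f (x + c)) \<longleftrightarrow> integrable lborel f"
    and "(LINT x|lborel. f (x + c)) = (LINT x|lborel. f x)"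
  using integrable_distr_eq[of "(+) c" lborel borel f] integral_distr[of "(+) c" lborel borel f]
  by (simp_all add: lborel_distr_plus add.commute)

text \<open>Sign convention of a positive operator, like minus the Laplacian. Building both jumps
  into the integrand makes the operator symmetric for every finite measure \<open>N\<close>,
  symmetric or not.\<close>

definition jump_diff :: "'z measure \<Rightarrow> ('z \<Rightarrow> 'a::euclidean_space) \<Rightarrow> ('a \<Rightarrow> real) \<Rightarrow> 'a \<Rightarrow> real" where
  "jump_diff N J f x = (LINT z|N. 2 * f x - f (x + J z) - f (x - J z))"

lemma integrable_jump:
  fixes f g :: "'a::euclidean_space \<Rightarrow> real" and J :: "'z \<Rightarrow> 'a"
  assumes N: "finite_measure N" and [measurable]: "J \<in> borel_measurable N"
    and f: "integrable lborel f" and [measurable]: "f \<in> borel_measurable borel" "g \<in> borel_measurable borel"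
    and B: "\<And>x. \<bar>g x\<bar> \<le> B"
  shows "integrable (N \<Otimes>\<^sub>M lborel) (\<lambda>(z, x). f (x + J z) * g x)"
    and "integrable (N \<Otimes>\<^sub>M lborel) (\<lambda>(z, x). f x * g (x + J z))"
proof -
  interpret N: finite_measure N by fact
  interpret pair_sigma_finite N lborel ..
  have fJ: "integrable lborel (\<lambda>x. f (x + J z))" for z using f by (simp add: lborel_shift(1))
  have "0 \<le> B" using B[of 0] by linarith
  have b1: "(LINT x|lborel. \<bar>f (x + J z) * g x\<bar>) \<le> B * (LINT x|lborel. \<bar>f x\<bar>)" for z
  proof -
    have "(LINT x|lborel. \<bar>f (x + J z) * g x\<bar>) \<le> (LINT x|lborel. B * \<bar>f (x + J z)\<bar>)"
      using fJ B \<open>0 \<le> B\<close> by (intro integral_mono' integrable_mult_right integrable_abs)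
        (auto simp: abs_mult mult.commute[of B] intro!: mult_left_mono)
    also have "\<dots> = B * (LINT x|lborel. \<bar>f x\<bar>)"
      by (simp add: lborel_shift(2)[of "\<lambda>x. \<bar>f x\<bar>"])
    finally show ?thesis .
  qed
  have b2: "(LINT x|lborel. \<bar>f x * g (x + J z)\<bar>) \<le> B * (LINT x|lborel. \<bar>f x\<bar>)" for z
  proof -
    have "(LINT x|lborel. \<bar>f x * g (x + J z)\<bar>) \<le> (LINT x|lborel. B * \<bar>f x\<bar>)"
      using f B \<open>0 \<le> B\<close> by (intro integral_mono' integrable_mult_right integrable_abs)
        (auto simp: abs_mult mult.commute[of B] intro!: mult_left_mono)
    then show ?thesis by simp
  qed
  have i1: "integrable lborel (\<lambda>x. f (x + J z) * g x)" for z
    by (rule integrable_mult_bounded[OF fJ _ B]) measurable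
  have i2: "integrable lborel (\<lambda>x. f x * g (x + J z))" for z
    by (rule integrable_mult_bounded[OF f _ B]) measurable
  show "integrable (N \<Otimes>\<^sub>M lborel) (\<lambda>(z, x). f (x + J z) * g x)"
  proof (rule Fubini_integrable)
    show "integrable N (\<lambda>z. LINT x|lborel. norm (case (z, x) of (z, x) \<Rightarrow> f (x + J z) * g x))"
      using b1 by (intro N.integrable_const_bound[where B = "B * (LINT x|lborel. \<bar>f x\<bar>)"]) auto
  qed (use i1 in auto)
  show "integrable (N \<Otimes>\<^sub>M lborel) (\<lambda>(z, x). f x * g (x + J z))"
  proof (rule Fubini_integrable)
    show "integrable N (\<lambda>z. LINT x|lborel. norm (case (z, x) of (z, x) \<Rightarrow> f x * g (x + J z)))"
      using b2 by (intro N.integrable_const_bound[where B = "B * (LINT x|lborel. \<bar>f x\<bar>)"]) auto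
  qed (use i2 in auto)
qed

text \<open>After Fubini, translating by \<open>J z\<close> moves the shift from \<open>g\<close> to
  \<open>f\<close> with opposite sign, which exchanges the two jump terms. Finiteness of
  \<open>N\<close> together with one integrable and one bounded function makes every term separately
  integrable.\<close>

lemma jump_diff_symmetric:
  fixes f g :: "'a::euclidean_space \<Rightarrow> real" and J :: "'z \<Rightarrow> 'a"
  assumes N: "finite_measure N" and J [measurable]: "J \<in> borel_measurable N"
    and f: "integrable lborel f" and fm [measurable]: "f \<in> borel_measurable borel"
    and gm [measurable]: "g \<in> borel_measurable borel" and B: "\<And>x. \<bar>g x\<bar> \<le> B"
  shows "(LINT x|lborel. f x * jump_diff N J g x) = (LINT x|lborel. g x * jump_diff N J f x)"
proof -
  interpret N: finite_measure N by fact
  interpret pair_sigma_finite N lborel ..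
  have mJ [measurable]: "(\<lambda>z. - J z) \<in> borel_measurable N" by measurable
  note I = integrable_jump[OF N _ f fm gm B]
  have z [measurable]: "(\<lambda>z. 0) \<in> borel_measurable N" by measurable
  have I0: "integrable (N \<Otimes>\<^sub>M lborel) (\<lambda>(z, x). f x * g x)" using I(1)[OF z] by simp
  have 1: "integrable (N \<Otimes>\<^sub>M lborel) (\<lambda>(z, x). f x * (2 * g x - g (x + J z) - g (x - J z)))"
    using Bochner_Integration.integrable_diff[OF Bochner_Integration.integrable_diff[OF
      integrable_mult_right[OF I0, of 2] I(2)[OF J]] I(2)[OF mJ]]
    by (simp add: case_prod_beta' algebra_simps)
  have 2: "integrable (N \<Otimes>\<^sub>M lborel) (\<lambda>(z, x). g x * (2 * f x - f (x + J z) - f (x - J z)))"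
    using Bochner_Integration.integrable_diff[OF Bochner_Integration.integrable_diff[OF
      integrable_mult_right[OF I0, of 2] I(1)[OF J]] I(1)[OF mJ]]
    by (simp add: case_prod_beta' algebra_simps)
  have sh: "(LINT x|lborel. f x * g (x + c)) = (LINT x|lborel. f (x - c) * g x)" for c
    using lborel_shift(2)[of "\<lambda>x. f (x - c) * g x" c] by simp
  have If: "integrable lborel (\<lambda>x. f x * g (x + c))" "integrable lborel (\<lambda>x. f (x + c) * g x)" for c
  proof -
    have fc: "integrable lborel (\<lambda>x. f (x + c))" using f by (simp add: lborel_shift(1))
    show "integrable lborel (\<lambda>x. f x * g (x + c))"
      by (rule integrable_mult_bounded[OF f _ B]) measurable
    show "integrable lborel (\<lambda>x. f (x + c) * g x)"
      by (rule integrable_mult_bounded[OF fc _ B]) measurable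
  qed
  have "(LINT x|lborel. f x * jump_diff N J g x) =
      (LINT x|lborel. LINT z|N. f x * (2 * g x - g (x + J z) - g (x - J z)))"
    by (simp add: jump_diff_def)
  also have "\<dots> = (LINT z|N. LINT x|lborel. f x * (2 * g x - g (x + J z) - g (x - J z)))"
    by (rule Fubini_integral[OF 1])
  also have "\<dots> = (LINT z|N. LINT x|lborel. g x * (2 * f x - f (x + J z) - f (x - J z)))"
  proof (rule Bochner_Integration.integral_cong[OF refl])
    fix z
    have "(LINT x|lborel. f x * (2 * g x - g (x + J z) - g (x - J z))) =
      (LINT x|lborel. 2 * (f x * g (x + 0)) - f x * g (x + J z) - f x * g (x + - J z))"
      by (intro Bochner_Integration.integral_cong) (auto simp: algebra_simps)
    also have "\<dots> = 2 * (LINT x|lborel. f x * g (x + 0)) - (LINT x|lborel. f x * g (x + J z))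
       - (LINT x|lborel. f x * g (x + - J z))"
      by (subst Bochner_Integration.integral_diff Bochner_Integration.integral_mult_right_zero
          | intro Bochner_Integration.integrable_diff integrable_mult_right If | rule refl)+
    also have "\<dots> = 2 * (LINT x|lborel. f (x + 0) * g x) - (LINT x|lborel. f (x + - J z) * g x)
       - (LINT x|lborel. f (x + J z) * g x)"
      unfolding sh by simp
    also have "\<dots> = (LINT x|lborel. 2 * (f (x + 0) * g x) - f (x + - J z) * g x - f (x + J z) * g x)"
      by (subst Bochner_Integration.integral_diff Bochner_Integration.integral_mult_right_zero
          | intro Bochner_Integration.integrable_diff integrable_mult_right If | rule refl)+
    also have "\<dots> = (LINT x|lborel. g x * (2 * f x - f (x + J z) - f (x - J z)))"
      by (intro Bochner_Integration.integral_cong) (auto simp: algebra_simps)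
    finally show "(LINT x|lborel. f x * (2 * g x - g (x + J z) - g (x - J z))) =
      (LINT x|lborel. g x * (2 * f x - f (x + J z) - f (x - J z)))" .
  qed
  also have "\<dots> = (LINT x|lborel. LINT z|N. g x * (2 * f x - f (x + J z) - f (x - J z)))"
    by (rule Fubini_integral[OF 2, symmetric])
  also have "\<dots> = (LINT x|lborel. g x * jump_diff N J f x)"
    by (simp add: jump_diff_def)
  finally show ?thesis .
qed

text \<open>Shifting \<open>x\<close> by a jump shifts the argument of \<open>g\<close> by the
  opposite jump, and the second difference does not see the sign.\<close>

lemma jump_diff_convolution:
  fixes f g :: "'a::euclidean_space \<Rightarrow> real" and J :: "'z \<Rightarrow> 'a"
  assumes N: "finite_measure N" and J [measurable]: "J \<in> borel_measurable N"
    and f: "integrable lborel f" and fm [measurable]: "f \<in> borel_measurable borel"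
    and gm [measurable]: "g \<in> borel_measurable borel" and B: "\<And>x. \<bar>g x\<bar> \<le> B"
  shows "jump_diff N J (\<lambda>x. LINT y|lborel. f y * g (y - x)) x = (LINT y|lborel. f y * jump_diff N J g (y - x))"
proof -
  interpret N: finite_measure N by fact
  interpret pair_sigma_finite N lborel ..
  define h where "h = (\<lambda>y. g (y - x))"
  have hm [measurable]: "h \<in> borel_measurable borel" unfolding h_def by measurable
  have hB: "\<bar>h y\<bar> \<le> B" for y using B by (simp add: h_def)
  have mJ [measurable]: "(\<lambda>z. - J z) \<in> borel_measurable N" by measurable
  have z [measurable]: "(\<lambda>z. 0) \<in> borel_measurable N" by measurable
  note I = integrable_jump(2)[OF N _ f fm hm hB]
  have 1: "integrable (N \<Otimes>\<^sub>M lborel) (\<lambda>(z, y). f y * (2 * h y - h (y + J z) - h (y - J z)))"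
    using Bochner_Integration.integrable_diff[OF Bochner_Integration.integrable_diff[OF
      integrable_mult_right[OF I[OF z], of 2] I[OF J]] I[OF mJ]]
    by (simp add: case_prod_beta' algebra_simps)
  have If: "integrable lborel (\<lambda>y. f y * g (y - c))" for c
    by (rule integrable_mult_bounded[OF f _ B]) measurable
  have "jump_diff N J (\<lambda>x. LINT y|lborel. f y * g (y - x)) x =
      (LINT z|N. LINT y|lborel. f y * (2 * h y - h (y + J z) - h (y - J z)))"
    unfolding jump_diff_def
  proof (rule Bochner_Integration.integral_cong[OF refl])
    fix z
    have "2 * (LINT y|lborel. f y * g (y - x)) - (LINT y|lborel. f y * g (y - (x + J z)))
        - (LINT y|lborel. f y * g (y - (x - J z))) =
      (LINT y|lborel. 2 * (f y * g (y - x)) - f y * g (y - (x + J z)) - f y * g (y - (x - J z)))"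
      by (subst Bochner_Integration.integral_diff Bochner_Integration.integral_mult_right_zero
          | intro Bochner_Integration.integrable_diff integrable_mult_right If | rule refl)+
    also have "\<dots> = (LINT y|lborel. f y * (2 * h y - h (y + J z) - h (y - J z)))"
      by (intro Bochner_Integration.integral_cong) (auto simp: h_def algebra_simps)
    finally show "2 * (LINT y|lborel. f y * g (y - x)) - (LINT y|lborel. f y * g (y - (x + J z)))
        - (LINT y|lborel. f y * g (y - (x - J z))) =
      (LINT y|lborel. f y * (2 * h y - h (y + J z) - h (y - J z)))" .
  qed
  also have "\<dots> = (LINT y|lborel. LINT z|N. f y * (2 * h y - h (y + J z) - h (y - J z)))"
    by (rule Fubini_integral[OF 1, symmetric])
  also have "\<dots> = (LINT y|lborel. f y * jump_diff N J g (y - x))"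
  proof -
    have e: "y - x + J z = y + J z - x" "y - x - J z = y - J z - x" for y z
      by (simp_all add: algebra_simps)
    show ?thesis unfolding jump_diff_def h_def e by simp
  qed
  finally show ?thesis .
qed

lemma integrable_jump_diff:
  fixes g :: "'a::euclidean_space \<Rightarrow> real" and J :: "'z \<Rightarrow> 'a"
  assumes N: "finite_measure N" and [measurable]: "J \<in> borel_measurable N"
    and [measurable]: "g \<in> borel_measurable borel" and B: "\<And>x. \<bar>g x\<bar> \<le> B"
  shows "integrable N (\<lambda>z. g (x + J z))" "integrable N (\<lambda>z. g (x - J z))"
    "integrable N (\<lambda>z. 2 * g x - g (x + J z) - g (x - J z))"
proof -
  interpret N: finite_measure N by fact
  show 1: "integrable N (\<lambda>z. g (x + J z))" "integrable N (\<lambda>z. g (x - J z))"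
    using B by (auto intro!: N.integrable_const_bound[where B = B])
  show "integrable N (\<lambda>z. 2 * g x - g (x + J z) - g (x - J z))"
    by (intro Bochner_Integration.integrable_diff 1 N.integrable_const)
qed

lemma jump_diff_measurable_bounded:
  fixes g :: "'a::euclidean_space \<Rightarrow> real" and J :: "'z \<Rightarrow> 'a"
  assumes N: "finite_measure N" and [measurable]: "J \<in> borel_measurable N"
    and [measurable]: "g \<in> borel_measurable borel" and B: "\<And>x. \<bar>g x\<bar> \<le> B"
  shows "jump_diff N J g \<in> borel_measurable borel"
    and "\<bar>jump_diff N J g x\<bar> \<le> 4 * B * measure N (space N)"
proof -
  interpret N: finite_measure N by fact
  show "jump_diff N J g \<in> borel_measurable borel"
    unfolding jump_diff_def by measurable
  have "\<bar>jump_diff N J g x\<bar> \<le> (LINT z|N. \<bar>2 * g x - g (x + J z) - g (x - J z)\<bar>)"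
    unfolding jump_diff_def by (rule integral_abs_bound)
  also have "\<dots> \<le> (LINT z|N. 4 * B)"
  proof (rule integral_mono)
    show "\<bar>2 * g x - g (x + J z) - g (x - J z)\<bar> \<le> 4 * B" for z
      using B[of x] B[of "x + J z"] B[of "x - J z"] by linarith
  qed (use integrable_jump_diff(3)[OF assms] in auto)
  finally show "\<bar>jump_diff N J g x\<bar> \<le> 4 * B * measure N (space N)" by (simp add: ac_simps)
qed

locale stable_kernel =
  fixes s :: real and \<mu> :: "'a::euclidean_space measure"
  assumes s: "0 < s" "s < 1" and sphere_measure: "sphere_measure \<mu>"
begin

sublocale mu: finite_measure \<mu>
  using sphere_measure by (simp add: sphere_measure_def)

lemma sets_mu: "sets \<mu> = sets (restrict_space borel (sphere 0 1))"
  using sphere_measure by (simp add: sphere_measure_def)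

lemma space_mu: "space \<mu> = sphere 0 1"
  using sets_eq_imp_space_eq[OF sets_mu] by (simp add: space_restrict_space)

lemma norm_mu: "\<theta> \<in> space \<mu> \<Longrightarrow> norm \<theta> = 1"
  by (simp add: space_mu)

lemma measurable_mu [measurable]: "(\<lambda>\<theta>. \<theta>) \<in> borel_measurable \<mu>"
proof -
  have "(\<lambda>\<theta>. \<theta>) \<in> borel_measurable (restrict_space borel (sphere 0 1 :: 'a set))"
    by (intro measurable_restrict_space1) simp
  then show ?thesis by (simp add: measurable_cong_sets[OF sets_mu refl])
qed

text \<open>The integral over \<open>\<bar>r\<bar> \<ge> \<kappa>\<close> of first differences is folded by \<open>r \<mapsto> - r\<close> into an integral of
  second differences over \<open>r \<ge> \<kappa>\<close>, so that \<open>A_trunc \<kappa>\<close> below is the truncated operator of the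
  problem although \<open>\<mu>\<close> need not be symmetric.\<close>
definition K :: "real \<Rightarrow> (real \<times> 'a) measure" where
  "K \<kappa> = power_tail s \<kappa> \<Otimes>\<^sub>M \<mu>"

definition jump :: "real \<times> 'a \<Rightarrow> 'a" where
  "jump z = fst z *\<^sub>R snd z"

lemma measurable_snd_K [measurable]: "snd \<in> borel_measurable (K \<kappa>)"
  unfolding K_def using measurable_compose[OF measurable_snd measurable_mu] by simp

lemma measurable_fst_K [measurable]: "fst \<in> borel_measurable (K \<kappa>)"
  unfolding K_def using measurable_fst[of "power_tail s \<kappa>" \<mu>] by (simp cong: measurable_cong_sets)

lemma measurable_jump [measurable]: "jump \<in> borel_measurable (K \<kappa>)"
  unfolding jump_def by measurable

lemma finite_K: "0 < \<kappa> \<Longrightarrow> finite_measure (K \<kappa>)"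
  unfolding K_def using s finite_measure_power_tail mu.finite_measure_axioms
  by (intro finite_measure_pair_measure) auto

definition A_trunc :: "real \<Rightarrow> ('a \<Rightarrow> real) \<Rightarrow> 'a \<Rightarrow> real" where
  "A_trunc \<kappa> = jump_diff (K \<kappa>) jump"

lemma AE_K: assumes "0 < \<kappa>" shows "AE z in K \<kappa>. \<kappa> \<le> fst z \<and> norm (snd z) = 1"
proof -
  interpret Q: finite_measure "power_tail s \<kappa>" using assms s by (intro finite_measure_power_tail) auto
  interpret pair_sigma_finite "power_tail s \<kappa>" \<mu> ..
  have "AE z in power_tail s \<kappa> \<Otimes>\<^sub>M \<mu>. \<kappa> \<le> fst z"
  proof (rule AE_pair_measure)
    show "{z \<in> space (power_tail s \<kappa> \<Otimes>\<^sub>M \<mu>). \<kappa> \<le> fst z} \<in> sets (power_tail s \<kappa> \<Otimes>\<^sub>M \<mu>)"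
      using measurable_fst_K[of \<kappa>, unfolded K_def] by measurable
    show "AE r in power_tail s \<kappa>. AE \<theta> in \<mu>. \<kappa> \<le> fst (r, \<theta>)"
      using AE_power_tail[of \<kappa> s] by eventually_elim simp
  qed
  moreover have "AE z in power_tail s \<kappa> \<Otimes>\<^sub>M \<mu>. norm (snd z) = 1"
    using norm_mu by (intro AE_I2) (auto simp: space_pair_measure)
  ultimately show ?thesis unfolding K_def by eventually_elim auto
qed

lemma integrable_K_fst:
  fixes f :: "real \<Rightarrow> real"
  assumes "0 < \<kappa>" "integrable (power_tail s \<kappa>) f"
  shows "integrable (K \<kappa>) (\<lambda>z. f (fst z))" "(LINT z|K \<kappa>. f (fst z)) = measure \<mu> (space \<mu>) * (LINT r|power_tail s \<kappa>. f r)"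
proof -
  interpret Q: finite_measure "power_tail s \<kappa>" using assms s by (intro finite_measure_power_tail) auto
  interpret pair_sigma_finite "power_tail s \<kappa>" \<mu> ..
  have [measurable]: "f \<in> borel_measurable borel" using assms(2) borel_measurable_integrable by fastforce
  have "integrable (power_tail s \<kappa>) (\<lambda>r. LINT \<theta>|\<mu>. \<bar>f r\<bar>)" using assms(2) by simp
  then show i: "integrable (K \<kappa>) (\<lambda>z. f (fst z))"
    unfolding K_def by (intro Fubini_integrable) auto
  show "(LINT z|K \<kappa>. f (fst z)) = measure \<mu> (space \<mu>) * (LINT r|power_tail s \<kappa>. f r)"
    using integral_fst'[OF i[unfolded K_def]] by (simp add: K_def)
qed

lemma A_trunc_eq_iterated:
  assumes "0 < \<kappa>" and [measurable]: "f \<in> borel_measurable borel" and B: "\<And>x. \<bar>f x\<bar> \<le> B"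
  shows "A_trunc \<kappa> f x = (LINT r|power_tail s \<kappa>. LINT \<theta>|\<mu>. 2 * f x - f (x + r *\<^sub>R \<theta>) - f (x - r *\<^sub>R \<theta>))"
proof -
  interpret Q: finite_measure "power_tail s \<kappa>" using assms s by (intro finite_measure_power_tail) auto
  interpret pair_sigma_finite "power_tail s \<kappa>" \<mu> ..
  show ?thesis
    using integral_fst'[OF integrable_jump_diff(3)[OF finite_K[OF assms(1)] measurable_jump assms(2) B, unfolded K_def]]
    by (simp add: A_trunc_def jump_diff_def K_def jump_def)
qed

lemma integrable_power_two_sided:
  assumes "0 < \<kappa>"
  shows "integrable lborel (\<lambda>r. indicator {r. \<kappa> \<le> \<bar>r\<bar>} r * \<bar>r\<bar> powr (- 1 - 2 * s))"
proof -
  define g where "g = (\<lambda>r. indicator {\<kappa>..} r * r powr (- 1 - 2 * s))"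
  have g: "integrable lborel g"
    using finite_measure_power_tail[OF assms s(1)] integrable_power_tail_iff[of "\<lambda>_. 1" s \<kappa>]
      finite_measure.integrable_const unfolding g_def by fastforce
  have "integrable lborel (\<lambda>r. g r + g (0 + (- 1) * r))"
    by (intro Bochner_Integration.integrable_add g lborel_integrable_real_affine) auto
  moreover have "indicator {r. \<kappa> \<le> \<bar>r\<bar>} r * \<bar>r\<bar> powr (- 1 - 2 * s) = g r + g (0 + (- 1) * r)" for r
    using assms by (auto simp: g_def indicator_def abs_if)
  ultimately show ?thesis by simp
qed

lemma integrable_weighted:
  fixes H :: "real \<Rightarrow> real"
  assumes "0 < \<kappa>" and [measurable]: "H \<in> borel_measurable borel" and B: "\<And>r. \<bar>H r\<bar> \<le> B"
  shows "integrable lborel (\<lambda>r. indicator {r. \<kappa> \<le> \<bar>r\<bar>} r * (H r / \<bar>r\<bar> powr (1 + 2 * s)))"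
proof -
  have "indicator {r. \<kappa> \<le> \<bar>r\<bar>} r * (H r / \<bar>r\<bar> powr (1 + 2 * s)) =
      indicator {r. \<kappa> \<le> \<bar>r\<bar>} r * \<bar>r\<bar> powr (- 1 - 2 * s) * H r" for r
  proof -
    have "\<bar>r\<bar> powr (- 1 - 2 * s) = inverse (\<bar>r\<bar> powr (1 + 2 * s))" by (simp flip: powr_minus)
    then show ?thesis by (simp add: divide_inverse)
  qed
  then show ?thesis
    using integrable_mult_bounded[OF integrable_power_two_sided[OF assms(1)] _ B] by simp
qed

lemma integral_two_sided:
  fixes H :: "real \<Rightarrow> real"
  assumes k: "0 < \<kappa>" and [measurable]: "H \<in> borel_measurable borel" and B: "\<And>r. \<bar>H r\<bar> \<le> B"
  shows "(LINT r|lborel. indicator {r. \<kappa> \<le> \<bar>r\<bar>} r * (H r / \<bar>r\<bar> powr (1 + 2 * s))) =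
    (LINT r|power_tail s \<kappa>. H r + H (- r))"
proof -
  interpret Q: finite_measure "power_tail s \<kappa>" using k s by (intro finite_measure_power_tail) auto
  define g where "g = (\<lambda>r. indicator {\<kappa>..} r * r powr (- 1 - 2 * s) * H r)"
  define h where "h = (\<lambda>r. indicator {\<kappa>..} r * r powr (- 1 - 2 * s) * H (- r))"
  have iH: "integrable (power_tail s \<kappa>) H" "integrable (power_tail s \<kappa>) (\<lambda>r. H (- r))"
    using B by (auto intro!: Q.integrable_const_bound[where B = B])
  have g: "integrable lborel g" "(LINT r|lborel. g r) = (LINT r|power_tail s \<kappa>. H r)"
    using iH(1) unfolding g_def by (auto simp: integrable_power_tail_iff integral_power_tail)
  have h: "integrable lborel h" "(LINT r|lborel. h r) = (LINT r|power_tail s \<kappa>. H (- r))"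
    using iH(2) unfolding h_def by (auto simp: integrable_power_tail_iff integral_power_tail)
  have h': "integrable lborel (\<lambda>r. h (0 + (- 1) * r))"
    using h by (intro lborel_integrable_real_affine) auto
  have "indicator {r. \<kappa> \<le> \<bar>r\<bar>} r * (H r / \<bar>r\<bar> powr (1 + 2 * s)) = g r + h (0 + (- 1) * r)" for r
  proof -
    have "\<bar>r\<bar> powr (- 1 - 2 * s) = inverse (\<bar>r\<bar> powr (1 + 2 * s))"
      by (simp flip: powr_minus)
    then show ?thesis
      using k by (auto simp: g_def h_def indicator_def abs_if divide_inverse)
  qed
  then have "(LINT r|lborel. indicator {r. \<kappa> \<le> \<bar>r\<bar>} r * (H r / \<bar>r\<bar> powr (1 + 2 * s))) =
      (LINT r|lborel. g r) + (LINT r|lborel. h (0 + (- 1) * r))"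
    using g(1) h' by simp
  also have "(LINT r|lborel. h (0 + (- 1) * r)) = (LINT r|lborel. h r)"
    using lborel_integral_real_affine[of "- 1" h 0] by simp
  finally show ?thesis using g h iH by simp
qed

definition truncated :: "real \<Rightarrow> ('a \<Rightarrow> real) \<Rightarrow> 'a \<Rightarrow> real" where
  "truncated \<kappa> u x = (LINT r|lborel. indicator {r. \<kappa> \<le> \<bar>r\<bar>} r *
       (LINT \<theta>|\<mu>. (u x - u (x + r *\<^sub>R \<theta>)) / \<bar>r\<bar> powr (1 + 2 * s)))"

lemma A_op_eq_Lim_truncated: "A_op s \<mu> u x = Lim (at_right 0) (\<lambda>\<kappa>. truncated \<kappa> u x)"
  by (simp add: A_op_def truncated_def)

lemma sphere_average_bound:
  fixes f :: "'a \<Rightarrow> real"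
  assumes "\<And>\<theta>. \<theta> \<in> space \<mu> \<Longrightarrow> \<bar>f \<theta>\<bar> \<le> B" and [measurable]: "f \<in> borel_measurable \<mu>"
  shows "integrable \<mu> f" "\<bar>LINT \<theta>|\<mu>. f \<theta>\<bar> \<le> B * measure \<mu> (space \<mu>)"
proof -
  show i: "integrable \<mu> f"
    using assms(1) by (intro mu.integrable_const_bound[where B = B] AE_I2) auto
  have "\<bar>LINT \<theta>|\<mu>. f \<theta>\<bar> \<le> (LINT \<theta>|\<mu>. \<bar>f \<theta>\<bar>)" by (rule integral_abs_bound)
  also have "\<dots> \<le> (LINT \<theta>|\<mu>. B)" using i assms(1) by (intro integral_mono) auto
  finally show "\<bar>LINT \<theta>|\<mu>. f \<theta>\<bar> \<le> B * measure \<mu> (space \<mu>)" by (simp add: ac_simps)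
qed

lemma truncated_eq_A_trunc:
  assumes k: "0 < \<kappa>" and fm [measurable]: "f \<in> borel_measurable borel" and B: "\<And>x. \<bar>f x\<bar> \<le> B"
  shows "truncated \<kappa> f x = A_trunc \<kappa> f x"
proof -
  define H where "H = (\<lambda>r. LINT \<theta>|\<mu>. f x - f (x + r *\<^sub>R \<theta>))"
  have Hm [measurable]: "H \<in> borel_measurable borel" unfolding H_def by measurable
  have fB: "\<bar>f x - f (x + r *\<^sub>R \<theta>)\<bar> \<le> 2 * B" for r \<theta>
    using B[of x] B[of "x + r *\<^sub>R \<theta>"] by linarith
  have HB: "\<bar>H r\<bar> \<le> 2 * B * measure \<mu> (space \<mu>)" for r
    unfolding H_def using fB by (intro sphere_average_bound) auto
  have iH: "integrable \<mu> (\<lambda>\<theta>. f x - f (x + r *\<^sub>R \<theta>))" for r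
    using fB by (intro sphere_average_bound) auto
  have "truncated \<kappa> f x = (LINT r|lborel. indicator {r. \<kappa> \<le> \<bar>r\<bar>} r * (H r / \<bar>r\<bar> powr (1 + 2 * s)))"
    by (simp add: truncated_def H_def)
  also have "\<dots> = (LINT r|power_tail s \<kappa>. H r + H (- r))"
    by (rule integral_two_sided[OF k Hm HB])
  also have "\<dots> = A_trunc \<kappa> f x"
    unfolding A_trunc_eq_iterated[OF k fm B]
  proof (rule Bochner_Integration.integral_cong[OF refl])
    fix r
    have "H r + H (- r) = (LINT \<theta>|\<mu>. (f x - f (x + r *\<^sub>R \<theta>)) + (f x - f (x + (- r) *\<^sub>R \<theta>)))"
      unfolding H_def by (rule Bochner_Integration.integral_add[symmetric]) (rule iH)+
    also have "\<dots> = (LINT \<theta>|\<mu>. 2 * f x - f (x + r *\<^sub>R \<theta>) - f (x - r *\<^sub>R \<theta>))"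
      by (intro Bochner_Integration.integral_cong) auto
    finally show "H r + H (- r) = (LINT \<theta>|\<mu>. 2 * f x - f (x + r *\<^sub>R \<theta>) - f (x - r *\<^sub>R \<theta>))" .
  qed
  finally show ?thesis .
qed

text \<open>\<open>A_op\<close> is defined through \<open>Lim\<close>, which carries information
  only if the limit exists; quadratic second differences guarantee that. The omitted part
  \<open>0 < r < \<kappa>\<close> is at most the integral of \<open>r powr (1 - 2 * s)\<close>,
  hence the rate. Measurability is read off from the limit formula.\<close>

lemma A_op_approx:
  assumes fm [measurable]: "f \<in> borel_measurable borel" and B: "\<And>x. \<bar>f x\<bar> \<le> B"
    and C: "\<And>x h. \<bar>2 * f x - f (x + h) - f (x - h)\<bar> \<le> C * (norm h)\<^sup>2" and C0: "0 \<le> C"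
  shows "A_op s \<mu> f \<in> borel_measurable borel"
    and "0 < \<kappa> \<Longrightarrow> \<bar>A_trunc \<kappa> f x - A_op s \<mu> f x\<bar> \<le> C * measure \<mu> (space \<mu>) / (2 - 2 * s) * \<kappa> powr (2 - 2 * s)"
proof -
  define m where "m = measure \<mu> (space \<mu>)"
  define \<Psi> where "\<Psi> = (\<lambda>x r. LINT \<theta>|\<mu>. 2 * f x - f (x + r *\<^sub>R \<theta>) - f (x - r *\<^sub>R \<theta>))"
  \<comment> \<open>The candidate limit converges absolutely: the spherical average \<Psi> is
    quadratic in \<open>r\<close> near \<open>0\<close> and bounded for large
    \<open>r\<close>.\<close>
  define L where "L = (\<lambda>x. LINT r|lborel. indicator {0<..} r * (r powr (- 1 - 2 * s) * \<Psi> x r))"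
  have m0: "0 \<le> m" by (simp add: m_def)
  have B0: "0 \<le> B" using B[of 0] by linarith
  have \<Psi>m [measurable]: "(\<lambda>p. \<Psi> (fst p) (snd p)) \<in> borel_measurable (borel \<Otimes>\<^sub>M borel)"
    unfolding \<Psi>_def by measurable
  have \<Psi>m1 [measurable]: "\<Psi> x \<in> borel_measurable borel" for x
    unfolding \<Psi>_def by measurable
  have \<Psi>1: "\<bar>\<Psi> x r\<bar> \<le> C * r\<^sup>2 * m" for x r
    unfolding \<Psi>_def m_def
  proof (rule sphere_average_bound)
    show "\<bar>2 * f x - f (x + r *\<^sub>R \<theta>) - f (x - r *\<^sub>R \<theta>)\<bar> \<le> C * r\<^sup>2" if "\<theta> \<in> space \<mu>" for \<theta>
      using C[of x "r *\<^sub>R \<theta>"] norm_mu[OF that] by simp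
  qed measurable
  have \<Psi>2: "\<bar>\<Psi> x r\<bar> \<le> 4 * B * m" for x r
    unfolding \<Psi>_def m_def
  proof (rule sphere_average_bound)
    show "\<bar>2 * f x - f (x + r *\<^sub>R \<theta>) - f (x - r *\<^sub>R \<theta>)\<bar> \<le> 4 * B" for \<theta>
      using B[of x] B[of "x + r *\<^sub>R \<theta>"] B[of "x - r *\<^sub>R \<theta>"] by linarith
  qed measurable
  have hd: "((\<lambda>r. r powr (1 - 2 * s)) has_integral c powr (2 - 2 * s) / (2 - 2 * s)) {0..c}" if "0 \<le> c" for c
    using has_integral_powr_from_0[of "1 - 2 * s" c] s that by (simp add: algebra_simps)
  have head: "integrable lborel (\<lambda>r. indicator {0..c} r * r powr (1 - 2 * s))"
    "(LINT r|lborel. indicator {0..c} r * r powr (1 - 2 * s)) = c powr (2 - 2 * s) / (2 - 2 * s)"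
    if "0 \<le> c" for c
    using nonneg_has_integral_lborel[OF _ _ _ hd[OF that]] by auto
  have near: "\<bar>r powr (- 1 - 2 * s) * \<Psi> x r\<bar> \<le> C * m * r powr (1 - 2 * s)" if "0 < r" for x r
  proof -
    have "\<bar>r powr (- 1 - 2 * s) * \<Psi> x r\<bar> \<le> r powr (- 1 - 2 * s) * (C * r\<^sup>2 * m)"
      using \<Psi>1[of x r] by (simp add: abs_mult mult_left_mono)
    also have "\<dots> = C * m * (r powr (- 1 - 2 * s) * r powr 2)"
      using that by (simp add: powr_numeral)
    also have "r powr (- 1 - 2 * s) * r powr 2 = r powr (1 - 2 * s)"
      by (simp flip: powr_add add: algebra_simps)
    finally show ?thesis .
  qed
  have int_near: "integrable lborel (\<lambda>r. indicator {0<..<c} r * (r powr (- 1 - 2 * s) * \<Psi> x r))"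
    and near_le: "\<bar>LINT r|lborel. indicator {0<..<c} r * (r powr (- 1 - 2 * s) * \<Psi> x r)\<bar>
      \<le> C * m / (2 - 2 * s) * c powr (2 - 2 * s)" if "0 < c" for c x
  proof -
    have le: "\<bar>indicator {0<..<c} r * (r powr (- 1 - 2 * s) * \<Psi> x r)\<bar>
        \<le> C * m * (indicator {0..c} r * r powr (1 - 2 * s))" for r
      using near[of r x] by (auto simp: indicator_def C0 m0)
    have ih: "integrable lborel (\<lambda>r. C * m * (indicator {0..c} r * r powr (1 - 2 * s)))"
      using head(1)[of c] that by simp
    show i: "integrable lborel (\<lambda>r. indicator {0<..<c} r * (r powr (- 1 - 2 * s) * \<Psi> x r))"
      by (rule Bochner_Integration.integrable_bound[OF ih]) (use le in \<open>auto simp: C0 m0 intro: order.trans[OF _ abs_ge_self]\<close>)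
    have "\<bar>LINT r|lborel. indicator {0<..<c} r * (r powr (- 1 - 2 * s) * \<Psi> x r)\<bar>
        \<le> (LINT r|lborel. \<bar>indicator {0<..<c} r * (r powr (- 1 - 2 * s) * \<Psi> x r)\<bar>)"
      by (rule integral_abs_bound)
    also have "\<dots> \<le> (LINT r|lborel. C * m * (indicator {0..c} r * r powr (1 - 2 * s)))"
      by (intro integral_mono integrable_abs i ih le)
    also have "\<dots> = C * m / (2 - 2 * s) * c powr (2 - 2 * s)"
      using head(2)[of c] that by simp
    finally show "\<bar>LINT r|lborel. indicator {0<..<c} r * (r powr (- 1 - 2 * s) * \<Psi> x r)\<bar>
      \<le> C * m / (2 - 2 * s) * c powr (2 - 2 * s)" .
  qed
  have far: "integrable lborel (\<lambda>r. indicator {c..} r * (r powr (- 1 - 2 * s) * \<Psi> x r))"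
    and A: "A_trunc c f x = (LINT r|lborel. indicator {c..} r * (r powr (- 1 - 2 * s) * \<Psi> x r))" if "0 < c" for c x
  proof -
    interpret Q: finite_measure "power_tail s c" using that s by (intro finite_measure_power_tail) auto
    have "integrable (power_tail s c) (\<Psi> x)"
      using \<Psi>2 by (intro Q.integrable_const_bound[where B = "4 * B * m"]) auto
    then show "integrable lborel (\<lambda>r. indicator {c..} r * (r powr (- 1 - 2 * s) * \<Psi> x r))"
      by (simp add: integrable_power_tail_iff mult.assoc)
    show "A_trunc c f x = (LINT r|lborel. indicator {c..} r * (r powr (- 1 - 2 * s) * \<Psi> x r))"
    proof -
      have "A_trunc c f x = (LINT r|power_tail s c. \<Psi> x r)"
        unfolding \<Psi>_def by (rule A_trunc_eq_iterated[OF that fm B])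
      then show ?thesis by (simp add: integral_power_tail mult.assoc)
    qed
  qed
  have diff: "\<bar>A_trunc c f x - L x\<bar> \<le> C * m / (2 - 2 * s) * c powr (2 - 2 * s)" if "0 < c" for c x
  proof -
    have "L x = (LINT r|lborel. indicator {0<..<c} r * (r powr (- 1 - 2 * s) * \<Psi> x r)
        + indicator {c..} r * (r powr (- 1 - 2 * s) * \<Psi> x r))"
      unfolding L_def using that by (intro Bochner_Integration.integral_cong) (auto simp: indicator_def)
    also have "\<dots> = (LINT r|lborel. indicator {0<..<c} r * (r powr (- 1 - 2 * s) * \<Psi> x r)) + A_trunc c f x"
      using int_near far A that by simp
    finally show ?thesis using near_le[OF that, of x] by simp
  qed
  have op: "A_op s \<mu> f x = L x" for x
    unfolding A_op_eq_Lim_truncated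
  proof (rule tendsto_Lim)
    show "((\<lambda>\<kappa>. truncated \<kappa> f x) \<longlongrightarrow> L x) (at_right 0)"
    proof (rule Lim_transform_eventually)
      show "eventually (\<lambda>\<kappa>. A_trunc \<kappa> f x = truncated \<kappa> f x) (at_right 0)"
        using eventually_at_right_less[of 0] by eventually_elim (simp add: truncated_eq_A_trunc[OF _ fm B])
      have "((\<lambda>c. A_trunc c f x - L x) \<longlongrightarrow> 0) (at_right 0)"
      proof (rule Lim_null_comparison)
        show "eventually (\<lambda>c. norm (A_trunc c f x - L x) \<le> C * m / (2 - 2 * s) * c powr (2 - 2 * s)) (at_right 0)"
          using eventually_at_right_less[of 0] by eventually_elim (use diff in auto)
        have "((\<lambda>c. C * m / (2 - 2 * s) * c powr (2 - 2 * s)) \<longlongrightarrow> C * m / (2 - 2 * s) * 0 powr (2 - 2 * s)) (at_right 0)"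
          using s by (intro tendsto_intros tendsto_powr') (auto intro!: eventually_mono[OF eventually_at_right_less])
        then show "((\<lambda>c. C * m / (2 - 2 * s) * c powr (2 - 2 * s)) \<longlongrightarrow> 0) (at_right 0)" by simp
      qed
      then show "((\<lambda>\<kappa>. A_trunc \<kappa> f x) \<longlongrightarrow> L x) (at_right 0)" by (simp add: Lim_null[symmetric])
    qed
  qed simp
  show "\<bar>A_trunc \<kappa> f x - A_op s \<mu> f x\<bar> \<le> C * measure \<mu> (space \<mu>) / (2 - 2 * s) * \<kappa> powr (2 - 2 * s)" if "0 < \<kappa>"
    using diff[OF that] by (simp add: op m_def)
  have "(\<lambda>p. \<Psi> (fst p) (snd p)) \<in> borel_measurable (borel \<Otimes>\<^sub>M lborel)" by measurable
  then have "L \<in> borel_measurable borel" unfolding L_def by measurable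
  then show "A_op s \<mu> f \<in> borel_measurable borel"
    by (simp add: op[abs_def] flip: eta_contract_eq)
qed

end

subsection \<open>Testing with bumps\<close>

lemma bump_abs_le_1: "\<bar>bump \<delta> x\<bar> \<le> 1"
  using bump_nonneg[of \<delta> x] bump_le_1[of \<delta> x] by simp

context stable_kernel
begin

lemma A_op_shift: "A_op s \<mu> (\<lambda>y. f (y - x)) y = A_op s \<mu> f (y - x)"
  by (simp add: A_op_def diff_add_eq)

lemma nu_star_integrable:
  assumes [measurable]: "\<Omega> \<in> sets borel"
  shows "integrable lborel (\<lambda>r. LINT \<theta>|\<mu>. indicator \<Omega> (x + r *\<^sub>R \<theta>) * (1 + \<bar>r\<bar>) powr (- 1 - 2 * s))"
proof -
  define m where "m = measure \<mu> (space \<mu>)"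
  have m: "0 \<le> m" by (simp add: m_def)
  have 1: "integrable lborel (\<lambda>r. m * (indicator {- 1..1} r + indicator {r. 1 \<le> \<bar>r\<bar>} r * \<bar>r\<bar> powr (- 1 - 2 * s)))"
    using integrable_power_two_sided[of 1]
    by (intro integrable_mult_right Bochner_Integration.integrable_add) auto
  show ?thesis
  proof (rule Bochner_Integration.integrable_bound[OF 1], measurable, rule AE_I2)
    fix r :: real
    have "\<bar>LINT \<theta>|\<mu>. indicator \<Omega> (x + r *\<^sub>R \<theta>) * (1 + \<bar>r\<bar>) powr (- 1 - 2 * s)\<bar>
        \<le> (1 + \<bar>r\<bar>) powr (- 1 - 2 * s) * m"
      unfolding m_def by (intro sphere_average_bound) (auto simp: indicator_def)
    also have "\<dots> \<le> (indicator {- 1..1} r + indicator {r. 1 \<le> \<bar>r\<bar>} r * \<bar>r\<bar> powr (- 1 - 2 * s)) * m"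
    proof (rule mult_right_mono[OF _ m], cases "1 \<le> \<bar>r\<bar>")
      case True
      then have "(1 + \<bar>r\<bar>) powr (- 1 - 2 * s) \<le> \<bar>r\<bar> powr (- 1 - 2 * s)"
        using s by (intro powr_mono2') auto
      then show "(1 + \<bar>r\<bar>) powr (- 1 - 2 * s) \<le> indicator {- 1..1} r + indicator {r. 1 \<le> \<bar>r\<bar>} r * \<bar>r\<bar> powr (- 1 - 2 * s)"
        using True by (simp add: add_increasing)
    next
      case False
      have "(1 + \<bar>r\<bar>) powr (- 1 - 2 * s) \<le> (1 + \<bar>r\<bar>) powr 0" using s by (intro powr_mono) auto
      then show "(1 + \<bar>r\<bar>) powr (- 1 - 2 * s) \<le> indicator {- 1..1} r + indicator {r. 1 \<le> \<bar>r\<bar>} r * \<bar>r\<bar> powr (- 1 - 2 * s)"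
        using False by (simp add: indicator_def split: if_splits) linarith
    qed
    finally show "norm (LINT \<theta>|\<mu>. indicator \<Omega> (x + r *\<^sub>R \<theta>) * (1 + \<bar>r\<bar>) powr (- 1 - 2 * s))
        \<le> norm (m * (indicator {- 1..1} r + indicator {r. 1 \<le> \<bar>r\<bar>} r * \<bar>r\<bar> powr (- 1 - 2 * s)))"
      by (simp add: ac_simps)
  qed
qed

text \<open>Where \<open>bump \<delta>\<close> vanishes on a \<delta>-neighbourhood of
  \<open>y\<close>, truncations below \<delta> agree and the operator is an ordinary integral of
  nonpositive terms over \<open>\<bar>r\<bar> \<ge> \<delta>\<close>. There
  \<open>1 + \<bar>r\<bar> \<le> (1 + 1 / \<delta>) * \<bar>r\<bar>\<close>, which brings in the
  weight of \<open>nu_star\<close>. Outside the domain the size makes \<open>u\<close> times this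
  value integrable and the sign makes it disposable.\<close>

lemma A_op_bump_far:
  assumes d: "0 < \<delta>" and y: "2 * \<delta> \<le> norm y" and \<Omega>: "ball x \<delta> \<subseteq> \<Omega>" and [measurable]: "\<Omega> \<in> sets borel"
  shows "A_op s \<mu> (bump \<delta>) y \<le> 0"
    and "\<bar>A_op s \<mu> (bump \<delta>) y\<bar> \<le> (1 + 1 / \<delta>) powr (1 + 2 * s) * nu_star s \<mu> \<Omega> (y + x)"
proof -
  define I where "I = (\<lambda>r. LINT \<theta>|\<mu>. (bump \<delta> y - bump \<delta> (y + r *\<^sub>R \<theta>)) / \<bar>r\<bar> powr (1 + 2 * s))"
  define G where "G = (\<lambda>r. LINT \<theta>|\<mu>. bump \<delta> (y + r *\<^sub>R \<theta>))"
  have Gm [measurable]: "G \<in> borel_measurable borel" unfolding G_def by measurable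
  have b0: "bump \<delta> y = 0" using y d by (simp add: bump_eq_0_iff)
  have I: "I r = - (G r / \<bar>r\<bar> powr (1 + 2 * s))" for r
    by (simp add: I_def G_def b0)
  have G0: "0 \<le> G r" for r unfolding G_def by (simp add: bump_nonneg)
  have Gb: "\<bar>G r\<bar> \<le> measure \<mu> (space \<mu>)" for r
    using sphere_average_bound(2)[of "\<lambda>\<theta>. bump \<delta> (y + r *\<^sub>R \<theta>)" 1]
    by (simp add: G_def bump_nonneg bump_le_1)
  have Gz: "G r = 0" if "\<bar>r\<bar> < \<delta>" for r
  proof -
    have "bump \<delta> (y + r *\<^sub>R \<theta>) = 0" if "\<theta> \<in> space \<mu>" for \<theta>
      using norm_mu[OF that] y d \<open>\<bar>r\<bar> < \<delta>\<close> norm_triangle_ineq2[of y "- (r *\<^sub>R \<theta>)"]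
      by (simp add: bump_eq_0_iff)
    then show ?thesis unfolding G_def by (simp cong: Bochner_Integration.integral_cong)
  qed
  have trunc: "truncated \<kappa> (bump \<delta>) y = (LINT r|lborel. indicator {r. \<kappa> \<le> \<bar>r\<bar>} r * I r)" for \<kappa>
    by (simp only: truncated_def I_def)
  have T: "truncated \<kappa> (bump \<delta>) y = truncated \<delta> (bump \<delta>) y" if "\<kappa> \<in> {0<..<\<delta>}" for \<kappa>
    unfolding trunc
    by (rule Bochner_Integration.integral_cong) (use that Gz in \<open>auto simp: indicator_def I\<close>)
  have "A_op s \<mu> (bump \<delta>) y = truncated \<delta> (bump \<delta>) y"
    unfolding A_op_eq_Lim_truncated
  proof (rule tendsto_Lim)
    show "((\<lambda>\<kappa>. truncated \<kappa> (bump \<delta>) y) \<longlongrightarrow> truncated \<delta> (bump \<delta>) y) (at_right 0)"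
      using eventually_at_right_real[OF d]
      by (intro tendsto_eventually) (rule eventually_mono, assumption, rule T)
  qed simp
  also have "\<dots> = - (LINT r|lborel. indicator {r. \<delta> \<le> \<bar>r\<bar>} r * (G r / \<bar>r\<bar> powr (1 + 2 * s)))"
    unfolding trunc I by simp
  finally have eq: "A_op s \<mu> (bump \<delta>) y =
    - (LINT r|lborel. indicator {r. \<delta> \<le> \<bar>r\<bar>} r * (G r / \<bar>r\<bar> powr (1 + 2 * s)))" .
  have nn: "0 \<le> (LINT r|lborel. indicator {r. \<delta> \<le> \<bar>r\<bar>} r * (G r / \<bar>r\<bar> powr (1 + 2 * s)))"
    using G0 by (intro integral_nonneg_AE AE_I2) auto
  then show "A_op s \<mu> (bump \<delta>) y \<le> 0" by (simp add: eq)
  define K where "K = (1 + 1 / \<delta>) powr (1 + 2 * s)"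
  define H where "H = (\<lambda>r. LINT \<theta>|\<mu>. indicator \<Omega> (y + x + r *\<^sub>R \<theta>) * (1 + \<bar>r\<bar>) powr (- 1 - 2 * s))"
  have K0: "0 \<le> K" by (simp add: K_def)
  have iH: "integrable lborel H" unfolding H_def by (rule nu_star_integrable) simp
  have le: "indicator {r. \<delta> \<le> \<bar>r\<bar>} r * (G r / \<bar>r\<bar> powr (1 + 2 * s)) \<le> K * H r" for r
  proof (cases "\<delta> \<le> \<bar>r\<bar>")
    case True
    then have r: "0 < \<bar>r\<bar>" using d by linarith
    have "G r \<le> (LINT \<theta>|\<mu>. indicator \<Omega> (y + x + r *\<^sub>R \<theta>))"
      unfolding G_def
    proof (rule integral_mono)
      show "integrable \<mu> (\<lambda>\<theta>. bump \<delta> (y + r *\<^sub>R \<theta>))"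
        by (intro mu.integrable_const_bound[where B = 1]) (auto simp: bump_abs_le_1)
      show "integrable \<mu> (\<lambda>\<theta>. indicator \<Omega> (y + x + r *\<^sub>R \<theta>) :: real)"
        by (intro mu.integrable_const_bound[where B = 1]) auto
      show "bump \<delta> (y + r *\<^sub>R \<theta>) \<le> indicator \<Omega> (y + x + r *\<^sub>R \<theta>)" for \<theta>
      proof (cases "norm (y + r *\<^sub>R \<theta>) < \<delta>")
        case True
        moreover have "x - (y + x + r *\<^sub>R \<theta>) = - (y + r *\<^sub>R \<theta>)" by simp
        ultimately have "y + x + r *\<^sub>R \<theta> \<in> ball x \<delta>"
          unfolding mem_ball dist_norm by (simp only: norm_minus_cancel)
        then show ?thesis using \<Omega> bump_le_1 by (auto simp: indicator_def)
      next
        case False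
        then have "bump \<delta> (y + r *\<^sub>R \<theta>) = 0" using d by (simp add: bump_eq_0_iff)
        then show ?thesis by simp
      qed
    qed
    then have "G r * (1 + \<bar>r\<bar>) powr (- 1 - 2 * s) \<le> H r"
      unfolding H_def by (simp add: mult_right_mono)
    moreover have "1 / \<bar>r\<bar> powr (1 + 2 * s) \<le> K * (1 + \<bar>r\<bar>) powr (- 1 - 2 * s)"
    proof -
      have "1 + \<bar>r\<bar> \<le> (1 + 1 / \<delta>) * \<bar>r\<bar>" using True d by (simp add: field_simps)
      then have "(1 + \<bar>r\<bar>) powr (1 + 2 * s) \<le> ((1 + 1 / \<delta>) * \<bar>r\<bar>) powr (1 + 2 * s)"
        using s by (intro powr_mono2) auto
      also have "\<dots> = K * \<bar>r\<bar> powr (1 + 2 * s)" using d by (simp add: K_def powr_mult)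
      finally have "(1 + \<bar>r\<bar>) powr (1 + 2 * s) \<le> K * \<bar>r\<bar> powr (1 + 2 * s)" .
      moreover have e: "(1 + \<bar>r\<bar>) powr (- 1 - 2 * s) = 1 / (1 + \<bar>r\<bar>) powr (1 + 2 * s)"
        by (simp flip: powr_minus_divide)
      moreover have "0 < (1 + \<bar>r\<bar>) powr (1 + 2 * s)" "0 < \<bar>r\<bar> powr (1 + 2 * s)" using r by auto
      ultimately show ?thesis unfolding e by (simp add: divide_simps mult.commute)
    qed
    then have "G r * (1 / \<bar>r\<bar> powr (1 + 2 * s)) \<le> G r * (K * (1 + \<bar>r\<bar>) powr (- 1 - 2 * s))"
      by (intro mult_left_mono G0)
    ultimately have "G r * (1 / \<bar>r\<bar> powr (1 + 2 * s)) \<le> K * H r"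
      using K0 mult_left_mono[of "G r * (1 + \<bar>r\<bar>) powr (- 1 - 2 * s)" "H r" K] by (simp add: ac_simps)
    then show ?thesis using True by simp
  next
    case False
    have "0 \<le> H r" unfolding H_def by (intro integral_nonneg_AE AE_I2) auto
    then show ?thesis using False K0 by simp
  qed
  have "(LINT r|lborel. indicator {r. \<delta> \<le> \<bar>r\<bar>} r * (G r / \<bar>r\<bar> powr (1 + 2 * s))) \<le> (LINT r|lborel. K * H r)"
    by (intro integral_mono integrable_weighted[OF d Gm Gb] integrable_mult_right iH le)
  also have "\<dots> = K * nu_star s \<mu> \<Omega> (y + x)" by (simp add: H_def nu_star_def)
  finally show "\<bar>A_op s \<mu> (bump \<delta>) y\<bar> \<le> (1 + 1 / \<delta>) powr (1 + 2 * s) * nu_star s \<mu> \<Omega> (y + x)"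
    using nn by (simp add: eq K_def)
qed

text \<open>The constant of \<open>bump_second_difference\<close>, integrated against the kernel
  over small \<open>r\<close> and over \<mu>.\<close>

definition bump_const :: "real \<Rightarrow> real" where
  "bump_const \<delta> = (288 * \<delta>\<^sup>2 + 8) * measure \<mu> (space \<mu>) / (2 - 2 * s)"

lemma A_op_bump_measurable [measurable]: "0 < \<delta> \<Longrightarrow> A_op s \<mu> (bump \<delta>) \<in> borel_measurable borel"
  by (rule A_op_approx[OF borel_measurable_bump bump_abs_le_1 bump_second_difference]) auto

lemma A_op_bump_approx:
  "0 < \<delta> \<Longrightarrow> 0 < \<kappa> \<Longrightarrow> \<bar>A_trunc \<kappa> (bump \<delta>) x - A_op s \<mu> (bump \<delta>) x\<bar> \<le> bump_const \<delta> * \<kappa> powr (2 - 2 * s)"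
  unfolding bump_const_def
  by (rule A_op_approx(2)[OF borel_measurable_bump bump_abs_le_1 bump_second_difference]) auto

lemma A_op_bump_bounded: "0 < \<delta> \<Longrightarrow> \<exists>B. \<forall>x. \<bar>A_op s \<mu> (bump \<delta>) x\<bar> \<le> B"
proof (intro exI allI)
  fix x assume d: "0 < \<delta>"
  have "\<bar>A_trunc 1 (bump \<delta>) x\<bar> \<le> 4 * 1 * measure (K 1) (space (K 1))"
    unfolding A_trunc_def
    by (rule jump_diff_measurable_bounded(2)[OF finite_K measurable_jump borel_measurable_bump bump_abs_le_1]) simp
  then show "\<bar>A_op s \<mu> (bump \<delta>) x\<bar> \<le> 4 * measure (K 1) (space (K 1)) + bump_const \<delta>"
    using A_op_bump_approx[OF d, of 1 x] by simp
qed

text \<open>Testing with the bump centred at \<open>x\<close> is convolution evaluated at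
  \<open>x\<close>, and truncated operators commute with convolution. The radius
  \<open>2 * \<delta>\<close> leaves room for the support of the bump and for a gap \<delta> between
  that support and the complement. Truncation costs a uniform error, hence a multiple of the total
  mass of \<open>U\<close>.\<close>

lemma mollified_subsolution:
  fixes u U :: "'a \<Rightarrow> real"
  assumes \<Omega>: "open \<Omega>" and d: "0 < \<delta>" and x: "cball x (2 * \<delta>) \<subseteq> \<Omega>"
    and U: "integrable lborel U" and Um [measurable]: "U \<in> borel_measurable borel"
    and U0: "\<And>y. y \<notin> \<Omega> \<Longrightarrow> U y = 0" and Uu: "AE y in lebesgue. y \<in> \<Omega> \<longrightarrow> U y = u y"
    and L1w: "integrable (density lebesgue (\<lambda>x. ennreal (nu_star s \<mu> \<Omega> x))) u"
    and h1: "\<And>\<eta>. test_fun \<Omega> \<eta> \<Longrightarrow> (\<forall>x. 0 \<le> \<eta> x) \<Longrightarrow> (LINT x|lebesgue. u x * A_op s \<mu> \<eta> x) \<le> 0"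
    and h2: "AE x in lebesgue. x \<notin> \<Omega> \<longrightarrow> u x \<le> 0"
    and k: "0 < \<kappa>"
  shows "A_trunc \<kappa> (\<lambda>x. LINT y|lborel. U y * bump \<delta> (y - x)) x \<le>
    bump_const \<delta> * \<kappa> powr (2 - 2 * s) * (LINT y|lborel. \<bar>U y\<bar>)"
proof -
  have \<Omega>m [measurable]: "\<Omega> \<in> sets borel" using \<Omega> by simp
  define a where "a = (\<lambda>y. A_op s \<mu> (bump \<delta>) (y - x))"
  have am [measurable]: "a \<in> borel_measurable borel" unfolding a_def using A_op_bump_measurable[OF d] by measurable
  obtain B where B: "\<And>y. \<bar>a y\<bar> \<le> B" using A_op_bump_bounded[OF d] unfolding a_def by blast
  define V where "V = nu_star s \<mu> \<Omega>"
  have Vm [measurable]: "V \<in> borel_measurable borel" unfolding V_def nu_star_def by measurable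
  have V0: "0 \<le> V y" for y unfolding V_def nu_star_def by (intro integral_nonneg_AE AE_I2) auto
  have Vl: "V \<in> borel_measurable lebesgue" and al: "a \<in> borel_measurable lebesgue"
    and Ul: "U \<in> borel_measurable lebesgue" using Vm am Um by (simp_all add: measurable_completion)
  have um: "u \<in> borel_measurable lebesgue"
    using borel_measurable_integrable[OF L1w] by simp
  have iVu: "integrable lebesgue (\<lambda>y. V y * u y)"
    using L1w integrable_density[OF um Vl] V0 by (simp add: V_def)
  have iUa: "integrable lborel (\<lambda>y. U y * a y)"
    by (rule integrable_mult_bounded[OF U _ B]) (simp add: am)
  have far: "2 * \<delta> \<le> norm (y - x)" if "y \<notin> \<Omega>" for y
    using that x by (force simp: dist_norm norm_minus_commute)
  have ballx: "ball x \<delta> \<subseteq> \<Omega>" using x d by (auto simp: subset_iff)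
  have a_neg: "a y \<le> 0" and a_le: "\<bar>a y\<bar> \<le> (1 + 1 / \<delta>) powr (1 + 2 * s) * V y" if "y \<notin> \<Omega>" for y
    using A_op_bump_far[OF d far[OF that] ballx \<Omega>m] by (auto simp: a_def V_def)
  define K' where "K' = (1 + 1 / \<delta>) powr (1 + 2 * s)"
  have K'0: "0 \<le> K'" by (simp add: K'_def)
  \<comment> \<open>The part of the pairing outside the domain. Both factors are nonpositive there,
    so dropping it only helps; its integrability, supplied by the weight, is what allows the
    integral to be split.\<close>
  define out where "out = (\<lambda>y. indicator (- \<Omega>) y * (u y * a y))"
  have i2: "integrable lebesgue out"
  proof (rule Bochner_Integration.integrable_bound[OF integrable_mult_right[OF iVu, of K']])
    show "out \<in> borel_measurable lebesgue" unfolding out_def using um al \<Omega> by (intro borel_measurable_times borel_measurable_indicator) auto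
    show "AE y in lebesgue. norm (out y) \<le> norm (K' * (V y * u y))"
    proof (rule AE_I2)
      fix y
      show "norm (out y) \<le> norm (K' * (V y * u y))"
      proof (cases "y \<in> \<Omega>")
        case False
        have "\<bar>u y\<bar> * \<bar>a y\<bar> \<le> \<bar>u y\<bar> * (K' * V y)" using a_le[OF False] by (intro mult_left_mono) (auto simp: K'_def)
        then show ?thesis using False K'0 V0[of y] by (simp add: out_def abs_mult ac_simps)
      qed (simp add: out_def)
    qed
  qed
  have out0: "0 \<le> (LINT y|lebesgue. out y)"
  proof (rule integral_nonneg_AE)
    show "AE y in lebesgue. 0 \<le> out y"
      using h2 by eventually_elim (use a_neg in \<open>auto simp: out_def indicator_def intro: mult_nonpos_nonpos\<close>)
  qed
  have "(LINT y|lebesgue. u y * a y) = (LINT y|lebesgue. U y * a y + out y)"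
  proof (rule integral_cong_AE)
    show "AE y in lebesgue. u y * a y = U y * a y + out y"
      using Uu by eventually_elim (use U0 in \<open>auto simp: out_def indicator_def\<close>)
    show "(\<lambda>y. u y * a y) \<in> borel_measurable lebesgue" using um al by (intro borel_measurable_times)
    show "(\<lambda>y. U y * a y + out y) \<in> borel_measurable lebesgue"
      using Ul al borel_measurable_integrable[OF i2] by (intro borel_measurable_add borel_measurable_times)
  qed
  also have "\<dots> = (LINT y|lebesgue. U y * a y) + (LINT y|lebesgue. out y)"
    using iUa i2 by (intro Bochner_Integration.integral_add) (auto simp: integrable_completion)
  also have "(LINT y|lebesgue. U y * a y) = (LINT y|lborel. U y * a y)"
    by (rule integral_completion) (auto intro!: borel_measurable_times Um am)
  finally have "(LINT y|lborel. U y * a y) \<le> (LINT y|lebesgue. u y * a y)" using out0 by simp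
  also have "(LINT y|lebesgue. u y * a y) \<le> 0"
  proof -
    have "cball x \<delta> \<subseteq> \<Omega>" using x d by (auto simp: subset_iff)
    then have "(LINT y|lebesgue. u y * A_op s \<mu> (\<lambda>y. bump \<delta> (y - x)) y) \<le> 0"
      using d by (intro h1 test_fun_bump) (auto simp: bump_nonneg)
    then show ?thesis by (simp add: a_def A_op_shift)
  qed
  finally have Ua: "(LINT y|lborel. U y * a y) \<le> 0" .
  define c where "c = bump_const \<delta> * \<kappa> powr (2 - 2 * s)"
  have c: "\<bar>A_trunc \<kappa> (bump \<delta>) (y - x) - a y\<bar> \<le> c" for y
    using A_op_bump_approx[OF d k] by (simp add: a_def c_def)
  have Am [measurable]: "A_trunc \<kappa> (bump \<delta>) \<in> borel_measurable borel"
    unfolding A_trunc_def by (rule jump_diff_measurable_bounded(1)[OF finite_K[OF k] measurable_jump borel_measurable_bump bump_abs_le_1])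
  have le: "U y * A_trunc \<kappa> (bump \<delta>) (y - x) \<le> U y * a y + c * \<bar>U y\<bar>" for y
  proof -
    have "U y * (A_trunc \<kappa> (bump \<delta>) (y - x) - a y) \<le> \<bar>U y\<bar> * \<bar>A_trunc \<kappa> (bump \<delta>) (y - x) - a y\<bar>"
      by (metis abs_ge_self abs_mult)
    also have "\<dots> \<le> \<bar>U y\<bar> * c" using c by (intro mult_left_mono) auto
    finally show ?thesis by (simp add: algebra_simps)
  qed
  have iR: "integrable lborel (\<lambda>y. U y * a y + c * \<bar>U y\<bar>)"
    using iUa U by (intro Bochner_Integration.integrable_add integrable_mult_right integrable_abs)
  have iL: "integrable lborel (\<lambda>y. U y * A_trunc \<kappa> (bump \<delta>) (y - x))"
  proof (rule integrable_mult_bounded[OF U])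
    show "(\<lambda>y. A_trunc \<kappa> (bump \<delta>) (y - x)) \<in> borel_measurable lborel"
      by (auto intro!: measurable_compose[OF _ Am])
    show "\<bar>A_trunc \<kappa> (bump \<delta>) (y - x)\<bar> \<le> B + c" for y using c[of y] B[of y] by linarith
  qed
  have "A_trunc \<kappa> (\<lambda>x. LINT y|lborel. U y * bump \<delta> (y - x)) x = (LINT y|lborel. U y * A_trunc \<kappa> (bump \<delta>) (y - x))"
    unfolding A_trunc_def
    by (rule jump_diff_convolution[OF finite_K[OF k] measurable_jump U Um borel_measurable_bump bump_abs_le_1])
  also have "\<dots> \<le> (LINT y|lborel. U y * a y + c * \<bar>U y\<bar>)"
    by (intro integral_mono iL iR le)
  also have "\<dots> = (LINT y|lborel. U y * a y) + c * (LINT y|lborel. \<bar>U y\<bar>)"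
    using iUa U by simp
  finally show ?thesis using Ua by (simp add: c_def)
qed

end

subsection \<open>Exterior balls and concave profiles\<close>

text \<open>Let \<open>c\<close> be the centre of the exterior ball touching at the nearest boundary
  point. Then \<open>dist y c - \<rho>\<close> dominates the distance to the complement wherever it
  is nonnegative, with equality at \<open>y = x\<close>. Expanding \<open>dist (x + h) c\<close> to
  second order gives the claim, \<open>e\<close> being the direction from \<open>c\<close> to
  \<open>x\<close>.\<close>

lemma exterior_ball_distance_expansion:
  fixes \<Omega> :: "'a::euclidean_space set"
  assumes "bounded \<Omega>" "open \<Omega>" "uniform_exterior_ball \<Omega>"
  obtains \<rho> where "0 < \<rho>"
    "\<And>x. x \<in> \<Omega> \<Longrightarrow> \<exists>e. norm e = 1 \<and>
      (\<forall>h. infdist (x + h) (- \<Omega>) \<le> max 0 (infdist x (- \<Omega>) + e \<bullet> h + (norm h)\<^sup>2 / (2 * \<rho>)))"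
proof -
  obtain \<rho> where \<rho>: "0 < \<rho>" and ball: "\<forall>z\<in>frontier \<Omega>. \<exists>c. ball c \<rho> \<subseteq> - closure \<Omega> \<and> cball c \<rho> \<inter> closure \<Omega> = {z}"
    using assms(3) unfolding uniform_exterior_ball_def by (elim exE conjE)
  have ne: "- \<Omega> \<noteq> {}" 
  proof
    assume "- \<Omega> = {}"
    then have "\<Omega> = UNIV" by auto
    then show False using assms(1) by simp
  qed
  have cl: "closed (- \<Omega>)" using assms(2) by (simp add: closed_Compl)
  have "\<exists>e. norm e = 1 \<and>
      (\<forall>h. infdist (x + h) (- \<Omega>) \<le> max 0 (infdist x (- \<Omega>) + e \<bullet> h + (norm h)\<^sup>2 / (2 * \<rho>)))"
    if x: "x \<in> \<Omega>" for x
  proof -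
    define t where "t = infdist x (- \<Omega>)"
    obtain z where z: "z \<in> - \<Omega>" "t = dist x z"
      using infdist_attains_inf[OF cl ne, of x] unfolding t_def by blast
    have t: "0 < t" using z x by (auto simp: zero_less_dist_iff)
    \<comment> \<open>Moving from \<open>z\<close> slightly towards \<open>x\<close> comes strictly
      closer to \<open>x\<close> than the distance to the complement allows, so the moved point lies
      in the domain.\<close>
    have "z \<in> closure \<Omega>"
      unfolding closure_approachable
    proof (intro allI impI)
      fix \<epsilon> :: real assume \<epsilon>: "0 < \<epsilon>"
      define \<tau> where "\<tau> = min 1 (\<epsilon> / (2 * t))"
      have \<tau>: "0 < \<tau>" "\<tau> \<le> 1" using t \<epsilon> by (simp_all add: \<tau>_def)
      have "\<tau> * t \<le> \<epsilon> / (2 * t) * t" using t by (intro mult_right_mono) (auto simp: \<tau>_def)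
      also have "\<dots> < \<epsilon>" using t \<epsilon> by simp
      finally have \<tau>t: "\<tau> * t < \<epsilon>" .
      define p where "p = z + \<tau> *\<^sub>R (x - z)"
      have "x - p = (1 - \<tau>) *\<^sub>R (x - z)" by (simp add: p_def algebra_simps)
      then have "dist x p = (1 - \<tau>) * t" using \<tau> z by (simp add: dist_norm)
      then have "dist x p < t" using mult_pos_pos[OF \<tau>(1) t] by (simp add: algebra_simps)
      then have "p \<in> \<Omega>" using infdist_le[of p "- \<Omega>" x] by (cases "p \<in> \<Omega>") (simp_all add: t_def)
      moreover have "dist p z = \<tau> * t" using \<tau> z by (simp add: p_def dist_norm)
      ultimately show "\<exists>y\<in>\<Omega>. dist y z < \<epsilon>" using \<tau>t by (intro bexI[of _ p]) simp_all
    qed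
    then have "z \<in> frontier \<Omega>" using z assms(2) by (simp add: frontier_def interior_open)
    then obtain c where c: "cball c \<rho> \<inter> closure \<Omega> = {z}" using ball by auto
    have cb: "cball c \<rho> \<subseteq> - \<Omega>" 
    proof
      fix y assume y: "y \<in> cball c \<rho>"
      have "y \<notin> \<Omega>"
      proof
        assume "y \<in> \<Omega>"
        then have "y \<in> cball c \<rho> \<inter> closure \<Omega>" using y closure_subset[of \<Omega>] by blast
        then have "y = z" unfolding c by simp
        then show False using \<open>y \<in> \<Omega>\<close> z by simp
      qed
      then show "y \<in> - \<Omega>" by simp
    qed
    have "z \<in> cball c \<rho>" using c by blast
    then have zc: "dist z c \<le> \<rho>" by (simp add: dist_commute)
    have le: "infdist y (- \<Omega>) \<le> max 0 (dist y c - \<rho>)" for y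
    proof (cases "dist y c \<le> \<rho>")
      case True
      then have "y \<in> cball c \<rho>" by (simp add: dist_commute)
      then have "y \<in> - \<Omega>" using cb by blast
      then show ?thesis by simp
    next
      case False
      define b where "b = dist y c"
      have b: "\<rho> < b" using False by (simp add: b_def)
      define p where "p = c + (\<rho> / b) *\<^sub>R (y - c)"
      have "p \<in> cball c \<rho>" using b \<rho> by (simp add: p_def dist_norm b_def)
      then have "infdist y (- \<Omega>) \<le> dist y p" using cb by (intro infdist_le) blast
      also have "dist y p = (1 - \<rho> / b) * b"
      proof -
        have "y - p = (1 - \<rho> / b) *\<^sub>R (y - c)" by (simp add: p_def algebra_simps)
        moreover have "0 \<le> 1 - \<rho> / b" using b \<rho> by simp
        ultimately show ?thesis by (simp add: dist_norm b_def)
      qed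
      also have "\<dots> = b - \<rho>" using b \<rho> by (simp add: field_simps)
      finally show ?thesis by (simp add: b_def)
    qed
    define A where "A = dist x c"
    \<comment> \<open>The triangle inequality through \<open>z\<close> gives one direction, the
      domination at \<open>y = x\<close> the other.\<close>
    have A: "A = t + \<rho>"
    proof (rule antisym)
      show "A \<le> t + \<rho>" using dist_triangle[of x c z] zc z by (simp add: A_def)
      show "t + \<rho> \<le> A" using le[of x] t unfolding A_def t_def max_def by (cases "0 \<le> dist x c - \<rho>") auto
    qed
    have A0: "0 < A" "\<rho> \<le> A" using A t \<rho> by auto
    define e where "e = (1 / A) *\<^sub>R (x - c)"
    have "norm e = 1" using A0 by (simp add: e_def A_def dist_norm)
    moreover have "infdist (x + h) (- \<Omega>) \<le> max 0 (t + e \<bullet> h + (norm h)\<^sup>2 / (2 * \<rho>))" for h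
    proof -
      define a where "a = dist (x + h) c"
      have "a\<^sup>2 = A\<^sup>2 + 2 * A * (e \<bullet> h) + (norm h)\<^sup>2"
      proof -
        have "x + h - c = (x - c) + h" by simp
        then have "a\<^sup>2 = (norm ((x - c) + h))\<^sup>2" unfolding a_def dist_norm by (simp only:)
        also have "\<dots> = A\<^sup>2 + 2 * ((x - c) \<bullet> h) + (norm h)\<^sup>2"
          using dot_norm[of "x - c" h] by (simp add: A_def dist_norm)
        also have "(x - c) \<bullet> h = A * (e \<bullet> h)" using A0 by (simp add: e_def)
        finally show ?thesis by simp
      qed
      \<comment> \<open>This replaces the square root by its tangent at \<open>A\<close>, which lies
        above it.\<close>
      moreover have "2 * A * a \<le> A\<^sup>2 + a\<^sup>2" by (rule sum_squares_bound)
      moreover have "2 * A * (A + e \<bullet> h + (norm h)\<^sup>2 / (2 * A)) = 2 * A\<^sup>2 + 2 * A * (e \<bullet> h) + (norm h)\<^sup>2"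
        using A0 by (simp add: distrib_left power2_eq_square)
      ultimately have "2 * A * a \<le> 2 * A * (A + e \<bullet> h + (norm h)\<^sup>2 / (2 * A))" by linarith
      then have "a \<le> A + e \<bullet> h + (norm h)\<^sup>2 / (2 * A)" using A0 by simp
      also have "\<dots> \<le> A + e \<bullet> h + (norm h)\<^sup>2 / (2 * \<rho>)"
        using A0 \<rho> by (intro add_left_mono divide_left_mono) auto
      finally show ?thesis using le[of "x + h"] A by (simp add: a_def)
    qed
    ultimately show ?thesis unfolding t_def by blast
  qed
  with \<rho> show ?thesis by (rule that)
qed

section \<open>A concave profile with prescribed logarithmic slope\<close>

definition concave_slope :: "real \<Rightarrow> real \<Rightarrow> real" where
  "concave_slope \<beta> v = exp (- \<beta> * sqrt v)"

text \<open>\<open>concave_profile \<beta>\<close> is the antiderivative of \<open>concave_slope \<beta>\<close> vanishing at \<open>0\<close>. At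
  \<open>v = t powr s\<close> its logarithmic slope has derivative \<open>- \<beta> / 2 * t powr (- s / 2)\<close>, which for
  large \<open>\<beta>\<close> beats the error \<open>O(t powr (- s / 2))\<close> made by replacing the distance to the complement
  by an affine function.\<close>
definition concave_profile :: "real \<Rightarrow> real \<Rightarrow> real" where
  "concave_profile \<beta> v = 2 / \<beta>\<^sup>2 * (1 - (1 + \<beta> * sqrt v) * exp (- \<beta> * sqrt v))"

lemma concave_profile_has_derivative:
  assumes "0 < \<beta>" "0 < v"
  shows "(concave_profile \<beta> has_real_derivative concave_slope \<beta> v) (at v)"
proof -
  have "sqrt v \<noteq> 0" using assms by simp
  then show ?thesis
    unfolding concave_profile_def concave_slope_def using assms
    by (auto intro!: derivative_eq_intros simp: divide_simps power2_eq_square) (simp add: algebra_simps)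
qed

lemma continuous_concave_profile: "0 < \<beta> \<Longrightarrow> continuous_on S (concave_profile \<beta>)"
  unfolding concave_profile_def by (intro continuous_intros) auto

lemma concave_slope_pos: "0 < concave_slope \<beta> v"
  by (simp add: concave_slope_def)

lemma concave_slope_antimono: "0 < \<beta> \<Longrightarrow> a \<le> b \<Longrightarrow> concave_slope \<beta> b \<le> concave_slope \<beta> a"
  by (simp add: concave_slope_def)

lemma concave_slope_le_1: "0 < \<beta> \<Longrightarrow> 0 \<le> v \<Longrightarrow> concave_slope \<beta> v \<le> 1"
  by (simp add: concave_slope_def)

lemma concave_profile_0 [simp]: "concave_profile \<beta> 0 = 0"
  by (simp add: concave_profile_def)

lemma concave_profile_mvt:
  assumes "0 < \<beta>" "0 \<le> b" "b < a"
  obtains \<xi> where "b < \<xi>" "\<xi> < a" "concave_profile \<beta> a - concave_profile \<beta> b = (a - b) * concave_slope \<beta> \<xi>"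
proof -
  have diff: "concave_profile \<beta> differentiable (at x)" if "b < x" for x
    using concave_profile_has_derivative[OF assms(1), of x] that assms(2)
    by (meson le_less_trans real_differentiable_def)
  have "\<exists>l z. b < z \<and> z < a \<and> DERIV (concave_profile \<beta>) z :> l \<and> concave_profile \<beta> a - concave_profile \<beta> b = (a - b) * l"
    using assms diff by (intro MVT continuous_concave_profile) auto
  then obtain l z where z: "b < z" "z < a" "DERIV (concave_profile \<beta>) z :> l"
    "concave_profile \<beta> a - concave_profile \<beta> b = (a - b) * l" by blast
  moreover have "l = concave_slope \<beta> z"
    using DERIV_unique[OF z(3) concave_profile_has_derivative] z assms by simp
  ultimately show ?thesis using that[of z] by simp
qed

lemma concave_profile_le:
  assumes "0 < \<beta>" "0 \<le> b" "b \<le> a"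
  shows "concave_profile \<beta> b \<le> concave_profile \<beta> a"
    and "concave_profile \<beta> a - concave_profile \<beta> b \<le> a - b"
proof -
  have "concave_profile \<beta> b \<le> concave_profile \<beta> a \<and> concave_profile \<beta> a - concave_profile \<beta> b \<le> a - b"
  proof (cases "b = a")
    case False
    then have "b < a" using assms by simp
    then obtain \<xi> where \<xi>: "b < \<xi>" "\<xi> < a"
      "concave_profile \<beta> a - concave_profile \<beta> b = (a - b) * concave_slope \<beta> \<xi>"
      by (rule concave_profile_mvt[OF assms(1,2)])
    have "(a - b) * concave_slope \<beta> \<xi> \<le> (a - b) * 1"
      using assms \<xi> concave_slope_le_1[of \<beta> \<xi>] by (intro mult_left_mono) auto
    moreover have "0 \<le> (a - b) * concave_slope \<beta> \<xi>"
      using assms concave_slope_pos[of \<beta> \<xi>] by simp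
    ultimately show ?thesis using \<xi> by simp
  qed simp
  then show "concave_profile \<beta> b \<le> concave_profile \<beta> a" "concave_profile \<beta> a - concave_profile \<beta> b \<le> a - b" by auto
qed

lemma concave_profile_tangent:
  assumes "0 < \<beta>" "0 \<le> a" "0 \<le> b"
  shows "concave_profile \<beta> b - concave_profile \<beta> a \<le> concave_slope \<beta> a * (b - a)"
proof -
  consider "a = b" | "b < a" | "a < b" by linarith
  then show ?thesis
  proof cases
    case 2
    then obtain \<xi> where \<xi>: "b < \<xi>" "\<xi> < a"
      "concave_profile \<beta> a - concave_profile \<beta> b = (a - b) * concave_slope \<beta> \<xi>"
      by (rule concave_profile_mvt[OF assms(1,3)])
    have "(a - b) * concave_slope \<beta> a \<le> (a - b) * concave_slope \<beta> \<xi>"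
      using 2 \<xi> concave_slope_antimono[OF assms(1), of \<xi> a] by (intro mult_left_mono) auto
    then show ?thesis using \<xi> by (simp add: algebra_simps)
  next
    case 3
    then obtain \<xi> where \<xi>: "a < \<xi>" "\<xi> < b"
      "concave_profile \<beta> b - concave_profile \<beta> a = (b - a) * concave_slope \<beta> \<xi>"
      by (rule concave_profile_mvt[OF assms(1,2)])
    have "(b - a) * concave_slope \<beta> \<xi> \<le> (b - a) * concave_slope \<beta> a"
      using 3 \<xi> concave_slope_antimono[OF assms(1), of a \<xi>] by (intro mult_left_mono) auto
    then show ?thesis using \<xi> by (simp add: algebra_simps)
  qed simp
qed

text \<open>The coefficient is half of \<open>\<beta> / (2 * sqrt a)\<close>, minus the logarithmic
  derivative of the slope at \<open>a\<close>. It suffices that the slope at \<open>v < a\<close>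
  exceeds its linearisation, which follows from \<open>exp y \<ge> 1 + y\<close> and concavity of
  the square root. Only the descending side \<open>b \<le> a\<close> is needed later.\<close>

lemma concave_profile_tangent_gain:
  assumes l: "0 < \<beta>" and a: "0 < a" and b: "0 \<le> b" "b \<le> a"
  shows "concave_profile \<beta> b - concave_profile \<beta> a \<le>
    concave_slope \<beta> a * ((b - a) - \<beta> / (4 * sqrt a) * (b - a)\<^sup>2)"
proof -
  define P where "P = (\<lambda>v. concave_profile \<beta> v -
    concave_slope \<beta> a * ((v - a) - \<beta> / (4 * sqrt a) * (v - a)\<^sup>2))"
  define P' where "P' = (\<lambda>v. concave_slope \<beta> v -
    concave_slope \<beta> a * (1 - \<beta> / (2 * sqrt a) * (v - a)))"
  have "P b \<le> P a"
  proof (cases "b = a")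
    case False
    have dP: "(P has_real_derivative P' v) (at v)" if "0 < v" for v
      unfolding P_def P'_def using a
      by (auto intro!: derivative_eq_intros concave_profile_has_derivative[OF l that] simp: field_simps)
    have "0 \<le> P' v" if "0 < v" "v < a" for v
    proof -
      have sq: "sqrt v \<le> sqrt a" "0 < sqrt a" "0 < sqrt v" using that a by auto
      have "a - v = (sqrt a - sqrt v) * (sqrt a + sqrt v)"
        using that a by (simp add: algebra_simps)
      also have "\<dots> \<le> (sqrt a - sqrt v) * (2 * sqrt a)"
        using sq by (intro mult_left_mono) auto
      finally have "(a - v) / (2 * sqrt a) \<le> sqrt a - sqrt v" using sq by (simp add: field_simps)
      then have "\<beta> * ((a - v) / (2 * sqrt a)) \<le> \<beta> * (sqrt a - sqrt v)" using l by (intro mult_left_mono) auto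
      also have "1 + \<dots> \<le> exp (\<beta> * (sqrt a - sqrt v))" by (rule exp_ge_add_one_self)
      finally have "1 - \<beta> / (2 * sqrt a) * (v - a) \<le> exp (\<beta> * (sqrt a - sqrt v))"
        by (simp add: diff_divide_distrib right_diff_distrib)
      then have "concave_slope \<beta> a * (1 - \<beta> / (2 * sqrt a) * (v - a)) \<le>
          concave_slope \<beta> a * exp (\<beta> * (sqrt a - sqrt v))"
        using concave_slope_pos[of \<beta> a] by (intro mult_left_mono) auto
      also have "\<dots> = concave_slope \<beta> v"
        by (simp add: concave_slope_def right_diff_distrib flip: exp_add)
      finally show ?thesis by (simp add: P'_def)
    qed
    then have "\<exists>y. (P has_real_derivative y) (at x) \<and> 0 \<le> y" if "b < x" "x < a" for x
      using dP[of x] that b by (meson le_less_trans)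
    moreover have "continuous_on {b..a} P"
      unfolding P_def using a by (intro continuous_intros continuous_concave_profile l) auto
    ultimately show ?thesis using b by (intro DERIV_nonneg_imp_increasing_open[of b a P]) auto
  qed simp
  then show ?thesis unfolding P_def by simp
qed

section \<open>Bending error and concavity gain along one line\<close>

lemma powr_tangent:
  fixes s t q :: real
  assumes "0 < s" "s < 1" "0 < t" "- t \<le> q"
  shows "(t + q) powr s \<le> t powr s + s * t powr (s - 1) * q"
proof (cases "t + q = 0")
  case True
  have "t * t powr (s - 1) = t powr s" using assms powr_add[of t 1 "s - 1"] by simp
  moreover have "q = - t" using True by simp
  then have "s * t powr (s - 1) * q = - (s * (t * t powr (s - 1)))" by simp
  ultimately have "s * t powr (s - 1) * q = - (s * t powr s)" by simp
  moreover have "s * t powr s \<le> 1 * t powr s" using assms by (intro mult_right_mono) auto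
  ultimately show ?thesis using True by simp
next
  case False
  then have p: "0 < t + q" using assms by linarith
  have "(1 + q / t) powr s \<le> 1 + s * (q / t)"
  proof -
    have y: "0 < 1 + q / t" using p assms by (simp add: field_simps)
    define y where "y = 1 + q / t"
    have "y powr s * 1 powr (1 - s) \<le> s * y + (1 - s) * 1"
      using Youngs_inequality_0[of s "1 - s" y 1] y assms by (simp add: y_def)
    then show ?thesis by (simp add: y_def algebra_simps)
  qed
  then have "t powr s * (1 + q / t) powr s \<le> t powr s * (1 + s * (q / t))"
    by (intro mult_left_mono) auto
  moreover have "t powr s * (1 + q / t) powr s = (t + q) powr s"
  proof -
    have "t + q = t * (1 + q / t)" using assms by (simp add: field_simps)
    then show ?thesis by (simp only: powr_mult)
  qed
  moreover have "t powr s = t * t powr (s - 1)" using assms powr_add[of t 1 "s - 1"] by simp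
  moreover have "t * t powr (s - 1) * (1 + s * (q / t)) = t * t powr (s - 1) + s * t powr (s - 1) * q"
    using assms by (simp add: field_simps)
  ultimately show ?thesis by simp
qed

definition bend_const :: "real \<Rightarrow> real \<Rightarrow> real \<Rightarrow> real" where
  "bend_const s \<rho> D = 4 * (2 * \<rho>) powr (- s) + D powr (1 - s) / \<rho>"

text \<open>Two regimes, one summand of \<open>bend_const\<close> each. For
  \<open>t \<le> 2 * r\<close> subadditivity splits off the quadratic term, and
  \<open>(2 * r / t) powr \<gamma> \<ge> 1\<close> may be inserted. For \<open>r < t / 2\<close> the
  affine function stays above \<open>t / 2\<close>, so the tangent bound gives
  \<open>t powr (s - 1) * r\<^sup>2\<close>, and surplus powers of \<open>r\<close> are traded for
  powers of \<open>t\<close>.\<close>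

lemma bend_estimate:
  fixes s \<rho> D t c r :: real
  assumes s: "0 < s" "s < 1" and \<rho>: "0 < \<rho>" and t: "0 < t" "t \<le> D" and c: "\<bar>c\<bar> \<le> 1" and r: "0 < r"
    and \<gamma>: "0 < \<gamma>" "\<gamma> \<le> 1" "\<gamma> \<le> 2 - 2 * s"
  shows "max 0 (t + c * r + r\<^sup>2 / (2 * \<rho>)) powr s \<le>
    max 0 (t + c * r) powr s + bend_const s \<rho> D * t powr (- \<gamma>) * r powr (2 * s + \<gamma>)"
proof -
  define q where "q = r\<^sup>2 / (2 * \<rho>)"
  have q: "0 < q" using r \<rho> by (simp add: q_def)
  define X where "X = t powr (- \<gamma>) * r powr (2 * s + \<gamma>)"
  have X: "0 \<le> X" by (simp add: X_def)
  have D0: "0 \<le> D powr (1 - s) / \<rho>" using \<rho> by simp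
  have "max 0 (t + c * r + q) powr s \<le> max 0 (t + c * r) powr s + bend_const s \<rho> D * X"
  proof (cases "t \<le> 2 * r")
    case True
    have "max 0 (t + c * r + q) powr s \<le> (max 0 (t + c * r) + q) powr s"
      using s q by (intro powr_mono2) auto
    also have "\<dots> \<le> max 0 (t + c * r) powr s + q powr s"
      using q by (intro powr_add_subadditive s) auto
    also have "q powr s \<le> 4 * (2 * \<rho>) powr (- s) * X"
    proof -
      have "q powr s = r powr (2 * s) * (2 * \<rho>) powr (- s)"
      proof -
        have "r\<^sup>2 = r powr 2" using r by (simp add: powr_numeral)
        then have "r\<^sup>2 powr s = (r powr 2) powr s" by (simp only:)
        also have "\<dots> = r powr (2 * s)" by (rule powr_powr)
        finally have "r\<^sup>2 powr s = r powr (2 * s)" .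
        moreover have "q powr s = r\<^sup>2 powr s / (2 * \<rho>) powr s"
          unfolding q_def by (rule powr_divide)
        ultimately show ?thesis by (simp only: powr_minus divide_inverse)
      qed
      moreover have "1 \<le> 4 * (r powr \<gamma> * t powr (- \<gamma>))"
      proof -
        have "1 \<le> (2 * r / t) powr \<gamma>" using True t \<gamma> by (intro ge_one_powr_ge_zero) auto
        also have "\<dots> = 2 powr \<gamma> * (r powr \<gamma> * t powr (- \<gamma>))"
        proof -
          have "(2 * r / t) powr \<gamma> = (2 * r) powr \<gamma> / t powr \<gamma>" by (rule powr_divide)
          also have "(2 * r) powr \<gamma> = 2 powr \<gamma> * r powr \<gamma>" by (rule powr_mult)
          finally show ?thesis by (simp only: powr_minus divide_inverse mult.assoc)
        qed
        also have "2 powr \<gamma> \<le> 2 powr 1" using \<gamma> by (intro powr_mono) auto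
        then have "2 powr \<gamma> * (r powr \<gamma> * t powr (- \<gamma>)) \<le> 4 * (r powr \<gamma> * t powr (- \<gamma>))"
          by (intro mult_right_mono) auto
        finally show ?thesis .
      qed
      then have "r powr (2 * s) * (2 * \<rho>) powr (- s) * 1 \<le>
          r powr (2 * s) * (2 * \<rho>) powr (- s) * (4 * (r powr \<gamma> * t powr (- \<gamma>)))"
        by (intro mult_left_mono) auto
      ultimately show ?thesis by (simp add: X_def powr_add algebra_simps)
    qed
    also have "\<dots> \<le> bend_const s \<rho> D * X"
      using D0 X by (intro mult_right_mono) (auto simp: bend_const_def)
    finally show ?thesis by simp
  next
    case False
    then have rt: "r < t / 2" by simp
    define p where "p = t + c * r"
    have "- r \<le> c * r" using c r mult_right_mono[of "- 1" c r] by simp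
    then have p: "t / 2 \<le> p" using rt by (simp add: p_def)
    then have p0: "0 < p" using t by linarith
    have "(p + q) powr s \<le> p powr s + s * p powr (s - 1) * q"
      using p0 q by (intro powr_tangent s) auto
    also have "s * p powr (s - 1) * q \<le> 1 * (2 * t powr (s - 1)) * q"
    proof -
      have "p powr (s - 1) \<le> (t / 2) powr (s - 1)" using p t s by (intro powr_mono2') auto
      also have "\<dots> = 2 powr (1 - s) * t powr (s - 1)"
        using t by (simp add: powr_divide powr_diff)
      also have "2 powr (1 - s) \<le> 2 powr 1" using s by (intro powr_mono) auto
      then have "2 powr (1 - s) * t powr (s - 1) \<le> 2 * t powr (s - 1)"
        by (intro mult_right_mono) auto
      finally have "p powr (s - 1) \<le> 2 * t powr (s - 1)" .
      then show ?thesis using s q by (intro mult_right_mono mult_mono) auto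
    qed
    also have "1 * (2 * t powr (s - 1)) * q = t powr (s - 1) * r powr 2 / \<rho>"
      using r by (simp add: q_def powr_numeral)
    also have "r powr 2 \<le> r powr (2 * s + \<gamma>) * t powr (2 - 2 * s - \<gamma>)"
    proof -
      have "r powr 2 = r powr (2 * s + \<gamma>) * r powr (2 - 2 * s - \<gamma>)" by (simp flip: powr_add)
      also have "\<dots> \<le> r powr (2 * s + \<gamma>) * t powr (2 - 2 * s - \<gamma>)"
        using r rt t \<gamma> by (intro mult_left_mono powr_mono2) auto
      finally show ?thesis .
    qed
    then have "t powr (s - 1) * r powr 2 / \<rho> \<le>
        t powr (s - 1) * (r powr (2 * s + \<gamma>) * t powr (2 - 2 * s - \<gamma>)) / \<rho>"
      using \<rho> by (intro divide_right_mono mult_left_mono) auto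
    also have "\<dots> = t powr (1 - s) * X / \<rho>"
    proof -
      have "t powr (s - 1) * t powr (2 - 2 * s - \<gamma>) = t powr (1 - s) * t powr (- \<gamma>)"
      proof -
        have "s - 1 + (2 - 2 * s - \<gamma>) = 1 - s + (- \<gamma>)" by simp
        then show ?thesis by (simp only: powr_add[symmetric])
      qed
      then show ?thesis by (simp add: X_def mult_ac)
    qed
    also have "\<dots> \<le> D powr (1 - s) * X / \<rho>"
      using X t s \<rho> by (intro divide_right_mono mult_right_mono powr_mono2) auto
    also have "\<dots> \<le> bend_const s \<rho> D * X"
    proof -
      have "D powr (1 - s) / \<rho> * X \<le> bend_const s \<rho> D * X"
        using X \<rho> by (intro mult_right_mono) (auto simp: bend_const_def)
      then show ?thesis by simp
    qed
    finally show ?thesis using p0 q by (simp add: p_def)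
  qed
  then show ?thesis by (simp add: q_def X_def mult.assoc)
qed

text \<open>In the descending direction and for \<open>r\<close> up to a small multiple of
  \<open>t * c\<close>, the quadratic term eats at most half of the linear decrease
  \<open>c * r\<close>. So \<open>w powr s\<close> lies below \<open>t powr s\<close> by at least a
  multiple of \<open>t powr (s - 1) * c * r\<close>; its square over
  \<open>4 * t powr (s / 2)\<close> is the gain. One part of the minimum controls the bending, the
  other keeps the affine function nonnegative.\<close>

lemma concave_gain_estimate:
  fixes s \<rho> D t c r \<beta> w :: real
  assumes s: "0 < s" "s < 1" and \<rho>: "0 < \<rho>" and t: "0 < t" "t \<le> D" and c: "0 < c" "c \<le> 1"
    and r: "0 < r" "r \<le> min (\<rho> / D) 1 * t * c" and \<beta>: "0 < \<beta>"
    and w: "0 \<le> w" "w \<le> max 0 (t - c * r + r\<^sup>2 / (2 * \<rho>))"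
  shows "concave_profile \<beta> (w powr s) - concave_profile \<beta> (t powr s) \<le>
    concave_slope \<beta> (t powr s) * ((w powr s - t powr s) -
      \<beta> * s\<^sup>2 / 16 * t powr (3 * s / 2 - 2) * c\<^sup>2 * r powr 2)"
proof -
  have D: "0 < D" using t by linarith
  have "min (\<rho> / D) 1 * t * c \<le> \<rho> / D * D * c"
    using t c \<rho> D by (intro mult_right_mono mult_mono) auto
  then have r1: "r \<le> \<rho> * c" using r D by simp
  have "min (\<rho> / D) 1 * t * c \<le> 1 * t * c" using t c by (intro mult_right_mono) auto
  then have r2: "r \<le> t * c" using r by simp
  have "c * r \<le> 1 * r" using c r by (intro mult_right_mono) auto
  moreover have "t * c \<le> t * 1" using t c by (intro mult_left_mono) auto
  ultimately have cr: "c * r \<le> t" using r2 by linarith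
  have "r * r \<le> \<rho> * c * r" using r1 r by (intro mult_right_mono) auto
  then have "r\<^sup>2 / (2 * \<rho>) \<le> c * r / 2" using \<rho> by (simp add: field_simps power2_eq_square)
  then have wl: "w \<le> t - c * r / 2" using w cr t by (simp add: max_def split: if_splits)
  define v where "v = w powr s"
  define a where "a = t powr s"
  have a: "0 < a" using t by (simp add: a_def)
  have "v \<le> (t + - (c * r / 2)) powr s" unfolding v_def using w wl s by (intro powr_mono2) auto
  also have "\<dots> \<le> t powr s + s * t powr (s - 1) * - (c * r / 2)"
    using cr t c r by (intro powr_tangent s) auto
  finally have v: "s * t powr (s - 1) * (c * r / 2) \<le> a - v" by (simp add: a_def)
  have v0: "0 \<le> v" "v \<le> a"
  proof -
    show "0 \<le> v" by (simp add: v_def)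
    have "0 \<le> s * t powr (s - 1) * (c * r / 2)" using s c r by simp
    then show "v \<le> a" using v by linarith
  qed
  have "concave_profile \<beta> v - concave_profile \<beta> a \<le>
      concave_slope \<beta> a * ((v - a) - \<beta> / (4 * sqrt a) * (v - a)\<^sup>2)"
    by (rule concave_profile_tangent_gain[OF \<beta> a v0])
  also have "\<dots> \<le> concave_slope \<beta> a * ((v - a) - \<beta> * s\<^sup>2 / 16 * t powr (3 * s / 2 - 2) * c\<^sup>2 * r powr 2)"
  proof -
    have "(s * t powr (s - 1) * (c * r / 2))\<^sup>2 \<le> (a - v)\<^sup>2"
      using v s t c r by (intro power_mono) auto
    then have "\<beta> / (4 * sqrt a) * (s * t powr (s - 1) * (c * r / 2))\<^sup>2 \<le> \<beta> / (4 * sqrt a) * (v - a)\<^sup>2"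
      using \<beta> a by (intro mult_left_mono) (auto simp: power2_commute)
    moreover have "\<beta> / (4 * sqrt a) * (s * t powr (s - 1) * (c * r / 2))\<^sup>2 =
        \<beta> * s\<^sup>2 / 16 * t powr (3 * s / 2 - 2) * c\<^sup>2 * r powr 2"
    proof -
      have "sqrt a = t powr (s / 2)" by (simp add: a_def powr_half_sqrt[symmetric] powr_powr)
      moreover have "t powr (s - 1) * t powr (s - 1) / t powr (s / 2) = t powr (3 * s / 2 - 2)"
      proof -
        have "t powr (s - 1) * t powr (s - 1) / t powr (s / 2) = t powr (s - 1 + (s - 1) - s / 2)"
          by (simp only: powr_add powr_diff)
        also have "s - 1 + (s - 1) - s / 2 = 3 * s / 2 - 2" by simp
        finally show ?thesis .
      qed
      moreover have "r powr 2 = r * r" using r by (simp add: powr_numeral power2_eq_square)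
      moreover have "\<beta> / (4 * sqrt a) * (s * t powr (s - 1) * (c * r / 2))\<^sup>2 =
          \<beta> * s\<^sup>2 / 16 * (t powr (s - 1) * t powr (s - 1) / sqrt a) * c\<^sup>2 * (r * r)"
        by (simp add: power2_eq_square)
      ultimately show ?thesis by (simp only:)
    qed
    ultimately show ?thesis using concave_slope_pos[of \<beta> a] by (intro mult_left_mono) auto
  qed
  finally show ?thesis by (simp add: v_def a_def)
qed

subsection \<open>The barrier on a line\<close>

lemma borel_measurable_concave_profile [measurable]:
  "0 < \<beta> \<Longrightarrow> concave_profile \<beta> \<in> borel_measurable borel"
  by (rule borel_measurable_continuous_onI[OF continuous_concave_profile])

lemma concave_profile_powr_bounds:
  assumes "0 < \<beta>" "0 < s" "0 \<le> w" "w \<le> D"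
  shows "0 \<le> concave_profile \<beta> (w powr s)" "concave_profile \<beta> (w powr s) \<le> w powr s"
    "\<bar>concave_profile \<beta> (w powr s)\<bar> \<le> D powr s"
proof -
  show 1: "0 \<le> concave_profile \<beta> (w powr s)" "concave_profile \<beta> (w powr s) \<le> w powr s"
    using concave_profile_le[OF assms(1), of 0 "w powr s"] by auto
  have "w powr s \<le> D powr s" using assms by (intro powr_mono2) auto
  then show "\<bar>concave_profile \<beta> (w powr s)\<bar> \<le> D powr s" using 1 by simp
qed

text \<open>The crude bending error \<open>r powr (2 * s)\<close> is only just not integrable against
  \<open>r powr (- 1 - 2 * s)\<close>; an extra factor \<open>(r / t) powr barrier_exp s\<close> repairs this at a cost of at
  most \<open>t powr (- s / 2)\<close>.\<close>
definition barrier_exp :: "real \<Rightarrow> real" where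
  "barrier_exp s = min (s / 2) (2 - 2 * s)"

text \<open>First summand: bending error over \<open>r \<le> 1\<close>. Second: boundedness over
  \<open>r \<ge> 1\<close>. Powers of \<open>D\<close> appear because \<open>t \<le> D\<close> is
  used to bring both under the common power \<open>t powr (- s / 2)\<close>.\<close>

definition barrier_loss :: "real \<Rightarrow> real \<Rightarrow> real \<Rightarrow> real" where
  "barrier_loss s \<rho> D = 2 * bend_const s \<rho> D * D powr (s / 2 - barrier_exp s) / barrier_exp s
    + 2 * D powr s * D powr (s / 2) / s"

text \<open>The integral of \<open>r\<^sup>2\<close> against the kernel over the range of
  \<open>concave_gain_estimate\<close>, with the coefficient from there and with \<beta> and the
  powers of \<open>t\<close> and \<open>c\<close> taken out.\<close>

definition barrier_gain :: "real \<Rightarrow> real \<Rightarrow> real \<Rightarrow> real" where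
  "barrier_gain s \<rho> D = s\<^sup>2 / 16 * min (\<rho> / D) 1 powr (2 - 2 * s) / (2 - 2 * s)"

text \<open>The two truncation errors, from the affine second difference and from the gain integral.
  It decreases in \<open>t\<close>, so a lower bound on the distance makes it uniform.\<close>

definition barrier_rem :: "real \<Rightarrow> real \<Rightarrow> real \<Rightarrow> real" where
  "barrier_rem \<beta> s t = (8 + 4 / s) * t powr (s - 2) + \<beta> * s\<^sup>2 / 16 / (2 - 2 * s) * t powr (3 * s / 2 - 2)"

lemma barrier_exp_pos: "0 < s \<Longrightarrow> s < 1 \<Longrightarrow> 0 < barrier_exp s"
  by (simp add: barrier_exp_def)

text \<open>Both increments of the profile are bounded by its tangent at \<open>t powr s\<close>,
  which reduces them to increments of \<open>d powr s\<close> with factor \<sigma>; the descending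
  side \<open>wm\<close> retains the quadratic gain. Replacing the bent lines by affine ones leaves
  a second difference whose truncated integral is almost nonnegative.\<close>

lemma line_estimate_nonneg:
  fixes s \<rho> D t c \<beta> \<kappa> :: real and wp wm :: "real \<Rightarrow> real"
  assumes s: "0 < s" "s < 1" and \<rho>: "0 < \<rho>" and t: "0 < t" "t \<le> D" and c: "0 \<le> c" "c \<le> 1"
    and \<beta>: "0 < \<beta>" and k: "0 < \<kappa>"
    and [measurable]: "wp \<in> borel_measurable borel" "wm \<in> borel_measurable borel"
    and w0: "\<And>r. 0 \<le> wp r" "\<And>r. wp r \<le> D" "\<And>r. 0 \<le> wm r" "\<And>r. wm r \<le> D"
    and wp: "\<And>r. 0 < r \<Longrightarrow> wp r \<le> max 0 (t + c * r + r\<^sup>2 / (2 * \<rho>))"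
    and wm: "\<And>r. 0 < r \<Longrightarrow> wm r \<le> max 0 (t - c * r + r\<^sup>2 / (2 * \<rho>))"
  shows "concave_slope \<beta> (t powr s) * (t powr (- s / 2) * (\<beta> * barrier_gain s \<rho> D * c powr (4 - 2 * s) - barrier_loss s \<rho> D)
      - barrier_rem \<beta> s t * \<kappa> powr (2 - 2 * s)) \<le>
    (LINT r|power_tail s \<kappa>. 2 * concave_profile \<beta> (t powr s) - concave_profile \<beta> (wp r powr s) - concave_profile \<beta> (wm r powr s))"
proof -
  interpret finite_measure "power_tail s \<kappa>" by (rule finite_measure_power_tail) (use s k in auto)
  have [measurable]: "concave_profile \<beta> \<in> borel_measurable borel" using \<beta> by measurable
  have D: "0 < D" using t by linarith
  define \<gamma> where "\<gamma> = barrier_exp s"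
  have \<gamma>: "0 < \<gamma>" "\<gamma> \<le> 1" "\<gamma> \<le> 2 - 2 * s" "\<gamma> \<le> s / 2"
    using s by (auto simp: \<gamma>_def barrier_exp_def min_def)
  define V where "V = (\<lambda>w. concave_profile \<beta> (w powr s))"
  define m0 where "m0 = min (\<rho> / D) 1"
  have m0: "0 < m0" "m0 \<le> 1" using \<rho> D by (auto simp: m0_def)
  \<comment> \<open>Range of the gain. For \<open>c = 0\<close> there is none and
    \<open>G = 0\<close>; the value 1 merely keeps \<open>m\<close> positive.\<close>
  define m where "m = (if c = 0 then 1 else m0 * t * c)"
  have m: "0 < m" using m0 t c by (auto simp: m_def)
  define B where "B = bend_const s \<rho> D * t powr (- \<gamma>)"
  have bc: "0 \<le> bend_const s \<rho> D" using \<rho> by (simp add: bend_const_def)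
  have B: "0 \<le> B" using bc by (simp add: B_def)
  define G where "G = \<beta> * s\<^sup>2 / 16 * t powr (3 * s / 2 - 2) * c\<^sup>2"
  have G: "0 \<le> G" using \<beta> by (simp add: G_def)
  define lin where "lin = (\<lambda>r. 2 * t powr s - (t + c * r) powr s - max 0 (t - c * r) powr s)"
  \<comment> \<open>The minorant to be integrated: affine second difference, bending loss up to 1,
    crude loss from 1 on, gain up to \<open>m\<close>. The overlap at \<open>r = 1\<close> only
    lowers it.\<close>
  define L where "L = (\<lambda>r. lin r - 2 * B * (indicator {..1} r * r powr (2 * s + \<gamma>))
    - 4 * D powr s * (indicator {1..} r * r powr 0) + G * (indicator {..m} r * r powr 2))"
  define \<sigma> where "\<sigma> = concave_slope \<beta> (t powr s)"
  have \<sigma>: "0 < \<sigma>" by (simp add: \<sigma>_def concave_slope_pos)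
  have le: "\<sigma> * L r \<le> 2 * V t - V (wp r) - V (wm r)" if r: "0 < r" for r
  proof -
    define a where "a = t powr s"
    have tang: "V w - V t \<le> \<sigma> * (w powr s - a)" if "0 \<le> w" for w
      unfolding V_def \<sigma>_def a_def using \<beta> by (intro concave_profile_tangent) auto
    have first: "L r - G * (indicator {..m} r * r powr 2) \<le> 2 * a - wp r powr s - wm r powr s"
    proof (cases "r \<le> 1")
      case True
      have bp: "wp r powr s \<le> (t + c * r) powr s + B * r powr (2 * s + \<gamma>)"
      proof -
        have "wp r powr s \<le> max 0 (t + c * r + r\<^sup>2 / (2 * \<rho>)) powr s"
          using wp[OF r] w0 s by (intro powr_mono2) auto
        also have "\<dots> \<le> max 0 (t + c * r) powr s + B * r powr (2 * s + \<gamma>)"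
          unfolding B_def using c by (intro bend_estimate s \<rho> t r \<gamma>) auto
        also have "max 0 (t + c * r) = t + c * r" using t c r by simp
        finally show ?thesis .
      qed
      have bm: "wm r powr s \<le> max 0 (t - c * r) powr s + B * r powr (2 * s + \<gamma>)"
      proof -
        have "wm r powr s \<le> max 0 (t + (- c) * r + r\<^sup>2 / (2 * \<rho>)) powr s"
          using wm[OF r] w0 s by (intro powr_mono2) auto
        also have "\<dots> \<le> max 0 (t + (- c) * r) powr s + B * r powr (2 * s + \<gamma>)"
          unfolding B_def using c by (intro bend_estimate s \<rho> t r \<gamma>) auto
        finally show ?thesis by simp
      qed
      have "0 \<le> 4 * D powr s * (indicator {1..} r * r powr 0)" by simp
      moreover have i: "indicator {..1} r = (1::real)" using True by simp
      ultimately show ?thesis using bp bm unfolding L_def lin_def a_def i by linarith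
    next
      case False
      \<comment> \<open>Beyond \<open>r = 1\<close> the expansion is useless and boundedness by
        \<open>D powr s\<close> takes over.\<close>
      have "t powr s \<le> D powr s" using t s by (intro powr_mono2) auto
      moreover have "wp r powr s \<le> D powr s" "wm r powr s \<le> D powr s"
        using w0 s by (auto intro!: powr_mono2)
      moreover have "0 \<le> (t + c * r) powr s" "0 \<le> max 0 (t - c * r) powr s" "0 \<le> t powr s" by auto
      moreover have "L r - G * (indicator {..m} r * r powr 2) = lin r - 4 * D powr s"
        using False r by (simp add: L_def)
      ultimately show ?thesis unfolding lin_def a_def by linarith
    qed
    show ?thesis
    proof (cases "c \<noteq> 0 \<and> r \<le> m")
      case True
      then have c0: "0 < c" and rm: "r \<le> min (\<rho> / D) 1 * t * c" using c by (auto simp: m_def m0_def)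
      have "V (wm r) - V t \<le> \<sigma> * ((wm r powr s - a) - G * r powr 2)"
        unfolding V_def \<sigma>_def a_def G_def
        by (rule concave_gain_estimate[OF s \<rho> t c0 c(2) r rm \<beta> w0(3) wm[OF r]])
      moreover have "V (wp r) - V t \<le> \<sigma> * (wp r powr s - a)" using tang w0 by simp
      moreover have "\<sigma> * L r \<le> \<sigma> * (2 * a - wp r powr s - wm r powr s + G * r powr 2)"
        using first True \<sigma> by (intro mult_left_mono) auto
      ultimately show ?thesis by (simp add: algebra_simps)
    next
      case False
      then have "G * (indicator {..m} r * r powr 2) = 0" by (auto simp: G_def)
      then have "\<sigma> * L r \<le> \<sigma> * (2 * a - wp r powr s - wm r powr s)"
        using first \<sigma> by (intro mult_left_mono) auto
      moreover have "V (wp r) - V t \<le> \<sigma> * (wp r powr s - a)" "V (wm r) - V t \<le> \<sigma> * (wm r powr s - a)"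
        using tang w0 by auto
      ultimately show ?thesis by (simp add: algebra_simps)
    qed
  qed
  note I0 = power_tail_second_difference_ge[OF s k t(1) c, folded lin_def]
  note I1 = power_tail_lower[of \<kappa> 1 s "2 * s + \<gamma>", OF k]
  note I2 = power_tail_upper[of \<kappa> 1 0 s, OF k]
  note I3 = power_tail_lower[of \<kappa> m s 2, OF k m]
  have i1: "integrable (power_tail s \<kappa>) (\<lambda>r. indicator {..1} r * r powr (2 * s + \<gamma>))" using I1(1) \<gamma> by simp
  have i2: "integrable (power_tail s \<kappa>) (\<lambda>r. indicator {1..} r * r powr 0)" using I2(1) s by (simp del: powr_zero_eq_one)
  have i3: "integrable (power_tail s \<kappa>) (\<lambda>r. indicator {..m} r * r powr 2)" using I3(1) s by simp
  have iL: "integrable (power_tail s \<kappa>) L"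
    unfolding L_def
    by (intro Bochner_Integration.integrable_add Bochner_Integration.integrable_diff integrable_mult_right i1 i2 i3 I0(1))
  have int: "(LINT r|power_tail s \<kappa>. L r) = (LINT r|power_tail s \<kappa>. lin r)
      - 2 * B * (LINT r|power_tail s \<kappa>. indicator {..1} r * r powr (2 * s + \<gamma>))
      - 4 * D powr s * (LINT r|power_tail s \<kappa>. indicator {1..} r * r powr 0)
      + G * (LINT r|power_tail s \<kappa>. indicator {..m} r * r powr 2)"
    unfolding L_def
    by (simp only: Bochner_Integration.integral_add Bochner_Integration.integral_diff
        Bochner_Integration.integral_mult_right_zero Bochner_Integration.integrable_add
        Bochner_Integration.integrable_diff integrable_mult_right i1 i2 i3 I0(1))
  have b1: "2 * B * (LINT r|power_tail s \<kappa>. indicator {..1} r * r powr (2 * s + \<gamma>)) \<le> 2 * B * (1 / \<gamma>)"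
    using I1(2) \<gamma> B by (intro mult_left_mono) auto
  have b2: "4 * D powr s * (LINT r|power_tail s \<kappa>. indicator {1..} r * r powr 0) \<le> 4 * D powr s * (1 / (2 * s))"
    using I2(2) s by (intro mult_left_mono) (auto simp del: powr_zero_eq_one)
  have b3: "G * ((m powr (2 - 2 * s) - \<kappa> powr (2 - 2 * s)) / (2 - 2 * s)) \<le>
      G * (LINT r|power_tail s \<kappa>. indicator {..m} r * r powr 2)"
    using I3(3) s G by (intro mult_left_mono) auto
  have e1: "2 * B * (1 / \<gamma>) + 4 * D powr s * (1 / (2 * s)) \<le> t powr (- s / 2) * barrier_loss s \<rho> D"
  proof -
    have "t powr (- \<gamma>) = t powr (- s / 2) * t powr (s / 2 - \<gamma>)" by (simp flip: powr_add)
    also have "\<dots> \<le> t powr (- s / 2) * D powr (s / 2 - \<gamma>)"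
      using t \<gamma> by (intro mult_left_mono powr_mono2) auto
    finally have "2 * bend_const s \<rho> D / \<gamma> * t powr (- \<gamma>) \<le> 2 * bend_const s \<rho> D / \<gamma> * (t powr (- s / 2) * D powr (s / 2 - \<gamma>))"
      using bc \<gamma> by (intro mult_left_mono) auto
    moreover have "1 \<le> t powr (- s / 2) * D powr (s / 2)"
    proof -
      have "1 = t powr (- s / 2) * t powr (s / 2)" using t by (simp flip: powr_add)
      also have "\<dots> \<le> t powr (- s / 2) * D powr (s / 2)" using t s by (intro mult_left_mono powr_mono2) auto
      finally show ?thesis .
    qed
    then have "2 * D powr s / s * 1 \<le> 2 * D powr s / s * (t powr (- s / 2) * D powr (s / 2))"
      using s by (intro mult_left_mono) auto
    ultimately show ?thesis by (simp add: barrier_loss_def B_def \<gamma>_def[symmetric] algebra_simps)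
  qed
  have e3: "t powr (- s / 2) * (\<beta> * barrier_gain s \<rho> D * c powr (4 - 2 * s))
      - \<beta> * s\<^sup>2 / 16 / (2 - 2 * s) * t powr (3 * s / 2 - 2) * \<kappa> powr (2 - 2 * s)
      \<le> G * ((m powr (2 - 2 * s) - \<kappa> powr (2 - 2 * s)) / (2 - 2 * s))"
  proof (cases "c = 0")
    case True
    then show ?thesis using s \<beta> by (simp add: G_def)
  next
    case False
    then have c0: "0 < c" using c by simp
    define q where "q = \<beta> * s\<^sup>2 / 16 / (2 - 2 * s)"
    have q: "0 \<le> q" using \<beta> s by (simp add: q_def)
    have mm: "m powr (2 - 2 * s) = m0 powr (2 - 2 * s) * t powr (2 - 2 * s) * c powr (2 - 2 * s)"
      using False by (simp add: m_def powr_mult)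
    \<comment> \<open>Here the gain acquires the same power of \<open>t\<close> as the loss, so that
      a large \<beta> decides between them independently of \<open>t\<close>.\<close>
    have tt: "t powr (3 * s / 2 - 2) * t powr (2 - 2 * s) = t powr (- s / 2)"
    proof -
      have "3 * s / 2 - 2 + (2 - 2 * s) = - s / 2" by simp
      then show ?thesis by (simp only: powr_add[symmetric])
    qed
    have c4: "c\<^sup>2 * c powr (2 - 2 * s) = c powr (4 - 2 * s)"
    proof -
      have "c\<^sup>2 = c powr 2" using c0 by (simp add: powr_numeral)
      then have "c\<^sup>2 * c powr (2 - 2 * s) = c powr (2 + (2 - 2 * s))" by (simp only: powr_add)
      then show ?thesis by simp
    qed
    have "t powr (3 * s / 2 - 2) * c\<^sup>2 * m powr (2 - 2 * s) =
        m0 powr (2 - 2 * s) * ((t powr (3 * s / 2 - 2) * t powr (2 - 2 * s)) * (c\<^sup>2 * c powr (2 - 2 * s)))"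
      unfolding mm by (simp only: mult_ac)
    then have A: "t powr (3 * s / 2 - 2) * c\<^sup>2 * m powr (2 - 2 * s) =
        m0 powr (2 - 2 * s) * (t powr (- s / 2) * c powr (4 - 2 * s))"
      unfolding tt c4 .
    have "c\<^sup>2 \<le> 1" using c by (intro power_le_one)
    then have "q * t powr (3 * s / 2 - 2) * \<kappa> powr (2 - 2 * s) * c\<^sup>2 \<le> q * t powr (3 * s / 2 - 2) * \<kappa> powr (2 - 2 * s) * 1"
      using q by (intro mult_left_mono) auto
    moreover have "G * ((m powr (2 - 2 * s) - \<kappa> powr (2 - 2 * s)) / (2 - 2 * s)) =
        q * (t powr (3 * s / 2 - 2) * c\<^sup>2 * m powr (2 - 2 * s)) - q * t powr (3 * s / 2 - 2) * \<kappa> powr (2 - 2 * s) * c\<^sup>2"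
      by (simp add: G_def q_def right_diff_distrib diff_divide_distrib mult_ac)
    moreover have "t powr (- s / 2) * (\<beta> * barrier_gain s \<rho> D * c powr (4 - 2 * s)) =
        q * (m0 powr (2 - 2 * s) * (t powr (- s / 2) * c powr (4 - 2 * s)))"
      by (simp add: barrier_gain_def q_def m0_def)
    ultimately show ?thesis unfolding A q_def[symmetric] by linarith
  qed
  have "t powr (- s / 2) * (\<beta> * barrier_gain s \<rho> D * c powr (4 - 2 * s) - barrier_loss s \<rho> D)
      - barrier_rem \<beta> s t * \<kappa> powr (2 - 2 * s) \<le> (LINT r|power_tail s \<kappa>. L r)"
  proof -
    have "barrier_rem \<beta> s t * \<kappa> powr (2 - 2 * s) = (8 + 4 / s) * t powr (s - 2) * \<kappa> powr (2 - 2 * s)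
        + \<beta> * s\<^sup>2 / 16 / (2 - 2 * s) * t powr (3 * s / 2 - 2) * \<kappa> powr (2 - 2 * s)"
      unfolding barrier_rem_def by (rule distrib_right)
    moreover have "- (8 + 4 / s) * t powr (s - 2) * \<kappa> powr (2 - 2 * s) =
        - ((8 + 4 / s) * t powr (s - 2) * \<kappa> powr (2 - 2 * s))" by (simp only: mult_minus_left)
    ultimately show ?thesis
      unfolding int right_diff_distrib using I0(2) b1 b2 b3 e1 e3 by linarith
  qed
  then have "\<sigma> * (t powr (- s / 2) * (\<beta> * barrier_gain s \<rho> D * c powr (4 - 2 * s) - barrier_loss s \<rho> D)
      - barrier_rem \<beta> s t * \<kappa> powr (2 - 2 * s)) \<le> \<sigma> * (LINT r|power_tail s \<kappa>. L r)"
    using \<sigma> by (intro mult_left_mono) auto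
  also have "\<dots> = (LINT r|power_tail s \<kappa>. \<sigma> * L r)" by simp
  also have "\<dots> \<le> (LINT r|power_tail s \<kappa>. 2 * V t - V (wp r) - V (wm r))"
  proof (rule integral_mono_AE)
    show "integrable (power_tail s \<kappa>) (\<lambda>r. \<sigma> * L r)" using iL by simp
    have Vb: "\<bar>V (wp r)\<bar> \<le> D powr s" "\<bar>V (wm r)\<bar> \<le> D powr s" for r
      unfolding V_def using concave_profile_powr_bounds(3)[OF \<beta> s(1)] w0 by auto
    have "integrable (power_tail s \<kappa>) (\<lambda>r. V (wp r))" "integrable (power_tail s \<kappa>) (\<lambda>r. V (wm r))"
      using Vb unfolding V_def by (auto intro!: integrable_const_bound[where B = "D powr s"])
    then show "integrable (power_tail s \<kappa>) (\<lambda>r. 2 * V t - V (wp r) - V (wm r))"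
      by (intro Bochner_Integration.integrable_diff) auto
    show "AE r in power_tail s \<kappa>. \<sigma> * L r \<le> 2 * V t - V (wp r) - V (wm r)"
      using AE_power_tail by eventually_elim (use le k in auto)
  qed
  finally show ?thesis by (simp add: V_def \<sigma>_def)
qed

text \<open>Reversing the line exchanges \<open>wp\<close> and \<open>wm\<close> and the sign of
  \<open>c\<close>.\<close>

lemma line_estimate:
  fixes s \<rho> D t c \<beta> \<kappa> :: real and wp wm :: "real \<Rightarrow> real"
  assumes s: "0 < s" "s < 1" and \<rho>: "0 < \<rho>" and t: "0 < t" "t \<le> D" and c: "\<bar>c\<bar> \<le> 1"
    and \<beta>: "0 < \<beta>" and k: "0 < \<kappa>"
    and m: "wp \<in> borel_measurable borel" "wm \<in> borel_measurable borel"
    and w0: "\<And>r. 0 \<le> wp r" "\<And>r. wp r \<le> D" "\<And>r. 0 \<le> wm r" "\<And>r. wm r \<le> D"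
    and wp: "\<And>r. 0 < r \<Longrightarrow> wp r \<le> max 0 (t + c * r + r\<^sup>2 / (2 * \<rho>))"
    and wm: "\<And>r. 0 < r \<Longrightarrow> wm r \<le> max 0 (t - c * r + r\<^sup>2 / (2 * \<rho>))"
  shows "concave_slope \<beta> (t powr s) * (t powr (- s / 2) * (\<beta> * barrier_gain s \<rho> D * \<bar>c\<bar> powr (4 - 2 * s) - barrier_loss s \<rho> D)
      - barrier_rem \<beta> s t * \<kappa> powr (2 - 2 * s)) \<le>
    (LINT r|power_tail s \<kappa>. 2 * concave_profile \<beta> (t powr s) - concave_profile \<beta> (wp r powr s) - concave_profile \<beta> (wm r powr s))"
proof (cases "0 \<le> c")
  case True
  then show ?thesis
    using line_estimate_nonneg[OF s \<rho> t _ _ \<beta> k m w0 wp wm] c by simp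
next
  case False
  have "concave_slope \<beta> (t powr s) * (t powr (- s / 2) * (\<beta> * barrier_gain s \<rho> D * (- c) powr (4 - 2 * s) - barrier_loss s \<rho> D)
      - barrier_rem \<beta> s t * \<kappa> powr (2 - 2 * s)) \<le>
    (LINT r|power_tail s \<kappa>. 2 * concave_profile \<beta> (t powr s) - concave_profile \<beta> (wm r powr s) - concave_profile \<beta> (wp r powr s))"
    using False c wp wm by (intro line_estimate_nonneg[OF s \<rho> t _ _ \<beta> k m(2,1) w0(3,4,1,2)]) auto
  also have "\<dots> = (LINT r|power_tail s \<kappa>. 2 * concave_profile \<beta> (t powr s) - concave_profile \<beta> (wp r powr s) - concave_profile \<beta> (wm r powr s))"
    by (intro Bochner_Integration.integral_cong) auto
  finally show ?thesis using False by simp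
qed

subsection \<open>The barrier in the domain\<close>

lemma powr_diff_le_powr:
  fixes a b s :: real
  assumes s: "0 < s" "s < 1" and "0 \<le> a" "0 \<le> b"
  shows "\<bar>a powr s - b powr s\<bar> \<le> \<bar>a - b\<bar> powr s"
proof -
  have *: "x powr s - y powr s \<le> (x - y) powr s" "y powr s \<le> x powr s" if "0 \<le> y" "y \<le> x" for x y :: real
    using powr_add_subadditive[OF s, of "x - y" y] powr_mono2[of s y x] that s by auto
  show ?thesis
  proof (cases "b \<le> a")
    case True
    then show ?thesis using *[of b a] assms by simp
  next
    case False
    then show ?thesis using *[of a b] assms by simp
  qed
qed

text \<open>Only one of the two points has to stay away from \<open>0\<close>: for
  \<open>y \<le> x\<close> the ratio satisfies \<open>y / x \<le> (y / x) powr s\<close>, even if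
  \<open>y = 0\<close>.\<close>

lemma powr_diff_le_linear:
  fixes a b s \<delta> :: real
  assumes s: "0 < s" "s < 1" and d: "0 < \<delta>" "\<delta> \<le> a" and "0 \<le> b"
  shows "\<bar>a powr s - b powr s\<bar> \<le> \<delta> powr (s - 1) * \<bar>a - b\<bar>"
proof -
  have *: "x powr s - y powr s \<le> \<delta> powr (s - 1) * (x - y)" "y powr s \<le> x powr s"
    if "0 \<le> y" "y \<le> x" "\<delta> \<le> x" for x y :: real
  proof -
    have x: "0 < x" using that d by linarith
    have "y / x \<le> (y / x) powr s" using that x by (intro one_minus_powr_bounds s) auto
    then have "x powr s * (1 - (y / x) powr s) \<le> x powr s * (1 - y / x)"
      by (intro mult_left_mono) auto
    moreover have "x powr s * (y / x) powr s = y powr s"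
      using x by (simp add: powr_divide)
    moreover have "x powr s * (1 - y / x) = x powr (s - 1) * (x - y)"
    proof -
      have "x powr s = x powr (s - 1) * x" using x powr_add[of x "s - 1" 1] by simp
      then have "x powr s * (1 - y / x) = x powr (s - 1) * (x * (1 - y / x))" by (simp only: mult.assoc)
      also have "x * (1 - y / x) = x - y" using x by (simp add: right_diff_distrib)
      finally show ?thesis .
    qed
    moreover have "x powr (s - 1) * (x - y) \<le> \<delta> powr (s - 1) * (x - y)"
      using that d s by (intro mult_right_mono powr_mono2') auto
    ultimately show "x powr s - y powr s \<le> \<delta> powr (s - 1) * (x - y)" by (simp add: right_diff_distrib)
    show "y powr s \<le> x powr s" using that s by (intro powr_mono2) auto
  qed
  show ?thesis
  proof (cases "b \<le> a")
    case True
    then show ?thesis using *[of b a] assms by simp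
  next
    case False
    then show ?thesis using *[of a b] assms by simp
  qed
qed

section \<open>Convex truncation at a small height\<close>

definition trunc_slope :: "real \<Rightarrow> real \<Rightarrow> real" where
  "trunc_slope \<sigma> v = max 0 (min 1 ((v - 2 * \<sigma>) / \<sigma>))"

text \<open>A smoothed version of \<open>v \<mapsto> max 0 (v - 2 \<sigma>)\<close>, written as the supremum over slopes
  \<open>y \<in> {0..1}\<close> of the affine functions \<open>y (v - 2 \<sigma>) - \<sigma> y\<^sup>2 / 2\<close>, attained at \<open>trunc_slope \<sigma> v\<close>.\<close>
definition smooth_trunc :: "real \<Rightarrow> real \<Rightarrow> real" where
  "smooth_trunc \<sigma> v = trunc_slope \<sigma> v * (v - 2 * \<sigma>) - \<sigma> * (trunc_slope \<sigma> v)\<^sup>2 / 2"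

lemma trunc_slope_bounds: "0 \<le> trunc_slope \<sigma> v" "trunc_slope \<sigma> v \<le> 1"
  by (auto simp: trunc_slope_def)

text \<open>The three cases are the position of the maximiser of a concave quadratic in
  \<open>y\<close>: the left end, the interior, or the right end of \<open>{0..1}\<close>.\<close>

lemma smooth_trunc_ge:
  assumes "0 < \<sigma>" "0 \<le> y" "y \<le> 1"
  shows "y * (v - 2 * \<sigma>) - \<sigma> * y\<^sup>2 / 2 \<le> smooth_trunc \<sigma> v"
proof -
  define p where "p = v - 2 * \<sigma>"
  consider "p \<le> 0" | "0 < p" "p < \<sigma>" | "\<sigma> \<le> p" by linarith
  then have "y * p - \<sigma> * y\<^sup>2 / 2 \<le> trunc_slope \<sigma> v * p - \<sigma> * (trunc_slope \<sigma> v)\<^sup>2 / 2"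
  proof cases
    case 1
    then have "p / \<sigma> \<le> 0" using assms by (simp add: divide_nonpos_pos)
    then have "trunc_slope \<sigma> v = 0" by (simp add: trunc_slope_def p_def[symmetric])
    moreover have "y * p \<le> 0" using 1 assms by (simp add: mult_nonneg_nonpos)
    moreover have "0 \<le> \<sigma> * y\<^sup>2 / 2" using assms by simp
    ultimately show ?thesis by simp
  next
    case 2
    then have t: "trunc_slope \<sigma> v = p / \<sigma>" using assms by (simp add: trunc_slope_def p_def[symmetric])
    have "2 * (y * \<sigma>) * p \<le> (y * \<sigma>)\<^sup>2 + p\<^sup>2" by (rule sum_squares_bound)
    then have "(2 * (y * \<sigma>) * p - (y * \<sigma>)\<^sup>2) / (2 * \<sigma>) \<le> p\<^sup>2 / (2 * \<sigma>)"
      using assms by (intro divide_right_mono) auto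
    moreover have "(2 * (y * \<sigma>) * p - (y * \<sigma>)\<^sup>2) / (2 * \<sigma>) = y * p - \<sigma> * y\<^sup>2 / 2"
      using assms by (simp add: diff_divide_distrib power2_eq_square)
    moreover have "p\<^sup>2 / (2 * \<sigma>) = p / \<sigma> * p - \<sigma> * (p / \<sigma>)\<^sup>2 / 2"
      using assms by (simp add: power2_eq_square)
    ultimately show ?thesis unfolding t by linarith
  next
    case 3
    then have "1 \<le> p / \<sigma>" using assms by simp
    then have t: "trunc_slope \<sigma> v = 1" by (simp add: trunc_slope_def p_def[symmetric])
    have "0 \<le> (1 - y) * (p - \<sigma> * (1 + y) / 2)"
    proof (rule mult_nonneg_nonneg)
      have "\<sigma> * (1 + y) \<le> \<sigma> * 2" using assms by (intro mult_left_mono) auto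
      then show "0 \<le> p - \<sigma> * (1 + y) / 2" using 3 by linarith
    qed (use assms in simp)
    also have "\<dots> = p - \<sigma> / 2 - (y * p - \<sigma> * y\<^sup>2 / 2)" by (simp add: field_simps power2_eq_square)
    finally show ?thesis unfolding t by simp
  qed
  then show ?thesis by (simp add: smooth_trunc_def p_def)
qed

lemma trunc_slope_lipschitz:
  assumes "0 < \<sigma>" shows "\<bar>trunc_slope \<sigma> a - trunc_slope \<sigma> b\<bar> \<le> \<bar>a - b\<bar> / \<sigma>"
proof -
  have "\<bar>trunc_slope \<sigma> a - trunc_slope \<sigma> b\<bar> \<le> \<bar>(a - 2 * \<sigma>) / \<sigma> - (b - 2 * \<sigma>) / \<sigma>\<bar>"
    unfolding trunc_slope_def by linarith
  also have "\<dots> = \<bar>a - b\<bar> / \<sigma>" using assms by (simp flip: diff_divide_distrib)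
  finally show ?thesis .
qed

text \<open>The Bregman remainder of the convex function \<open>smooth_trunc \<sigma>\<close>. It
  measures the failure of the linear chain rule when the truncation is composed with the barrier,
  and must be bounded from above.\<close>

definition trunc_bracket :: "real \<Rightarrow> real \<Rightarrow> real \<Rightarrow> real" where
  "trunc_bracket \<sigma> a b = smooth_trunc \<sigma> b - smooth_trunc \<sigma> a - trunc_slope \<sigma> a * (b - a)"

text \<open>Using the optimal slope for \<open>b\<close> as a competitor at \<open>a\<close> bounds
  the remainder by the difference of the slopes times \<open>b - a\<close>. The slope function is
  Lipschitz with constant \<open>1 / \<sigma>\<close> and varies by at most 1.\<close>

lemma trunc_bracket_le:
  assumes "0 < \<sigma>"
  shows "trunc_bracket \<sigma> a b \<le> (b - a)\<^sup>2 / \<sigma>" "trunc_bracket \<sigma> a b \<le> \<bar>b - a\<bar>"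
proof -
  let ?y = "trunc_slope \<sigma>"
  have "trunc_bracket \<sigma> a b \<le> (?y b - ?y a) * (b - a)"
    using smooth_trunc_ge[OF assms trunc_slope_bounds(1)[of \<sigma> b] trunc_slope_bounds(2)[of \<sigma> b], of a] unfolding trunc_bracket_def smooth_trunc_def[of \<sigma> b]
    by (simp add: algebra_simps)
  also have "\<dots> \<le> \<bar>?y b - ?y a\<bar> * \<bar>b - a\<bar>" by (metis abs_ge_self abs_mult)
  finally have *: "trunc_bracket \<sigma> a b \<le> \<bar>?y b - ?y a\<bar> * \<bar>b - a\<bar>" .
  also have "\<dots> \<le> \<bar>b - a\<bar> / \<sigma> * \<bar>b - a\<bar>"
    by (intro mult_right_mono trunc_slope_lipschitz assms) auto
  finally show "trunc_bracket \<sigma> a b \<le> (b - a)\<^sup>2 / \<sigma>" by (simp add: power2_eq_square)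
  have "\<bar>?y b - ?y a\<bar> \<le> 1" using trunc_slope_bounds[of \<sigma> a] trunc_slope_bounds[of \<sigma> b] by linarith
  then have "\<bar>?y b - ?y a\<bar> * \<bar>b - a\<bar> \<le> 1 * \<bar>b - a\<bar>" by (intro mult_right_mono) auto
  with * show "trunc_bracket \<sigma> a b \<le> \<bar>b - a\<bar>" by simp
qed

lemma smooth_trunc_small:
  assumes "0 < \<sigma>" "v \<le> 2 * \<sigma>" shows "trunc_slope \<sigma> v = 0" "smooth_trunc \<sigma> v = 0"
proof -
  have "(v - 2 * \<sigma>) / \<sigma> \<le> 0" using assms by (simp add: divide_nonpos_pos)
  then show "trunc_slope \<sigma> v = 0" by (simp add: trunc_slope_def)
  then show "smooth_trunc \<sigma> v = 0" by (simp add: smooth_trunc_def)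
qed

lemma smooth_trunc_large:
  assumes "0 < \<sigma>" "3 * \<sigma> \<le> v" shows "trunc_slope \<sigma> v = 1" "smooth_trunc \<sigma> v = v - 5 / 2 * \<sigma>"
proof -
  have "1 \<le> (v - 2 * \<sigma>) / \<sigma>" using assms by simp
  then show "trunc_slope \<sigma> v = 1" by (simp add: trunc_slope_def)
  then show "smooth_trunc \<sigma> v = v - 5 / 2 * \<sigma>" by (simp add: smooth_trunc_def)
qed

lemma smooth_trunc_bounds:
  assumes "0 < \<sigma>" shows "0 \<le> smooth_trunc \<sigma> v" "0 \<le> v \<Longrightarrow> smooth_trunc \<sigma> v \<le> v"
proof -
  show "0 \<le> smooth_trunc \<sigma> v" using smooth_trunc_ge[OF assms, of 0 v] by simp
  show "smooth_trunc \<sigma> v \<le> v" if v: "0 \<le> v"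
  proof (cases "v \<le> 2 * \<sigma>")
    case True
    then show ?thesis using smooth_trunc_small[OF assms] v by simp
  next
    case False
    have "trunc_slope \<sigma> v * (v - 2 * \<sigma>) \<le> 1 * (v - 2 * \<sigma>)"
      using False trunc_slope_bounds by (intro mult_right_mono) auto
    moreover have "0 \<le> \<sigma> * (trunc_slope \<sigma> v)\<^sup>2 / 2" using assms by simp
    ultimately have "smooth_trunc \<sigma> v \<le> 1 * (v - 2 * \<sigma>) - 0"
      unfolding smooth_trunc_def by (rule diff_mono)
    also have "\<dots> \<le> v" using assms by simp
    finally show ?thesis .
  qed
qed

text \<open>Above \<open>3 * \<sigma>\<close> the truncation is the affine function
  \<open>v - 5 / 2 * \<sigma>\<close>, so the remainder vanishes if both points are there; otherwise
  it is at most the offset, since the truncation never exceeds its argument.\<close>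

lemma trunc_bracket_large:
  assumes "0 < \<sigma>" "3 * \<sigma> \<le> a" "0 \<le> b"
  shows "trunc_bracket \<sigma> a b \<le> 5 / 2 * \<sigma>" "3 * \<sigma> \<le> b \<Longrightarrow> trunc_bracket \<sigma> a b = 0"
  using smooth_trunc_large[OF assms(1,2)] smooth_trunc_large[OF assms(1), of b] smooth_trunc_bounds[OF assms(1), of b] assms
  by (auto simp: trunc_bracket_def)

lemma borel_measurable_smooth_trunc [measurable]: "smooth_trunc \<sigma> \<in> borel_measurable borel"
  unfolding smooth_trunc_def trunc_slope_def by measurable

context stable_kernel
begin

text \<open>Nondegeneracy is given for the power \<open>2 * s\<close>, but the gain carries
  \<open>4 - 2 * s\<close>. Directions with cosine at most \<tau> contribute at most
  \<open>C / 2\<close> to the lower power; on the others the two powers are comparable.\<close>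

lemma nondegenerate_power:
  assumes C: "0 < C" "\<forall>\<omega>\<in>sphere 0 1. C \<le> (LINT \<theta>|\<mu>. \<bar>\<omega> \<bullet> \<theta>\<bar> powr (2 * s))" and p: "2 * s \<le> p"
  obtains c where "0 < c" "\<And>e. norm e = 1 \<Longrightarrow> c \<le> (LINT \<theta>|\<mu>. \<bar>e \<bullet> \<theta>\<bar> powr p)"
proof -
  define m where "m = measure \<mu> (space \<mu>)"
  have m: "0 \<le> m" by (simp add: m_def)
  \<comment> \<open>Chosen so that \<open>\<tau> powr (2 * s) * m \<le> C / 2\<close>;
    \<open>m + 1\<close> avoids a separate case \<open>m = 0\<close>.\<close>
  define \<tau> where "\<tau> = (C / (2 * (m + 1))) powr (1 / (2 * s))"
  have \<tau>: "0 < \<tau>" using C m by (simp add: \<tau>_def)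
  have e: "\<tau> powr (2 * s) = C / (2 * (m + 1))" using s C m by (simp add: \<tau>_def powr_powr)
  have "\<tau> powr (2 * s) * (m + 1) = C / 2"
    unfolding e using m by (simp add: divide_simps)
  moreover have "\<tau> powr (2 * s) * m \<le> \<tau> powr (2 * s) * (m + 1)"
    by (intro mult_left_mono) auto
  ultimately have \<tau>m: "\<tau> powr (2 * s) * m \<le> C / 2" by linarith
  have "C / 2 * \<tau> powr (p - 2 * s) \<le> (LINT \<theta>|\<mu>. \<bar>e \<bullet> \<theta>\<bar> powr p)" if e: "norm e = 1" for e
  proof -
    have unit: "\<bar>e \<bullet> \<theta>\<bar> \<le> 1" if "\<theta> \<in> space \<mu>" for \<theta>
      using Cauchy_Schwarz_ineq2[of e \<theta>] e norm_mu[OF that] by simp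
    have i: "integrable \<mu> (\<lambda>\<theta>. \<bar>e \<bullet> \<theta>\<bar> powr q)" if "0 \<le> q" for q
    proof (rule sphere_average_bound(1))
      show "\<bar>\<bar>e \<bullet> \<theta>\<bar> powr q\<bar> \<le> 1" if "\<theta> \<in> space \<mu>" for \<theta>
        using unit[OF that] \<open>0 \<le> q\<close> by (simp add: powr_le1)
    qed measurable
    have pw: "x powr (2 * s) \<le> \<tau> powr (2 * s) + \<tau> powr (2 * s - p) * x powr p" if "0 \<le> x" for x
    proof (cases "x \<le> \<tau>")
      case True
      then have "x powr (2 * s) \<le> \<tau> powr (2 * s)" using that s by (intro powr_mono2) auto
      then show ?thesis by (simp add: add_increasing2)
    next
      case False
      have "x powr (2 * s) = x powr (2 * s - p) * x powr p" by (simp flip: powr_add)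
      also have "\<dots> \<le> \<tau> powr (2 * s - p) * x powr p"
        using False \<tau> p by (intro mult_right_mono powr_mono2') auto
      finally show ?thesis by (simp add: add_increasing)
    qed
    have "C \<le> (LINT \<theta>|\<mu>. \<bar>e \<bullet> \<theta>\<bar> powr (2 * s))" using C e by simp
    also have "\<dots> \<le> (LINT \<theta>|\<mu>. \<tau> powr (2 * s) + \<tau> powr (2 * s - p) * \<bar>e \<bullet> \<theta>\<bar> powr p)"
      using s p pw by (intro integral_mono i Bochner_Integration.integrable_add integrable_mult_right) auto
    also have "\<dots> = \<tau> powr (2 * s) * m + \<tau> powr (2 * s - p) * (LINT \<theta>|\<mu>. \<bar>e \<bullet> \<theta>\<bar> powr p)"
      using i[of p] s p by (simp add: m_def mult.commute)
    finally have "C / 2 \<le> \<tau> powr (2 * s - p) * (LINT \<theta>|\<mu>. \<bar>e \<bullet> \<theta>\<bar> powr p)" using \<tau>m by linarith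
    then have "C / 2 * \<tau> powr (p - 2 * s) \<le>
        \<tau> powr (2 * s - p) * (LINT \<theta>|\<mu>. \<bar>e \<bullet> \<theta>\<bar> powr p) * \<tau> powr (p - 2 * s)"
      by (intro mult_right_mono) auto
    also have "\<dots> = (\<tau> powr (2 * s - p) * \<tau> powr (p - 2 * s)) * (LINT \<theta>|\<mu>. \<bar>e \<bullet> \<theta>\<bar> powr p)"
      by (simp only: mult_ac)
    also have "\<tau> powr (2 * s - p) * \<tau> powr (p - 2 * s) = 1" using \<tau> by (simp flip: powr_add)
    finally show ?thesis by simp
  qed
  moreover have "0 < C / 2 * \<tau> powr (p - 2 * s)" using C \<tau> by simp
  ultimately show ?thesis using that by blast
qed

end

text \<open>The geometry of the boundary enters the barrier only through \<open>expansion\<close>;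
  \<open>D\<close> bounds the distance, which keeps the slope of the profile away from
  \<open>0\<close>.\<close>

locale distance_barrier = stable_kernel s \<mu> for s and \<mu> :: "'a::euclidean_space measure" +
  fixes \<Omega> :: "'a set" and \<rho> D C :: real
  assumes open_dom: "open \<Omega>" and \<rho>: "0 < \<rho>" and D: "0 < D" and C: "0 < C"
    and expansion: "\<And>x. x \<in> \<Omega> \<Longrightarrow> \<exists>e. norm e = 1 \<and>
      (\<forall>h. infdist (x + h) (- \<Omega>) \<le> max 0 (infdist x (- \<Omega>) + e \<bullet> h + (norm h)\<^sup>2 / (2 * \<rho>)))"
    and infdist_le_D: "\<And>x. infdist x (- \<Omega>) \<le> D"
    and infdist_pos: "\<And>x. x \<in> \<Omega> \<Longrightarrow> 0 < infdist x (- \<Omega>)"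
    and nondeg: "\<forall>\<omega>\<in>sphere 0 1. C \<le> (LINT \<theta>|\<mu>. \<bar>\<omega> \<bullet> \<theta>\<bar> powr (2 * s))"
begin

abbreviation d :: "'a \<Rightarrow> real" where "d x \<equiv> infdist x (- \<Omega>)"

abbreviation m :: real where "m \<equiv> measure \<mu> (space \<mu>)"

lemma measurable_d [measurable]: "(\<lambda>x. d x) \<in> borel_measurable borel"
  by (intro borel_measurable_continuous_onI continuous_on_infdist continuous_on_id)

definition V :: "real \<Rightarrow> 'a \<Rightarrow> real" where
  "V \<beta> x = concave_profile \<beta> (d x powr s)"

lemma measurable_V [measurable]: "0 < \<beta> \<Longrightarrow> V \<beta> \<in> borel_measurable borel"
  unfolding V_def by measurable

lemma V_bounds:
  assumes "0 < \<beta>" shows "0 \<le> V \<beta> x" "V \<beta> x \<le> d x powr s" "\<bar>V \<beta> x\<bar> \<le> D powr s"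
  unfolding V_def using concave_profile_powr_bounds[OF assms s(1) infdist_nonneg infdist_le_D] by auto

text \<open>Averaging the line estimate over \<mu> replaces the cosine power by its lower bound
  \<open>c4\<close>. The truncation constant \<open>M\<close> depends on \<delta> but neither on
  \<open>x\<close> nor on \<kappa>.\<close>

lemma V_supersolution:
  obtains \<beta> c where "0 < \<beta>" "0 < c"
    "\<And>\<delta>. 0 < \<delta> \<Longrightarrow> \<exists>M\<ge>0. \<forall>\<kappa>>0. \<forall>x\<in>\<Omega>. \<delta> \<le> d x \<longrightarrow> c - M * \<kappa> powr (2 - 2 * s) \<le> A_trunc \<kappa> (V \<beta>) x"
proof -
  define p where "p = 4 - 2 * s"
  have "2 * s \<le> p" using s by (simp add: p_def)
  then obtain c4 where c4: "0 < c4" "\<And>e. norm e = 1 \<Longrightarrow> c4 \<le> (LINT \<theta>|\<mu>. \<bar>e \<bullet> \<theta>\<bar> powr p)"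
    using nondegenerate_power[OF C nondeg] by metis
  define g where "g = barrier_gain s \<rho> D"
  define l where "l = barrier_loss s \<rho> D"
  have g: "0 < g" unfolding g_def barrier_gain_def using s \<rho> D
    by (intro divide_pos_pos mult_pos_pos) (auto simp: min_def)
  have "0 \<le> bend_const s \<rho> D" using \<rho> by (simp add: bend_const_def)
  then have l: "0 \<le> l" using s barrier_exp_pos[OF s] by (simp add: l_def barrier_loss_def)
  \<comment> \<open>Chosen so that the averaged gain \<open>\<beta> * g * c4\<close> beats the
    averaged loss \<open>l * m\<close> by exactly 1.\<close>
  define \<beta> where "\<beta> = (l * m + 1) / (g * c4)"
  have lm: "0 < l * m + 1" using l by (simp add: add_nonneg_pos)
  have \<beta>: "0 < \<beta>" using lm g c4 by (simp add: \<beta>_def)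
  have \<beta>g: "\<beta> * g * c4 = l * m + 1" using g c4 by (simp add: \<beta>_def)
  define c where "c = concave_slope \<beta> (D powr s) * D powr (- s / 2)"
  have c: "0 < c" using D concave_slope_pos by (simp add: c_def)
  have main: "c - barrier_rem \<beta> s \<delta> * m * \<kappa> powr (2 - 2 * s) \<le> A_trunc \<kappa> (V \<beta>) x"
    if d: "0 < \<delta>" and k: "0 < \<kappa>" and x: "x \<in> \<Omega>" "\<delta> \<le> d x" for \<delta> \<kappa> x
  proof -
    interpret Q: finite_measure "power_tail s \<kappa>" using k s by (intro finite_measure_power_tail) auto
    interpret pair_sigma_finite "power_tail s \<kappa>" \<mu> ..
    define t where "t = d x"
    have t: "0 < t" "t \<le> D" using infdist_pos[OF x(1)] infdist_le_D by (auto simp: t_def)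
    obtain e where e: "norm e = 1" "\<And>h. d (x + h) \<le> max 0 (t + e \<bullet> h + (norm h)\<^sup>2 / (2 * \<rho>))"
      using expansion[OF x(1)] unfolding t_def by metis
    define \<sigma> where "\<sigma> = concave_slope \<beta> (t powr s)"
    define r where "r = barrier_rem \<beta> s t * \<kappa> powr (2 - 2 * s)"
    have Vm [measurable]: "V \<beta> \<in> borel_measurable borel" using \<beta> by measurable
    define J where "J = (\<lambda>\<theta>. LINT r|power_tail s \<kappa>. 2 * V \<beta> x - V \<beta> (x + r *\<^sub>R \<theta>) - V \<beta> (x - r *\<^sub>R \<theta>))"
    define R where "R = (\<lambda>\<theta>. \<sigma> * (t powr (- s / 2) * (\<beta> * g * \<bar>e \<bullet> \<theta>\<bar> powr p - l) - r))"
    have iK: "integrable (power_tail s \<kappa> \<Otimes>\<^sub>M \<mu>) (\<lambda>(r, \<theta>). 2 * V \<beta> x - V \<beta> (x + r *\<^sub>R \<theta>) - V \<beta> (x - r *\<^sub>R \<theta>))"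
      using integrable_jump_diff(3)[OF finite_K[OF k] measurable_jump Vm V_bounds(3)[OF \<beta>], of x]
      by (simp add: K_def jump_def case_prod_beta')
    have RJ: "R \<theta> \<le> J \<theta>" if \<theta>: "\<theta> \<in> space \<mu>" for \<theta>
    proof -
      have n: "norm \<theta> = 1" using \<theta> by (rule norm_mu)
      have "\<bar>e \<bullet> \<theta>\<bar> \<le> 1" using Cauchy_Schwarz_ineq2[of e \<theta>] e n by simp
      moreover have "d (x + r *\<^sub>R \<theta>) \<le> max 0 (t + (e \<bullet> \<theta>) * r + r\<^sup>2 / (2 * \<rho>))"
        "d (x - r *\<^sub>R \<theta>) \<le> max 0 (t - (e \<bullet> \<theta>) * r + r\<^sup>2 / (2 * \<rho>))" for r
        using e(2)[of "r *\<^sub>R \<theta>"] e(2)[of "- (r *\<^sub>R \<theta>)"] n by (simp_all add: mult.commute)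
      ultimately show ?thesis
        unfolding R_def J_def V_def \<sigma>_def g_def l_def r_def p_def t_def[symmetric]
        by (intro line_estimate s \<rho> t \<beta> k) (auto simp: infdist_le_D infdist_nonneg)
    qed
    have ip: "integrable \<mu> (\<lambda>\<theta>. \<bar>e \<bullet> \<theta>\<bar> powr p)"
    proof (rule sphere_average_bound(1))
      show "\<bar>\<bar>e \<bullet> \<theta>\<bar> powr p\<bar> \<le> 1" if "\<theta> \<in> space \<mu>" for \<theta>
        using Cauchy_Schwarz_ineq2[of e \<theta>] e norm_mu[OF that] s by (simp add: powr_le1 p_def)
    qed measurable
    have iR: "integrable \<mu> R"
      unfolding R_def using ip
      by (intro integrable_mult_right Bochner_Integration.integrable_diff mu.integrable_const)
    have "(LINT \<theta>|\<mu>. R \<theta>) = \<sigma> * (t powr (- s / 2) * (\<beta> * g * (LINT \<theta>|\<mu>. \<bar>e \<bullet> \<theta>\<bar> powr p) - l * m) - r * m)"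
      unfolding R_def using ip by (simp add: right_diff_distrib mult.commute[of m] mult.assoc)
    also have "\<dots> \<ge> \<sigma> * (t powr (- s / 2) * 1 - r * m)"
    proof -
      have "\<beta> * g * c4 \<le> \<beta> * g * (LINT \<theta>|\<mu>. \<bar>e \<bullet> \<theta>\<bar> powr p)"
        using c4(2)[OF e(1)] \<beta> g by (intro mult_left_mono) auto
      then have "1 \<le> \<beta> * g * (LINT \<theta>|\<mu>. \<bar>e \<bullet> \<theta>\<bar> powr p) - l * m" using \<beta>g by linarith
      then have "t powr (- s / 2) * 1 \<le> t powr (- s / 2) * (\<beta> * g * (LINT \<theta>|\<mu>. \<bar>e \<bullet> \<theta>\<bar> powr p) - l * m)"
        by (intro mult_left_mono) auto
      then show ?thesis using concave_slope_pos[of \<beta> "t powr s"] unfolding \<sigma>_def by (intro mult_left_mono) auto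
    qed
    finally have low: "\<sigma> * (t powr (- s / 2) - r * m) \<le> (LINT \<theta>|\<mu>. R \<theta>)" by simp
    have "A_trunc \<kappa> (V \<beta>) x = (LINT \<theta>|\<mu>. J \<theta>)"
      using integral_snd[OF iK] unfolding J_def A_trunc_def jump_diff_def K_def jump_def by (simp add: case_prod_beta')
    moreover have "(LINT \<theta>|\<mu>. R \<theta>) \<le> (LINT \<theta>|\<mu>. J \<theta>)"
      using integrable_snd[OF iK] iR RJ unfolding J_def by (intro integral_mono) auto
    moreover have "c - barrier_rem \<beta> s \<delta> * m * \<kappa> powr (2 - 2 * s) \<le> \<sigma> * (t powr (- s / 2) - r * m)"
    proof -
      have "concave_slope \<beta> (D powr s) \<le> \<sigma>"
        unfolding \<sigma>_def using t s by (intro concave_slope_antimono \<beta> powr_mono2) auto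
      then have 1: "c \<le> \<sigma> * t powr (- s / 2)"
        unfolding c_def using t s concave_slope_pos[of \<beta> "t powr s"]
        by (intro mult_mono powr_mono2') (auto simp: \<sigma>_def)
      have "barrier_rem \<beta> s t \<le> barrier_rem \<beta> s \<delta>"
        unfolding barrier_rem_def using \<beta> s d x
        by (intro add_mono mult_left_mono powr_mono2') (auto simp: t_def)
      then have "r * m \<le> barrier_rem \<beta> s \<delta> * \<kappa> powr (2 - 2 * s) * m"
        unfolding r_def by (intro mult_right_mono) auto
      moreover have "\<sigma> * (r * m) \<le> 1 * (r * m)"
      proof (rule mult_right_mono)
        show "\<sigma> \<le> 1" unfolding \<sigma>_def by (intro concave_slope_le_1 \<beta>) simp
        show "0 \<le> r * m" using \<beta> s by (simp add: r_def barrier_rem_def)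
      qed
      ultimately show ?thesis using 1 by (simp add: right_diff_distrib mult_ac)
    qed
    ultimately show ?thesis using low by linarith
  qed
  have "\<exists>M\<ge>0. \<forall>\<kappa>>0. \<forall>x\<in>\<Omega>. \<delta> \<le> d x \<longrightarrow> c - M * \<kappa> powr (2 - 2 * s) \<le> A_trunc \<kappa> (V \<beta>) x"
    if "0 < \<delta>" for \<delta>
  proof (intro exI conjI allI impI ballI)
    show "0 \<le> barrier_rem \<beta> s \<delta> * m" using \<beta> s by (simp add: barrier_rem_def)
  qed (rule main[OF that])
  with \<beta> c show ?thesis by (rule that)
qed

section \<open>The truncated barrier as a test function\<close>

definition cutoff :: "real \<Rightarrow> real \<Rightarrow> 'a \<Rightarrow> real" where
  "cutoff \<beta> \<delta> x = smooth_trunc (\<delta> powr s) (V \<beta> x)"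

lemma measurable_cutoff [measurable]: "0 < \<beta> \<Longrightarrow> cutoff \<beta> \<delta> \<in> borel_measurable borel"
  unfolding cutoff_def by measurable

lemma V_small:
  assumes \<beta>: "0 < \<beta>" and \<delta>: "0 < \<delta>" and x: "d x \<le> 2 * \<delta>"
  shows "V \<beta> x \<le> 2 * \<delta> powr s"
proof -
  have "V \<beta> x \<le> d x powr s" by (rule V_bounds[OF \<beta>])
  also have "\<dots> \<le> (2 * \<delta>) powr s" using x s by (intro powr_mono2) (auto simp: infdist_nonneg)
  also have "\<dots> = 2 powr s * \<delta> powr s" by (rule powr_mult)
  also have "\<dots> \<le> 2 * \<delta> powr s"
    using powr_mono[of s 1 2] s by (intro mult_right_mono) auto
  finally show ?thesis .
qed

lemma cutoff_bounds:
  assumes \<beta>: "0 < \<beta>" and \<delta>: "0 < \<delta>"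
  shows "0 \<le> cutoff \<beta> \<delta> x" "\<bar>cutoff \<beta> \<delta> x\<bar> \<le> D powr s" "d x \<le> 2 * \<delta> \<Longrightarrow> cutoff \<beta> \<delta> x = 0"
proof -
  have \<sigma>: "0 < \<delta> powr s" using \<delta> by simp
  show 1: "0 \<le> cutoff \<beta> \<delta> x" unfolding cutoff_def by (rule smooth_trunc_bounds[OF \<sigma>])
  have "cutoff \<beta> \<delta> x \<le> V \<beta> x" unfolding cutoff_def by (rule smooth_trunc_bounds(2)[OF \<sigma> V_bounds(1)[OF \<beta>]])
  then show "\<bar>cutoff \<beta> \<delta> x\<bar> \<le> D powr s" using 1 V_bounds(3)[OF \<beta>, of x] by linarith
  show "cutoff \<beta> \<delta> x = 0" if "d x \<le> 2 * \<delta>"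
    unfolding cutoff_def by (rule smooth_trunc_small(2)[OF \<sigma> V_small[OF \<beta> \<delta> that]])
qed

lemma V_diff:
  assumes \<beta>: "0 < \<beta>"
  shows "\<bar>V \<beta> y - V \<beta> x\<bar> \<le> \<bar>d y powr s - d x powr s\<bar>"
proof -
  have *: "\<bar>concave_profile \<beta> a - concave_profile \<beta> b\<bar> \<le> \<bar>a - b\<bar>" if "0 \<le> b" "b \<le> a" for a b
    using concave_profile_le[OF \<beta> that] by simp
  show ?thesis
    using *[of "d x powr s" "d y powr s"] *[of "d y powr s" "d x powr s"]
    by (cases "d x powr s \<le> d y powr s") (simp_all add: V_def abs_minus_commute)
qed

text \<open>Long jumps use that \<open>d powr s\<close> is Hoelder. For a jump shorter than
  \<delta>, either both endpoints have distance at most \<open>2 * \<delta>\<close> and the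
  truncation vanishes at both, or \<open>d x > \<delta>\<close> and the increment of
  \<open>V\<close> is at most \<open>\<delta> powr (s - 1) * r\<close>, whose square divided by
  \<open>\<delta> powr s\<close> is the second term.\<close>

lemma bracket_le:
  assumes \<beta>: "0 < \<beta>" and \<delta>: "0 < \<delta>" and h: "norm h = r"
  shows "trunc_bracket (\<delta> powr s) (V \<beta> x) (V \<beta> (x + h)) \<le>
    indicator {\<delta>..} r * r powr s + \<delta> powr (s - 2) * (indicator {..\<delta>} r * r powr 2)"
proof -
  define \<sigma> where "\<sigma> = \<delta> powr s"
  have \<sigma>: "0 < \<sigma>" using \<delta> by (simp add: \<sigma>_def)
  define y where "y = x + h"
  have dist: "\<bar>d y - d x\<bar> \<le> r"
    using infdist_triangle_abs[of y "- \<Omega>" x] h by (simp add: y_def dist_norm)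
  have r0: "0 \<le> r" using h norm_ge_zero by blast
  show ?thesis
  proof (cases "\<delta> \<le> r")
    case True
    have "trunc_bracket \<sigma> (V \<beta> x) (V \<beta> y) \<le> \<bar>V \<beta> y - V \<beta> x\<bar>" by (rule trunc_bracket_le[OF \<sigma>])
    also have "\<dots> \<le> \<bar>d y powr s - d x powr s\<bar>" by (rule V_diff[OF \<beta>])
    also have "\<dots> \<le> \<bar>d y - d x\<bar> powr s" by (intro powr_diff_le_powr s infdist_nonneg)
    also have "\<dots> \<le> r powr s" using dist s by (intro powr_mono2) auto
    also have "\<dots> \<le> indicator {\<delta>..} r * r powr s + \<delta> powr (s - 2) * (indicator {..\<delta>} r * r powr 2)"
      using True by simp
    finally show ?thesis by (simp add: \<sigma>_def y_def)
  next
    case False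
    then have r\<delta>: "r < \<delta>" by simp
    have R: "0 \<le> \<delta> powr (s - 2) * r powr 2" by simp
    have "trunc_bracket \<sigma> (V \<beta> x) (V \<beta> y) \<le> \<delta> powr (s - 2) * r powr 2"
    proof (cases "d x \<le> \<delta>")
      case True
      then have "d y \<le> 2 * \<delta>" "d x \<le> 2 * \<delta>" using dist r\<delta> \<delta> by linarith+
      then have "V \<beta> x \<le> 2 * \<sigma>" "V \<beta> y \<le> 2 * \<sigma>" unfolding \<sigma>_def by (intro V_small \<beta> \<delta>; simp)+
      then have "trunc_bracket \<sigma> (V \<beta> x) (V \<beta> y) = 0"
        using smooth_trunc_small[OF \<sigma>] by (simp add: trunc_bracket_def)
      then show ?thesis using R by simp
    next
      case False
      have "\<bar>V \<beta> y - V \<beta> x\<bar> \<le> \<bar>d y powr s - d x powr s\<bar>" by (rule V_diff[OF \<beta>])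
      also have "\<dots> \<le> \<delta> powr (s - 1) * \<bar>d y - d x\<bar>"
        using powr_diff_le_linear[OF s \<delta>, of "d x" "d y"] False infdist_nonneg[of y "- \<Omega>"]
        by (simp add: abs_minus_commute)
      also have "\<dots> \<le> \<delta> powr (s - 1) * r" using dist by (intro mult_left_mono) auto
      finally have "(V \<beta> y - V \<beta> x)\<^sup>2 \<le> (\<delta> powr (s - 1) * r)\<^sup>2"
        by (metis abs_ge_zero power2_abs power_mono)
      then have "(V \<beta> y - V \<beta> x)\<^sup>2 / \<sigma> \<le> (\<delta> powr (s - 1) * r)\<^sup>2 / \<sigma>"
        using \<sigma> by (intro divide_right_mono) auto
      also have "\<dots> = \<delta> powr (s - 2) * r powr 2"
      proof -
        have "\<delta> powr (s - 1) * \<delta> powr (s - 1) / \<delta> powr s = \<delta> powr (s - 1 + (s - 1) - s)"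
          by (simp only: powr_add powr_diff)
        also have "s - 1 + (s - 1) - s = s - 2" by simp
        finally have e: "\<delta> powr (s - 1) * \<delta> powr (s - 1) / \<delta> powr s = \<delta> powr (s - 2)" .
        have "(\<delta> powr (s - 1) * r)\<^sup>2 / \<sigma> = \<delta> powr (s - 1) * \<delta> powr (s - 1) / \<delta> powr s * (r * r)"
          by (simp add: \<sigma>_def power2_eq_square)
        then show ?thesis unfolding e using r0 by (simp add: powr_numeral power2_eq_square)
      qed
      finally show ?thesis using trunc_bracket_le(1)[OF \<sigma>, of "V \<beta> x" "V \<beta> y"] by linarith
    qed
    moreover have "indicator {\<delta>..} r * r powr s + \<delta> powr (s - 2) * (indicator {..\<delta>} r * r powr 2) = \<delta> powr (s - 2) * r powr 2"
      using r\<delta> by simp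
    ultimately show ?thesis by (simp add: \<sigma>_def y_def)
  qed
qed

lemma V_ge: assumes \<beta>: "0 < \<beta>" shows "concave_slope \<beta> (D powr s) * d x powr s \<le> V \<beta> x"
proof -
  have "d x powr s \<le> D powr s" using s infdist_le_D by (intro powr_mono2) (auto simp: infdist_nonneg)
  then have "concave_slope \<beta> (D powr s) * d x powr s \<le> concave_slope \<beta> (d x powr s) * d x powr s"
    by (intro mult_right_mono concave_slope_antimono \<beta>) auto
  also have "\<dots> \<le> V \<beta> x"
    using concave_profile_tangent[OF \<beta>, of "d x powr s" 0] by (simp add: V_def)
  finally show ?thesis .
qed

text \<open>The multiple of \<delta> beyond which the truncation acts as an affine function; the
  factor undoes the smallest slope of the profile.\<close>

lemma V_large:
  assumes \<beta>: "0 < \<beta>" and \<delta>: "0 < \<delta>"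
    and x: "(3 / concave_slope \<beta> (D powr s)) powr (1 / s) * \<delta> \<le> d x"
  shows "3 * \<delta> powr s \<le> V \<beta> x"
proof -
  define q where "q = concave_slope \<beta> (D powr s)"
  have q: "0 < q" by (simp add: q_def concave_slope_pos)
  have "(3 / q) * \<delta> powr s = ((3 / q) powr (1 / s)) powr s * \<delta> powr s"
    using q s by (simp add: powr_powr)
  also have "\<dots> = ((3 / q) powr (1 / s) * \<delta>) powr s" by (rule powr_mult[symmetric])
  also have "\<dots> \<le> d x powr s" using x s \<delta> by (intro powr_mono2) (auto simp: q_def)
  finally have "q * ((3 / q) * \<delta> powr s) \<le> q * d x powr s" using q by (intro mult_left_mono) auto
  then show ?thesis using V_ge[OF \<beta>, of x] q by (simp add: q_def)
qed

text \<open>A chain rule with remainder: the linear part of the truncation passes through the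
  operator, and each of the two jumps contributes one bracket, hence \<open>2 * m\<close>.\<close>

lemma A_trunc_cutoff_ge:
  assumes \<beta>: "0 < \<beta>" and \<delta>: "0 < \<delta>" and k: "0 < \<kappa>"
    and f: "integrable (power_tail s \<kappa>) f"
    and br: "\<And>h r. norm h = r \<Longrightarrow> 0 < r \<Longrightarrow> trunc_bracket (\<delta> powr s) (V \<beta> x) (V \<beta> (x + h)) \<le> f r"
  shows "trunc_slope (\<delta> powr s) (V \<beta> x) * A_trunc \<kappa> (V \<beta>) x - 2 * m * (LINT r|power_tail s \<kappa>. f r) \<le>
    A_trunc \<kappa> (cutoff \<beta> \<delta>) x"
proof -
  define \<sigma> where "\<sigma> = \<delta> powr s"
  define y where "y = trunc_slope \<sigma> (V \<beta> x)"
  have Vm: "V \<beta> \<in> borel_measurable borel" and cm: "cutoff \<beta> \<delta> \<in> borel_measurable borel" using \<beta> by measurable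
  note iV = integrable_jump_diff(3)[OF finite_K[OF k] measurable_jump Vm V_bounds(3)[OF \<beta>], of x]
  note ic = integrable_jump_diff(3)[OF finite_K[OF k] measurable_jump cm cutoff_bounds(2)[OF \<beta> \<delta>], of x]
  note iF = integrable_K_fst[OF k f]
  have "y * A_trunc \<kappa> (V \<beta>) x - 2 * m * (LINT r|power_tail s \<kappa>. f r) =
    (LINT z|K \<kappa>. y * (2 * V \<beta> x - V \<beta> (x + jump z) - V \<beta> (x - jump z)) - 2 * f (fst z))"
    unfolding A_trunc_def jump_diff_def using iV iF by simp
  also have "\<dots> \<le> (LINT z|K \<kappa>. 2 * cutoff \<beta> \<delta> x - cutoff \<beta> \<delta> (x + jump z) - cutoff \<beta> \<delta> (x - jump z))"
  proof (rule integral_mono_AE[OF _ ic])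
    show "integrable (K \<kappa>) (\<lambda>z. y * (2 * V \<beta> x - V \<beta> (x + jump z) - V \<beta> (x - jump z)) - 2 * f (fst z))"
      by (intro Bochner_Integration.integrable_diff integrable_mult_right iV iF)
    show "AE z in K \<kappa>. y * (2 * V \<beta> x - V \<beta> (x + jump z) - V \<beta> (x - jump z)) - 2 * f (fst z)
        \<le> 2 * cutoff \<beta> \<delta> x - cutoff \<beta> \<delta> (x + jump z) - cutoff \<beta> \<delta> (x - jump z)"
      using AE_K[OF k]
    proof eventually_elim
      case (elim z)
      then have z: "0 < fst z" "norm (jump z) = fst z" using k by (auto simp: jump_def)
      have "trunc_bracket \<sigma> (V \<beta> x) (V \<beta> (x + jump z)) \<le> f (fst z)"
        unfolding \<sigma>_def by (rule br[OF z(2,1)])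
      moreover have "trunc_bracket \<sigma> (V \<beta> x) (V \<beta> (x + - jump z)) \<le> f (fst z)"
        unfolding \<sigma>_def by (rule br[OF _ z(1)]) (simp add: z)
      ultimately show ?case
        unfolding trunc_bracket_def y_def[symmetric] by (simp add: cutoff_def \<sigma>_def algebra_simps)
    qed
  qed
  also have "\<dots> = A_trunc \<kappa> (cutoff \<beta> \<delta>) x" by (simp add: A_trunc_def jump_diff_def)
  finally show ?thesis by (simp add: y_def \<sigma>_def)
qed

text \<open>Far from the boundary the truncation is affine near \<open>x\<close>, and only jumps of
  length at least \<open>d x / 2\<close> leave this range; their mass is of order
  \<open>d x powr (- 2 * s)\<close>. Close to the boundary, and outside the domain, both bracket
  integrals are of order \<open>\<delta> powr (- s)\<close>, the size of the error term
  there.\<close>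

lemma cutoff_supersolution:
  obtains \<beta> c E where "0 < \<beta>" "0 < c" "0 \<le> E"
    "\<And>\<delta>. 0 < \<delta> \<Longrightarrow> \<delta> \<le> 1 \<Longrightarrow> \<exists>M\<ge>0. \<forall>\<kappa>>0. \<forall>x.
      c * indicator \<Omega> x - E * (\<delta> powr s * max \<delta> (d x) powr (- 2 * s)) - M * \<kappa> powr (2 - 2 * s) \<le> A_trunc \<kappa> (cutoff \<beta> \<delta>) x"
proof -
  obtain \<beta> c where \<beta>: "0 < \<beta>" and c: "0 < c" and super:
    "\<And>\<delta>. 0 < \<delta> \<Longrightarrow> \<exists>M\<ge>0. \<forall>\<kappa>>0. \<forall>x\<in>\<Omega>. \<delta> \<le> d x \<longrightarrow> c - M * \<kappa> powr (2 - 2 * s) \<le> A_trunc \<kappa> (V \<beta>) x"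
    by (rule V_supersolution, rule that)
  define q where "q = concave_slope \<beta> (D powr s)"
  have q: "0 < q" "q \<le> 1" using concave_slope_pos concave_slope_le_1[OF \<beta>] by (auto simp: q_def)
  define L where "L = (3 / q) powr (1 / s)"
  have L: "1 \<le> L" unfolding L_def using q s by (intro ge_one_powr_ge_zero) (auto simp: field_simps)
  have m0: "0 \<le> m" by simp
  \<comment> \<open>\<open>E1\<close> collects the integrals of the long and the short jumps near
    the boundary, \<open>E2\<close> the mass of jumps beyond \<open>d x / 2\<close> times the offset
    \<open>5 / 2\<close>.\<close>
  define E1 where "E1 = 2 * m * (1 / s + 1 / (2 - 2 * s))"
  define E2 where "E2 = 2 * m * (5 / 2 * (2 powr (2 * s) / (2 * s)))"
  have E1: "0 \<le> E1" and E2: "0 \<le> E2" using s by (auto simp: E1_def E2_def)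
  \<comment> \<open>The factor \<open>(2 * L) powr (2 * s)\<close> compares
    \<open>\<delta> powr (- s)\<close> with the error term for distances up to
    \<open>2 * L * \<delta>\<close>. Adding \<open>c\<close> lets the error absorb the positive
    source where no lower bound is available.\<close>
  define E where "E = (E1 + c) * (2 * L) powr (2 * s) + E2"
  have E: "0 \<le> E" using E1 E2 c by (simp add: E_def)
  have "\<exists>M\<ge>0. \<forall>\<kappa>>0. \<forall>x.
      c * indicator \<Omega> x - E * (\<delta> powr s * max \<delta> (d x) powr (- 2 * s)) - M * \<kappa> powr (2 - 2 * s) \<le> A_trunc \<kappa> (cutoff \<beta> \<delta>) x"
    if \<delta>: "0 < \<delta>" "\<delta> \<le> 1" for \<delta>
  proof -
    obtain M where M: "0 \<le> M" and sup: "\<And>\<kappa> x. 0 < \<kappa> \<Longrightarrow> x \<in> \<Omega> \<Longrightarrow> \<delta> \<le> d x \<Longrightarrow> c - M * \<kappa> powr (2 - 2 * s) \<le> A_trunc \<kappa> (V \<beta>) x"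
      using super[OF \<delta>(1)] by metis
    have main: "c * indicator \<Omega> x - E * (\<delta> powr s * max \<delta> (d x) powr (- 2 * s)) - M * \<kappa> powr (2 - 2 * s) \<le> A_trunc \<kappa> (cutoff \<beta> \<delta>) x"
      if k: "0 < \<kappa>" for \<kappa> x
    proof -
      define y where "y = trunc_slope (\<delta> powr s) (V \<beta> x)"
      have y: "0 \<le> y" "y \<le> 1" unfolding y_def by (rule trunc_slope_bounds)+
      define r where "r = M * \<kappa> powr (2 - 2 * s)"
      have r: "0 \<le> r" using M by (simp add: r_def)
      define W where "W = \<delta> powr s * max \<delta> (d x) powr (- 2 * s)"
      have W: "0 \<le> W" by (simp add: W_def)
      show ?thesis
      proof (cases "x \<in> \<Omega> \<and> 2 * L * \<delta> \<le> d x")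
        case True
        then have x: "x \<in> \<Omega>" and dx: "2 * L * \<delta> \<le> d x" by auto
        have L\<delta>: "\<delta> \<le> L * \<delta>" using L \<delta> by (simp add: mult_right_mono[of 1 L \<delta>, simplified])
        have \<delta>x: "\<delta> \<le> d x" using L\<delta> dx \<delta> by linarith
        have V3: "3 * \<delta> powr s \<le> V \<beta> x"
        proof -
          have "L * \<delta> \<le> d x" using dx L\<delta> \<delta> by linarith
          then show ?thesis by (intro V_large \<beta> \<delta>) (simp add: L_def q_def)
        qed
        have y1: "y = 1" unfolding y_def using \<delta> V3 by (intro smooth_trunc_large) auto
        have t2: "0 < d x / 2" using \<delta>x \<delta> by simp
        note T = power_tail_upper[OF k t2, of 0 s]
        have s2: "0 < 2 * s" using s by simp
        have iT: "integrable (power_tail s \<kappa>) (\<lambda>r. 5 / 2 * \<delta> powr s * (indicator {d x / 2..} r * r powr 0))"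
          using T(1)[OF s2] by (rule integrable_mult_right)
        have "(LINT r|power_tail s \<kappa>. 5 / 2 * \<delta> powr s * (indicator {d x / 2..} r * r powr 0)) =
            5 / 2 * \<delta> powr s * (LINT r|power_tail s \<kappa>. indicator {d x / 2..} r * r powr 0)"
          by (rule Bochner_Integration.integral_mult_right_zero)
        also have "\<dots> \<le> 5 / 2 * \<delta> powr s * ((d x / 2) powr (0 - 2 * s) / (2 * s - 0))"
          by (intro mult_left_mono T(2)[OF s2]) simp
        also have "\<dots> = 5 / 2 * (2 powr (2 * s) / (2 * s)) * W"
        proof -
          have "(d x / 2) powr (0 - 2 * s) = d x powr (- 2 * s) / 2 powr (- 2 * s)"
            by (simp only: powr_divide diff_0) simp
          also have "\<dots> = d x powr (- 2 * s) * 2 powr (2 * s)" by (simp add: powr_minus divide_inverse)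
          finally show ?thesis using \<delta>x by (simp add: W_def max_def)
        qed
        finally have "2 * m * (LINT r|power_tail s \<kappa>. 5 / 2 * \<delta> powr s * (indicator {d x / 2..} r * r powr 0)) \<le>
            2 * m * (5 / 2 * (2 powr (2 * s) / (2 * s)) * W)"
          by (rule mult_left_mono) simp
        also have "\<dots> = E2 * W" by (simp only: E2_def mult.assoc)
        finally have T2: "2 * m * (LINT r|power_tail s \<kappa>. 5 / 2 * \<delta> powr s * (indicator {d x / 2..} r * r powr 0)) \<le> E2 * W" .
        have "y * A_trunc \<kappa> (V \<beta>) x - 2 * m * (LINT r|power_tail s \<kappa>. 5 / 2 * \<delta> powr s * (indicator {d x / 2..} r * r powr 0)) \<le>
            A_trunc \<kappa> (cutoff \<beta> \<delta>) x"
          unfolding y_def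
        proof (rule A_trunc_cutoff_ge[OF \<beta> \<delta>(1) k iT])
          fix h :: 'a and r :: real assume h: "norm h = r" "0 < r"
          have V0: "0 \<le> V \<beta> (x + h)" by (rule V_bounds[OF \<beta>])
          have \<sigma>: "0 < \<delta> powr s" using \<delta> by simp
          show "trunc_bracket (\<delta> powr s) (V \<beta> x) (V \<beta> (x + h)) \<le> 5 / 2 * \<delta> powr s * (indicator {d x / 2..} r * r powr 0)"
          proof (cases "d x / 2 \<le> r")
            case True
            then show ?thesis using trunc_bracket_large(1)[OF \<sigma> V3 V0] h by simp
          next
            case False
            have "\<bar>d (x + h) - d x\<bar> \<le> r"
              using infdist_triangle_abs[of "x + h" "- \<Omega>" x] h by (simp add: dist_norm)
            \<comment> \<open>A jump shorter than half the distance keeps at least half of it; this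
              is why the far region starts at \<open>2 * L * \<delta>\<close> and not at
              \<open>L * \<delta>\<close>.\<close>
            then have "L * \<delta> \<le> d (x + h)" using False dx by linarith
            then have "3 * \<delta> powr s \<le> V \<beta> (x + h)" by (intro V_large \<beta> \<delta>) (simp add: L_def q_def)
            then show ?thesis using trunc_bracket_large(2)[OF \<sigma> V3 V0] False by simp
          qed
        qed
        moreover have "c - r \<le> A_trunc \<kappa> (V \<beta>) x" unfolding r_def by (rule sup[OF k x \<delta>x])
        moreover have "E2 * W \<le> E * W"
          using E1 c W by (intro mult_right_mono) (auto simp: E_def)
        ultimately show ?thesis using T2 x unfolding y1 r_def[symmetric] W_def[symmetric] by simp
      next
        case False
        have far: "max \<delta> (d x) \<le> 2 * L * \<delta>" if "x \<in> \<Omega>"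
          using False that L \<delta> mult_right_mono[of 1 L \<delta>] by auto
        have far': "max \<delta> (d x) \<le> 2 * L * \<delta>"
        proof (cases "x \<in> \<Omega>")
          case False
          then have "d x = 0" by simp
          then show ?thesis using L \<delta> mult_right_mono[of 1 L \<delta>] by (auto simp: max_def)
        qed (rule far)
        have W1: "\<delta> powr (- s) \<le> (2 * L) powr (2 * s) * W"
        proof -
          have "(2 * L * \<delta>) powr (- 2 * s) \<le> max \<delta> (d x) powr (- 2 * s)"
            using far' \<delta> s by (intro powr_mono2') auto
          then have "(2 * L) powr (2 * s) * (\<delta> powr s * (2 * L * \<delta>) powr (- 2 * s)) \<le> (2 * L) powr (2 * s) * W"
            unfolding W_def by (intro mult_left_mono) auto
          moreover have "(2 * L) powr (2 * s) * (\<delta> powr s * (2 * L * \<delta>) powr (- 2 * s)) = \<delta> powr (- s)"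
          proof -
            have "(2 * L * \<delta>) powr (- 2 * s) = (2 * L) powr (- 2 * s) * \<delta> powr (- 2 * s)" by (rule powr_mult)
            moreover have "(2 * L) powr (2 * s) * (2 * L) powr (- 2 * s) = 1" using L by (simp flip: powr_add)
            moreover have "\<delta> powr s * \<delta> powr (- 2 * s) = \<delta> powr (- s)" by (simp flip: powr_add)
            ultimately show ?thesis by (simp add: mult_ac)
          qed
          ultimately show ?thesis by simp
        qed
        \<comment> \<open>Here \<open>\<delta> \<le> 1\<close> is used.\<close>
        have W2: "1 \<le> (2 * L) powr (2 * s) * W"
        proof -
          have "1 powr (- s) \<le> \<delta> powr (- s)" using \<delta> s by (intro powr_mono2') auto
          then show ?thesis using W1 by simp
        qed
        note T1 = power_tail_upper[OF k \<delta>(1), of s s] and T2 = power_tail_lower[OF k \<delta>(1), of s 2]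
        have s1: "s < 2 * s" "2 * s < 2" using s by auto
        have i: "integrable (power_tail s \<kappa>) (\<lambda>r. indicator {\<delta>..} r * r powr s + \<delta> powr (s - 2) * (indicator {..\<delta>} r * r powr 2))"
          by (intro Bochner_Integration.integrable_add integrable_mult_right T1(1)[OF s1(1)] T2(1)[OF s1(2)])
        have "(LINT r|power_tail s \<kappa>. indicator {\<delta>..} r * r powr s + \<delta> powr (s - 2) * (indicator {..\<delta>} r * r powr 2)) =
          (LINT r|power_tail s \<kappa>. indicator {\<delta>..} r * r powr s) + \<delta> powr (s - 2) * (LINT r|power_tail s \<kappa>. indicator {..\<delta>} r * r powr 2)"
          by (simp only: Bochner_Integration.integral_add Bochner_Integration.integral_mult_right_zero
              integrable_mult_right T1(1)[OF s1(1)] T2(1)[OF s1(2)])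
        also have "\<dots> \<le> \<delta> powr (s - 2 * s) / (2 * s - s) + \<delta> powr (s - 2) * (\<delta> powr (2 - 2 * s) / (2 - 2 * s))"
          by (intro add_mono mult_left_mono T1(2)[OF s1(1)] T2(2)[OF s1(2)]) simp
        also have "\<dots> = (1 / s + 1 / (2 - 2 * s)) * \<delta> powr (- s)"
        proof -
          have "\<delta> powr (s - 2) * \<delta> powr (2 - 2 * s) = \<delta> powr (- s)" by (simp flip: powr_add)
          then show ?thesis by (simp add: distrib_right)
        qed
        finally have "2 * m * (LINT r|power_tail s \<kappa>. indicator {\<delta>..} r * r powr s + \<delta> powr (s - 2) * (indicator {..\<delta>} r * r powr 2)) \<le>
            E1 * \<delta> powr (- s)"
          unfolding E1_def mult.assoc using m0 by (intro mult_left_mono) auto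
        also have "\<dots> \<le> E1 * ((2 * L) powr (2 * s) * W)" using W1 E1 by (intro mult_left_mono)
        finally have I: "2 * m * (LINT r|power_tail s \<kappa>. indicator {\<delta>..} r * r powr s + \<delta> powr (s - 2) * (indicator {..\<delta>} r * r powr 2)) \<le>
            E1 * ((2 * L) powr (2 * s) * W)" .
        have "y * A_trunc \<kappa> (V \<beta>) x - 2 * m * (LINT r|power_tail s \<kappa>. indicator {\<delta>..} r * r powr s + \<delta> powr (s - 2) * (indicator {..\<delta>} r * r powr 2)) \<le>
            A_trunc \<kappa> (cutoff \<beta> \<delta>) x"
          unfolding y_def by (rule A_trunc_cutoff_ge[OF \<beta> \<delta>(1) k i bracket_le[OF \<beta> \<delta>(1)]])
        \<comment> \<open>The supersolution bound for \<open>V\<close> is known only for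
          \<open>\<delta> \<le> d x\<close>; at smaller distances, and outside the domain, the slope
          \<open>y\<close> is zero.\<close>
        moreover have "- r \<le> y * A_trunc \<kappa> (V \<beta>) x"
        proof (cases "d x \<le> \<delta>")
          case True
          then have "y = 0" unfolding y_def using \<delta> by (intro smooth_trunc_small V_small \<beta>) auto
          then show ?thesis using r by simp
        next
          case False
          have "x \<in> \<Omega>"
          proof (rule ccontr)
            assume "x \<notin> \<Omega>"
            then have "d x = 0" by simp
            then show False using False \<delta> by simp
          qed
          then have "c - r \<le> A_trunc \<kappa> (V \<beta>) x" unfolding r_def using False by (intro sup[OF k]) auto
          then have "- r \<le> A_trunc \<kappa> (V \<beta>) x" using c by linarith
          then have "y * (- r) \<le> y * A_trunc \<kappa> (V \<beta>) x" using y by (intro mult_left_mono)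
          moreover have "y * r \<le> 1 * r" using y r by (intro mult_right_mono)
          ultimately show ?thesis by simp
        qed
        moreover have "c * indicator \<Omega> x \<le> c * ((2 * L) powr (2 * s) * W)"
        proof (rule mult_left_mono)
          show "indicator \<Omega> x \<le> (2 * L) powr (2 * s) * W" using W2 by (simp add: indicator_def)
        qed (use c in simp)
        moreover have "E1 * ((2 * L) powr (2 * s) * W) + c * ((2 * L) powr (2 * s) * W) \<le> E * W"
          using E2 W by (simp add: E_def distrib_right mult.assoc)
        ultimately show ?thesis using I unfolding r_def[symmetric] W_def[symmetric] by linarith
      qed
    qed
    show ?thesis using M main by blast
  qed
  with \<beta> c E show ?thesis by (rule that)
qed

end

subsection \<open>Mollified positive parts\<close>

lemma integral_bump_reflect:
  fixes y :: "'a::euclidean_space"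
  assumes "0 < \<delta>"
  shows "integrable lborel (\<lambda>x. bump \<delta> (y - x))" "(LINT x|lborel. bump \<delta> (y - x)) = (LINT x|lborel. bump \<delta> (x :: 'a))"
proof -
  have sym: "bump \<delta> (y - x) = bump \<delta> (x - y)" for x :: 'a
    using bump_minus[of \<delta> "y - x"] by simp
  show "integrable lborel (\<lambda>x. bump \<delta> (y - x))" unfolding sym by (rule integrable_bump[OF assms])
  show "(LINT x|lborel. bump \<delta> (y - x)) = (LINT x|lborel. bump \<delta> (x :: 'a))"
    using lborel_shift(2)[of "bump \<delta>" "- y"] unfolding sym by simp
qed

lemma integral_power_tail_atLeast:
  assumes "0 < s" "0 < \<kappa>" "\<kappa> \<le> a"
  shows "(LINT r|power_tail s \<kappa>. indicator {a..} r) = a powr (- 2 * s) / (2 * s)"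
proof -
  have hi: "((\<lambda>r. r powr (- 1 - 2 * s)) has_integral a powr (- 2 * s) / (2 * s)) {a..}"
    using has_integral_powr_to_inf[of "- 1 - 2 * s" a] assms by simp
  have "(LINT r|power_tail s \<kappa>. indicator {a..} r) = (LINT r|lborel. indicator {a..} r * r powr (- 1 - 2 * s))"
    using assms by (subst integral_power_tail) (auto intro!: Bochner_Integration.integral_cong simp: indicator_def)
  also have "\<dots> = a powr (- 2 * s) / (2 * s)"
    using nonneg_has_integral_lborel(2)[OF _ _ _ hi] by auto
  finally show ?thesis .
qed

lemma integrable_mollify_product:
  fixes f g :: "'a::euclidean_space \<Rightarrow> real"
  assumes \<delta>: "0 < \<delta>" and f: "integrable lborel f" and [measurable]: "f \<in> borel_measurable borel" "g \<in> borel_measurable borel"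
    and B: "\<And>x. \<bar>g x\<bar> \<le> B"
  shows "integrable (lborel \<Otimes>\<^sub>M lborel) (\<lambda>(y, x). f y * bump \<delta> (y - x) * g x)"
proof -
  have 1: "integrable (lborel \<Otimes>\<^sub>M lborel) (\<lambda>(y, x). f y * bump \<delta> (y - x))"
  proof (rule lborel_pair.Fubini_integrable)
    have "(LINT x|lborel. norm (f y * bump \<delta> (y - x))) = \<bar>f y\<bar> * (LINT x|lborel. bump \<delta> (x :: 'a))" for y
      by (simp add: abs_mult bump_nonneg integral_bump_reflect(2)[OF \<delta>])
    then show "integrable lborel (\<lambda>y. LINT x|lborel. norm (case (y, x) of (y, x) \<Rightarrow> f y * bump \<delta> (y - x)))"
      using f by simp
  qed (use integral_bump_reflect(1)[OF \<delta>] in auto)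
  have "integrable (lborel \<Otimes>\<^sub>M lborel) (\<lambda>p. (case p of (y, x) \<Rightarrow> f y * bump \<delta> (y - x)) * g (snd p))"
    using B by (intro integrable_mult_bounded[OF 1]) auto
  then show ?thesis by (simp add: case_prod_beta')
qed

definition mollify :: "real \<Rightarrow> ('a::euclidean_space \<Rightarrow> real) \<Rightarrow> 'a \<Rightarrow> real" where
  "mollify \<delta> f x = (LINT y|lborel. f y * bump \<delta> (y - x))"

lemma measurable_mollify [measurable]:
  assumes [measurable]: "f \<in> borel_measurable borel"
  shows "mollify \<delta> f \<in> borel_measurable borel"
  unfolding mollify_def by measurable

lemma mollify_integral:
  fixes f g :: "'a::euclidean_space \<Rightarrow> real"
  assumes \<delta>: "0 < \<delta>" and f: "integrable lborel f" and fm: "f \<in> borel_measurable borel" and gm: "g \<in> borel_measurable borel"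
    and B: "\<And>x. \<bar>g x\<bar> \<le> B"
  shows "integrable lborel (\<lambda>x. mollify \<delta> f x * g x)"
    and "integrable lborel (\<lambda>y. f y * (LINT x|lborel. bump \<delta> (y - x) * g x))"
    and "(LINT x|lborel. mollify \<delta> f x * g x) = (LINT y|lborel. f y * (LINT x|lborel. bump \<delta> (y - x) * g x))"
proof -
  note I = integrable_mollify_product[OF \<delta> f fm gm B]
  have 1: "mollify \<delta> f x * g x = (LINT y|lborel. f y * bump \<delta> (y - x) * g x)" for x
    by (simp add: mollify_def)
  have 2: "f y * (LINT x|lborel. bump \<delta> (y - x) * g x) = (LINT x|lborel. f y * bump \<delta> (y - x) * g x)" for y
    by (simp add: mult.assoc)
  show "integrable lborel (\<lambda>x. mollify \<delta> f x * g x)" unfolding 1 by (rule lborel_pair.integrable_snd[OF I])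
  show "integrable lborel (\<lambda>y. f y * (LINT x|lborel. bump \<delta> (y - x) * g x))"
    unfolding 2 by (rule lborel_pair.integrable_fst[OF I])
  show "(LINT x|lborel. mollify \<delta> f x * g x) = (LINT y|lborel. f y * (LINT x|lborel. bump \<delta> (y - x) * g x))"
    unfolding 1 2 by (rule lborel_pair.Fubini_integral[OF I])
qed

lemma integrable_mollify:
  fixes f :: "'a::euclidean_space \<Rightarrow> real"
  assumes "0 < \<delta>" "integrable lborel f" "f \<in> borel_measurable borel"
  shows "integrable lborel (mollify \<delta> f)"
  using mollify_integral(1)[OF assms, of "\<lambda>_. 1" 1] by simp

lemma integrable_times_bump:
  fixes f :: "'a::euclidean_space \<Rightarrow> real"
  assumes f: "integrable lborel f" and [measurable]: "f \<in> borel_measurable borel"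
  shows "integrable lborel (\<lambda>y. f y * bump \<delta> (y - x))"
  by (rule integrable_mult_bounded[OF f _ bump_abs_le_1]) measurable

lemma mollify_bounded:
  fixes f :: "'a::euclidean_space \<Rightarrow> real"
  assumes f: "integrable lborel f" and fm: "f \<in> borel_measurable borel"
  shows "\<bar>mollify \<delta> f x\<bar> \<le> (LINT y|lborel. \<bar>f y\<bar>)"
proof -
  have "\<bar>mollify \<delta> f x\<bar> \<le> (LINT y|lborel. \<bar>f y * bump \<delta> (y - x)\<bar>)"
    unfolding mollify_def by (rule integral_abs_bound)
  also have "\<dots> \<le> (LINT y|lborel. \<bar>f y\<bar>)"
    using integrable_times_bump[OF f fm] f bump_abs_le_1[of \<delta>]
    by (intro integral_mono integrable_abs) (auto simp: abs_mult intro!: mult_left_le)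
  finally show ?thesis .
qed

lemma mollify_mono:
  fixes f g :: "'a::euclidean_space \<Rightarrow> real"
  assumes "integrable lborel f" "f \<in> borel_measurable borel" "integrable lborel g" "g \<in> borel_measurable borel" "\<And>y. f y \<le> g y"
  shows "mollify \<delta> f x \<le> mollify \<delta> g x"
  unfolding mollify_def using assms
  by (intro integral_mono integrable_times_bump mult_right_mono) (auto simp: bump_nonneg)

lemma nonpos_if_le_powr:
  fixes a b p :: real
  assumes "0 < p" "\<And>\<kappa>. 0 < \<kappa> \<Longrightarrow> a \<le> b * \<kappa> powr p"
  shows "a \<le> 0"
proof (rule tendsto_le)
  show "((\<lambda>\<kappa>. b * \<kappa> powr p) \<longlongrightarrow> 0) (at_right 0)"
  proof -
    have "((\<lambda>\<kappa>. b * \<kappa> powr p) \<longlongrightarrow> b * 0 powr p) (at_right 0)"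
      using assms(1) by (intro tendsto_intros tendsto_powr') (auto intro!: eventually_mono[OF eventually_at_right_less])
    then show ?thesis by simp
  qed
  show "((\<lambda>\<kappa>. a) \<longlongrightarrow> a) (at_right 0)" by simp
  show "eventually (\<lambda>\<kappa>. a \<le> b * \<kappa> powr p) (at_right 0)"
    using eventually_at_right_less[of 0] by eventually_elim (use assms in auto)
qed simp

context stable_kernel
begin

text \<open>Kato's inequality for second differences. Where \<open>f\<close> is positive, taking the
  positive part only raises the neighbouring values; elsewhere the value at \<open>x\<close> is
  \<open>0\<close> among nonnegative neighbours, and \<open>0 \<le> r\<close> suffices.\<close>

lemma A_trunc_max_le:
  assumes k: "0 < \<kappa>" and fm [measurable]: "f \<in> borel_measurable borel" and B: "\<And>x. \<bar>f x\<bar> \<le> B"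
    and le: "A_trunc \<kappa> f x \<le> r" and r: "0 \<le> r"
  shows "A_trunc \<kappa> (\<lambda>x. max (f x) 0) x \<le> r"
proof -
  have gm: "(\<lambda>x. max (f x) 0) \<in> borel_measurable borel" by measurable
  have gB: "\<bar>max (f x) 0\<bar> \<le> B" for x using B[of x] by auto
  note ig = integrable_jump_diff(3)[OF finite_K[OF k] measurable_jump gm gB, of x]
  note jf = integrable_jump_diff(3)[OF finite_K[OF k] measurable_jump fm B, of x]
  show ?thesis
  proof (cases "0 < f x")
    case True
    have "A_trunc \<kappa> (\<lambda>x. max (f x) 0) x \<le> A_trunc \<kappa> f x"
      unfolding A_trunc_def jump_diff_def by (rule integral_mono[OF ig jf]) (use True in auto)
    then show ?thesis using le by simp
  next
    case False
    have "A_trunc \<kappa> (\<lambda>x. max (f x) 0) x \<le> (LINT z|K \<kappa>. 0)"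
      unfolding A_trunc_def jump_diff_def by (rule integral_mono[OF ig]) (use False in auto)
    then show ?thesis using r by simp
  qed
qed

end

context distance_barrier
begin

declare measurable_mu [measurable del]

lemma infdist_shift_le: "d x \<le> d y + dist x y"
  using infdist_triangle[of x "- \<Omega>" y] .

definition weight :: "real \<Rightarrow> 'a \<Rightarrow> real" where
  "weight \<delta> x = \<delta> powr s * max \<delta> (d x) powr (- 2 * s)"

lemma measurable_weight [measurable]: "weight \<delta> \<in> borel_measurable borel"
  unfolding weight_def by measurable

lemma weight_bounds:
  assumes "0 < \<delta>" shows "0 \<le> weight \<delta> x" "\<bar>weight \<delta> x\<bar> \<le> \<delta> powr s * \<delta> powr (- 2 * s)"
proof -
  show 0: "0 \<le> weight \<delta> x" by (simp add: weight_def)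
  have "max \<delta> (d x) powr (- 2 * s) \<le> \<delta> powr (- 2 * s)" using assms s by (intro powr_mono2') auto
  then have "weight \<delta> x \<le> \<delta> powr s * \<delta> powr (- 2 * s)" unfolding weight_def by (intro mult_left_mono) auto
  then show "\<bar>weight \<delta> x\<bar> \<le> \<delta> powr s * \<delta> powr (- 2 * s)" using 0 by simp
qed

text \<open>The distance changes by less than \<delta>, so \<open>max \<delta> d\<close> at most
  doubles; \<open>2 powr (2 * s) \<le> 4\<close>. Mollification on scale \<delta> therefore cannot
  see the variation of the weight.\<close>

lemma weight_near:
  assumes \<delta>: "0 < \<delta>" and xy: "dist y x < \<delta>" shows "weight \<delta> x \<le> 4 * weight \<delta> y"
proof -
  have "d y \<le> d x + \<delta>" using infdist_shift_le[of y x] xy by linarith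
  then have "max \<delta> (d y) / 2 \<le> max \<delta> (d x)" using \<delta> by (auto simp: max_def)
  then have "max \<delta> (d x) powr (- 2 * s) \<le> (max \<delta> (d y) / 2) powr (- 2 * s)"
    using \<delta> s by (intro powr_mono2') auto
  also have "\<dots> = max \<delta> (d y) powr (- 2 * s) / 2 powr (- 2 * s)" by (rule powr_divide)
  also have "\<dots> = 2 powr (2 * s) * max \<delta> (d y) powr (- 2 * s)" by (simp add: powr_minus divide_inverse)
  also have "\<dots> \<le> 4 * max \<delta> (d y) powr (- 2 * s)"
    using powr_mono[of "2 * s" 2 2] s by (intro mult_right_mono) auto
  finally have "\<delta> powr s * max \<delta> (d x) powr (- 2 * s) \<le> \<delta> powr s * (4 * max \<delta> (d y) powr (- 2 * s))"
    by (intro mult_left_mono) auto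
  then show ?thesis by (simp add: weight_def)
qed

text \<open>The truncated barrier is a supersolution up to \<open>weight\<close>, and the mollified
  positive part is a subsolution wherever that barrier is nonzero. Symmetry of the truncated
  operator compares the two. The constant \<open>C'\<close> must not depend on \<delta>.\<close>

lemma mollified_positive_part_bound:
  fixes U :: "'a \<Rightarrow> real"
  assumes U: "integrable lborel U" and Um [measurable]: "U \<in> borel_measurable borel" and bdd: "bounded \<Omega>"
    and sub: "\<And>\<delta>. 0 < \<delta> \<Longrightarrow> \<exists>B\<ge>0. \<forall>\<kappa>>0. \<forall>x. 2 * \<delta> < d x \<longrightarrow> A_trunc \<kappa> (mollify \<delta> U) x \<le> B * \<kappa> powr (2 - 2 * s)"
  obtains C' where "0 \<le> C'"
    "\<And>\<delta>. 0 < \<delta> \<Longrightarrow> \<delta> \<le> 1 \<Longrightarrow> (LINT x|lborel. max (mollify \<delta> U x) 0 * indicator \<Omega> x) \<le>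
      C' * (LINT x|lborel. bump \<delta> (x :: 'a)) * (LINT y|lborel. max (U y) 0 * weight \<delta> y)"
proof -
  obtain \<beta> c E where \<beta>: "0 < \<beta>" and c: "0 < c" and E: "0 \<le> E" and super:
    "\<And>\<delta>. 0 < \<delta> \<Longrightarrow> \<delta> \<le> 1 \<Longrightarrow> \<exists>M\<ge>0. \<forall>\<kappa>>0. \<forall>x.
      c * indicator \<Omega> x - E * (\<delta> powr s * max \<delta> (d x) powr (- 2 * s)) - M * \<kappa> powr (2 - 2 * s) \<le> A_trunc \<kappa> (cutoff \<beta> \<delta>) x"
    by (rule cutoff_supersolution, rule that)
  have \<Omega>m [measurable]: "\<Omega> \<in> sets borel" using open_dom by simp
  have main: "(LINT x|lborel. max (mollify \<delta> U x) 0 * indicator \<Omega> x) \<le>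
      4 * E / c * (LINT x|lborel. bump \<delta> (x :: 'a)) * (LINT y|lborel. max (U y) 0 * weight \<delta> y)"
    if \<delta>: "0 < \<delta>" "\<delta> \<le> 1" for \<delta>
  proof -
    define v where "v = (\<lambda>x. max (mollify \<delta> U x) 0)"
    define \<eta> where "\<eta> = cutoff \<beta> \<delta>"
    define Z where "Z = (LINT x|lborel. bump \<delta> (x :: 'a))"
    have vm [measurable]: "v \<in> borel_measurable borel" unfolding v_def by measurable
    have \<eta>m [measurable]: "\<eta> \<in> borel_measurable borel" unfolding \<eta>_def using \<beta> by measurable
    have v0: "0 \<le> v x" for x by (simp add: v_def)
    have vB: "\<bar>v x\<bar> \<le> (LINT y|lborel. \<bar>U y\<bar>)" for x
      using mollify_bounded[OF U Um, of \<delta> x] by (auto simp: v_def)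
    have iv: "integrable lborel v"
    proof (rule Bochner_Integration.integrable_bound[OF integrable_mollify[OF \<delta>(1) U Um]])
      show "AE x in lborel. norm (v x) \<le> norm (mollify \<delta> U x)" by (auto simp: v_def)
    qed measurable
    have \<eta>b: "0 \<le> \<eta> x" "\<bar>\<eta> x\<bar> \<le> D powr s" "d x \<le> 2 * \<delta> \<Longrightarrow> \<eta> x = 0" for x
      unfolding \<eta>_def using cutoff_bounds[OF \<beta> \<delta>(1)] by auto
    have i\<eta>: "integrable lborel \<eta>"
    proof (rule Bochner_Integration.integrable_bound)
      have "emeasure lborel \<Omega> < \<infinity>" using bdd emeasure_bounded_finite by blast
      then show "integrable lborel (\<lambda>x. D powr s * indicator \<Omega> x)"
        by (intro integrable_mult_right integrable_real_indicator) auto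
      show "AE x in lborel. norm (\<eta> x) \<le> norm (D powr s * indicator \<Omega> x)"
      proof (rule AE_I2)
        fix x
        show "norm (\<eta> x) \<le> norm (D powr s * indicator \<Omega> x)"
        proof (cases "x \<in> \<Omega>")
          case False
          then have "d x = 0" by simp
          then show ?thesis using \<eta>b(3)[of x] \<delta> by simp
        qed (use \<eta>b(2) in simp)
      qed
    qed measurable
    obtain M where M: "0 \<le> M" and low: "\<And>\<kappa> x. 0 < \<kappa> \<Longrightarrow>
        c * indicator \<Omega> x - E * weight \<delta> x - M * \<kappa> powr (2 - 2 * s) \<le> A_trunc \<kappa> \<eta> x"
      using super[OF \<delta>] unfolding \<eta>_def weight_def by metis
    obtain B where B: "0 \<le> B" and up: "\<And>\<kappa> x. 0 < \<kappa> \<Longrightarrow> 2 * \<delta> < d x \<Longrightarrow> A_trunc \<kappa> (mollify \<delta> U) x \<le> B * \<kappa> powr (2 - 2 * s)"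
      using sub[OF \<delta>(1)] by metis
    have iv\<Omega>: "integrable lborel (\<lambda>x. v x * indicator \<Omega> x)"
      by (rule integrable_mult_bounded[OF iv, of _ 1]) (auto simp: indicator_def)
    have ivW: "integrable lborel (\<lambda>x. v x * weight \<delta> x)"
      by (rule integrable_mult_bounded[OF iv _ weight_bounds(2)[OF \<delta>(1)]]) measurable
    \<comment> \<open>Both truncation errors, \<open>M\<close> from the barrier and \<open>B\<close>
      from the mollification, carry the same power of \<kappa> and vanish for fixed
      \<delta>.\<close>
    have step: "c * (LINT x|lborel. v x * indicator \<Omega> x) - E * (LINT x|lborel. v x * weight \<delta> x) \<le>
        (M * (LINT x|lborel. v x) + B * (LINT x|lborel. \<eta> x)) * \<kappa> powr (2 - 2 * s)" if k: "0 < \<kappa>" for \<kappa>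
    proof -
      define r where "r = \<kappa> powr (2 - 2 * s)"
      have r: "0 \<le> r" by (simp add: r_def)
      have iA: "integrable lborel (\<lambda>x. f x * A_trunc \<kappa> g x)"
        if f: "integrable lborel f" and gm: "g \<in> borel_measurable borel" and gB: "\<And>x. \<bar>g x\<bar> \<le> b" for f g b
      proof -
        have [measurable]: "A_trunc \<kappa> g \<in> borel_measurable borel"
          unfolding A_trunc_def by (rule jump_diff_measurable_bounded(1)[OF finite_K[OF k] measurable_jump gm gB])
        have "\<bar>A_trunc \<kappa> g x\<bar> \<le> 4 * b * measure (K \<kappa>) (space (K \<kappa>))" for x
          unfolding A_trunc_def by (rule jump_diff_measurable_bounded(2)[OF finite_K[OF k] measurable_jump gm gB])
        then show ?thesis by (intro integrable_mult_bounded[OF f]) auto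
      qed
      have "c * (LINT x|lborel. v x * indicator \<Omega> x) - E * (LINT x|lborel. v x * weight \<delta> x) - M * r * (LINT x|lborel. v x) =
        (LINT x|lborel. c * (v x * indicator \<Omega> x) - E * (v x * weight \<delta> x) - M * r * v x)"
        using iv iv\<Omega> ivW by simp
      also have "\<dots> \<le> (LINT x|lborel. v x * A_trunc \<kappa> \<eta> x)"
      proof (rule integral_mono)
        show "integrable lborel (\<lambda>x. v x * A_trunc \<kappa> \<eta> x)" by (rule iA[OF iv \<eta>m \<eta>b(2)])
        show "integrable lborel (\<lambda>x. c * (v x * indicator \<Omega> x) - E * (v x * weight \<delta> x) - M * r * v x)"
          by (intro Bochner_Integration.integrable_diff integrable_mult_right iv iv\<Omega> ivW)
        show "c * (v x * indicator \<Omega> x) - E * (v x * weight \<delta> x) - M * r * v x \<le> v x * A_trunc \<kappa> \<eta> x" for x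
          using mult_left_mono[OF low[OF k, of x] v0[of x]] by (simp add: r_def algebra_simps)
      qed
      also have "\<dots> = (LINT x|lborel. \<eta> x * A_trunc \<kappa> v x)"
        unfolding A_trunc_def by (rule jump_diff_symmetric[OF finite_K[OF k] measurable_jump iv vm \<eta>m \<eta>b(2)])
      also have "\<dots> \<le> (LINT x|lborel. B * r * \<eta> x)"
      proof (rule integral_mono)
        show "integrable lborel (\<lambda>x. \<eta> x * A_trunc \<kappa> v x)" by (rule iA[OF i\<eta> vm vB])
        show "integrable lborel (\<lambda>x. B * r * \<eta> x)" using i\<eta> by simp
        show "\<eta> x * A_trunc \<kappa> v x \<le> B * r * \<eta> x" for x
        proof (cases "d x \<le> 2 * \<delta>")
          case True
          then show ?thesis using \<eta>b(3) by simp
        next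
          case False
          have "A_trunc \<kappa> v x \<le> B * r"
            unfolding v_def r_def
            by (rule A_trunc_max_le[OF k measurable_mollify[OF Um] mollify_bounded[OF U Um] up[OF k]]) (use False B in auto)
          then have "\<eta> x * A_trunc \<kappa> v x \<le> \<eta> x * (B * r)" by (rule mult_left_mono[OF _ \<eta>b(1)])
          then show ?thesis by (simp only: mult.commute)
        qed
      qed
      also have "\<dots> = B * r * (LINT x|lborel. \<eta> x)" by simp
      finally show ?thesis unfolding r_def[symmetric] by (simp add: algebra_simps)
    qed
    have "c * (LINT x|lborel. v x * indicator \<Omega> x) - E * (LINT x|lborel. v x * weight \<delta> x) \<le> 0"
      by (rule nonpos_if_le_powr[OF _ step]) (use s in simp)
    \<comment> \<open>Returning from \<open>v\<close> to the positive part of \<open>U\<close>: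
      \<open>v\<close> is below the mollification of that positive part, and Fubini moves the
      mollifier onto the weight, at the cost of 4 times the mass of the bump.\<close>
    moreover have "(LINT x|lborel. v x * weight \<delta> x) \<le> 4 * Z * (LINT y|lborel. max (U y) 0 * weight \<delta> y)"
    proof -
      define P where "P = (\<lambda>y. max (U y) 0)"
      have Pm [measurable]: "P \<in> borel_measurable borel" unfolding P_def by measurable
      have iP: "integrable lborel P"
        by (rule Bochner_Integration.integrable_bound[OF U]) (auto simp: P_def)
      have P0: "0 \<le> P y" for y by (simp add: P_def)
      have vP: "v x \<le> mollify \<delta> P x" for x
      proof -
        have "mollify \<delta> U x \<le> mollify \<delta> P x" by (rule mollify_mono[OF U Um iP Pm]) (simp add: P_def)
        moreover have "0 \<le> mollify \<delta> P x"
          unfolding mollify_def by (intro integral_nonneg_AE AE_I2 mult_nonneg_nonneg P0 bump_nonneg)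
        ultimately show ?thesis by (simp add: v_def)
      qed
      note I = mollify_integral[OF \<delta>(1) iP Pm measurable_weight weight_bounds(2)[OF \<delta>(1)]]
      have iPW: "integrable lborel (\<lambda>x. P x * weight \<delta> x)"
        by (rule integrable_mult_bounded[OF iP _ weight_bounds(2)[OF \<delta>(1)]]) measurable
      have "(LINT x|lborel. v x * weight \<delta> x) \<le> (LINT x|lborel. mollify \<delta> P x * weight \<delta> x)"
        using vP weight_bounds[OF \<delta>(1)] by (intro integral_mono ivW I(1) mult_right_mono)
      also have "\<dots> = (LINT y|lborel. P y * (LINT x|lborel. bump \<delta> (y - x) * weight \<delta> x))" by (rule I(3))
      also have "\<dots> \<le> (LINT y|lborel. 4 * Z * (P y * weight \<delta> y))"
      proof (rule integral_mono[OF I(2)])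
        show "integrable lborel (\<lambda>y. 4 * Z * (P y * weight \<delta> y))" using iPW by (rule integrable_mult_right)
        fix y
        have "(LINT x|lborel. bump \<delta> (y - x) * weight \<delta> x) \<le> (LINT x|lborel. bump \<delta> (y - x) * (4 * weight \<delta> y))"
        proof (rule integral_mono)
          show "integrable lborel (\<lambda>x. bump \<delta> (y - x) * weight \<delta> x)"
            by (rule integrable_mult_bounded[OF integral_bump_reflect(1)[OF \<delta>(1)] _ weight_bounds(2)[OF \<delta>(1)]]) measurable
          show "integrable lborel (\<lambda>x. bump \<delta> (y - x) * (4 * weight \<delta> y))"
            by (intro integrable_mult_left integral_bump_reflect(1) \<delta>)
          show "bump \<delta> (y - x) * weight \<delta> x \<le> bump \<delta> (y - x) * (4 * weight \<delta> y)" for x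
          proof (cases "dist y x < \<delta>")
            case True
            then show ?thesis by (intro mult_left_mono weight_near \<delta> bump_nonneg)
          next
            case False
            then have "bump \<delta> (y - x) = 0" using \<delta> by (simp add: bump_eq_0_iff dist_norm)
            then show ?thesis by simp
          qed
        qed
        also have "\<dots> = Z * (4 * weight \<delta> y)" using integral_bump_reflect(2)[OF \<delta>(1), of y] by (simp add: Z_def)
        finally show "P y * (LINT x|lborel. bump \<delta> (y - x) * weight \<delta> x) \<le> 4 * Z * (P y * weight \<delta> y)"
          using mult_left_mono[OF _ P0[of y]] by (force simp: mult_ac)
      qed
      also have "\<dots> = 4 * Z * (LINT y|lborel. P y * weight \<delta> y)" by simp
      finally show ?thesis by (simp add: P_def)
    qed
    then have "E * (LINT x|lborel. v x * weight \<delta> x) \<le> E * (4 * Z * (LINT y|lborel. max (U y) 0 * weight \<delta> y))"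
      using E by (intro mult_left_mono)
    ultimately have "c * (LINT x|lborel. v x * indicator \<Omega> x) \<le> E * (4 * Z * (LINT y|lborel. max (U y) 0 * weight \<delta> y))"
      by linarith
    then have "(LINT x|lborel. v x * indicator \<Omega> x) \<le> E * (4 * Z * (LINT y|lborel. max (U y) 0 * weight \<delta> y)) / c"
      using c by (simp add: pos_le_divide_eq mult.commute)
    then show ?thesis by (simp add: v_def Z_def mult_ac)
  qed
  have "0 \<le> 4 * E / c" using E c by simp
  then show ?thesis using main by (rule that)
qed

end

subsection \<open>Conclusion\<close>

context distance_barrier
begin

text \<open>Layer cake turns the weighted integral into an average of strip masses. Strips of width
  below \<open>b / 2\<close> have mass at most \<open>2 * \<tau> * r powr s\<close>, and integrating
  this gives \<open>\<delta> powr (- s)\<close>, which the prefactor cancels; wider strips have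
  total mass at most \<open>N\<close> and keep the factor \<open>\<delta> powr s\<close>.\<close>

lemma weighted_integral_tendsto:
  fixes P :: "'a \<Rightarrow> real"
  assumes P: "integrable lborel P" and Pm [measurable]: "P \<in> borel_measurable borel" and P0: "\<And>y. 0 \<le> P y"
    and lim: "((\<lambda>\<epsilon>. \<epsilon> powr (- s) * (LINT y|lborel. P y * (if d y < \<epsilon> then 1 else 0))) \<longlongrightarrow> 0) (at_right 0)"
  shows "((\<lambda>\<delta>. LINT y|lborel. P y * weight \<delta> y) \<longlongrightarrow> 0) (at_right 0)"
proof -
  define N where "N = (LINT y|lborel. P y)"
  have N: "0 \<le> N" unfolding N_def by (intro integral_nonneg_AE AE_I2 P0)
  have iP: "integrable lborel (\<lambda>y. P y * (if Q y then 1 else 0))" if "Measurable.pred borel Q" for Q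
    using that by (intro integrable_mult_bounded[OF P, of _ 1]) auto
  have S0: "0 \<le> (LINT y|lborel. P y * weight \<delta> y)" if "0 < \<delta>" for \<delta>
    using P0 weight_bounds[OF that] by (intro integral_nonneg_AE AE_I2 mult_nonneg_nonneg)
  have bound: "\<exists>C0. \<forall>\<delta>>0. (LINT y|lborel. P y * weight \<delta> y) \<le> 4 * \<tau> + C0 * \<delta> powr s" if \<tau>: "0 < \<tau>" for \<tau>
  proof -
    have "eventually (\<lambda>\<epsilon>. \<epsilon> powr (- s) * (LINT y|lborel. P y * (if d y < \<epsilon> then 1 else 0)) < \<tau>) (at_right 0)"
      using lim \<tau> by (rule order_tendstoD)
    then obtain b where b: "0 < b" and less: "\<And>\<epsilon>. 0 < \<epsilon> \<Longrightarrow> \<epsilon> < b \<Longrightarrow>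
        \<epsilon> powr (- s) * (LINT y|lborel. P y * (if d y < \<epsilon> then 1 else 0)) < \<tau>"
      unfolding eventually_at_right_field by metis
    have small: "(LINT y|lborel. P y * (if d y < \<epsilon> then 1 else 0)) \<le> \<tau> * \<epsilon> powr s" if \<epsilon>: "0 < \<epsilon>" "\<epsilon> < b" for \<epsilon>
    proof -
      have "\<epsilon> powr s * (\<epsilon> powr (- s) * (LINT y|lborel. P y * (if d y < \<epsilon> then 1 else 0))) \<le> \<epsilon> powr s * \<tau>"
        using less[OF \<epsilon>] by (intro mult_left_mono) auto
      moreover have "\<epsilon> powr s * \<epsilon> powr (- s) = 1" using \<epsilon> by (simp flip: powr_add)
      ultimately show ?thesis by (simp add: mult.commute flip: mult.assoc)
    qed
    have "(LINT y|lborel. P y * weight \<delta> y) \<le> 4 * \<tau> + N * (b / 2) powr (- 2 * s) * \<delta> powr s" if \<delta>: "0 < \<delta>" for \<delta>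
    proof -
      interpret Q: finite_measure "power_tail s \<delta>" using \<delta> s by (intro finite_measure_power_tail) auto
      interpret pair_sigma_finite "power_tail s \<delta>" "lborel :: 'a measure" ..
      txt \<open>Layer cake: \<open>max \<delta> (d y) powr (- 2 * s) / (2 * s)\<close> is the mass of \<open>{max \<delta> (d y)..}\<close>.\<close>
      define \<iota> where "\<iota> = (\<lambda>r y. if max \<delta> (d y) \<le> r then 1 else 0 :: real)"
      have \<iota>m [measurable]: "(\<lambda>(r, y). \<iota> r y) \<in> borel_measurable (borel \<Otimes>\<^sub>M borel)" unfolding \<iota>_def by measurable
      have \<iota>: "(LINT r|power_tail s \<delta>. \<iota> r y) = max \<delta> (d y) powr (- 2 * s) / (2 * s)" for y
      proof -
        have "\<iota> r y = indicator {max \<delta> (d y)..} r" for r by (simp add: \<iota>_def indicator_def)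
        then show ?thesis using integral_power_tail_atLeast[OF s(1) \<delta>, of "max \<delta> (d y)"] by simp
      qed
      have i1: "integrable (power_tail s \<delta> \<Otimes>\<^sub>M lborel) (\<lambda>(r, y). P y)"
      proof (rule Fubini_integrable)
        show "integrable (power_tail s \<delta>) (\<lambda>r. LINT y|lborel. norm (case (r, y) of (r, y) \<Rightarrow> P y))" by simp
      qed (use P in auto)
      have "integrable (power_tail s \<delta> \<Otimes>\<^sub>M lborel) (\<lambda>p. (case p of (r, y) \<Rightarrow> P y) * (case p of (r, y) \<Rightarrow> \<iota> r y))"
      proof (rule integrable_mult_bounded[OF i1, of _ 1])
        show "(\<lambda>(r, y). \<iota> r y) \<in> borel_measurable (power_tail s \<delta> \<Otimes>\<^sub>M lborel)"
          using \<iota>m by (simp cong: measurable_cong_sets sets_pair_measure_cong)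
      qed (auto simp: \<iota>_def)
      then have i2: "integrable (power_tail s \<delta> \<Otimes>\<^sub>M lborel) (\<lambda>(r, y). P y * \<iota> r y)"
        by (simp add: case_prod_beta')
      define \<Psi> where "\<Psi> = (\<lambda>r. LINT y|lborel. P y * \<iota> r y)"
      have i\<Psi>: "integrable (power_tail s \<delta>) \<Psi>" unfolding \<Psi>_def by (rule integrable_fst[OF i2])
      have "(LINT y|lborel. P y * weight \<delta> y) = (LINT y|lborel. 2 * s * \<delta> powr s * (LINT r|power_tail s \<delta>. P y * \<iota> r y))"
        using s by (intro Bochner_Integration.integral_cong) (auto simp: \<iota> weight_def)
      also have "\<dots> = 2 * s * \<delta> powr s * (LINT r|power_tail s \<delta>. \<Psi> r)"
        unfolding \<Psi>_def using Fubini_integral[OF i2] by simp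
      also have "(LINT r|power_tail s \<delta>. \<Psi> r) \<le> 2 * \<tau> * (\<delta> powr (- s) / s) + N * ((b / 2) powr (- 2 * s) / (2 * s))"
      proof -
        have b2: "0 < b / 2" using b by simp
        note T1 = power_tail_upper[OF \<delta> \<delta>, of s s] and T2 = power_tail_upper[OF \<delta> b2, of 0 s]
        have s1: "s < 2 * s" "0 < 2 * s" using s by auto
        have "(LINT r|power_tail s \<delta>. \<Psi> r) \<le>
          (LINT r|power_tail s \<delta>. 2 * \<tau> * (indicator {\<delta>..} r * r powr s) + N * (indicator {b / 2..} r * r powr 0))"
        proof (rule integral_mono_AE[OF i\<Psi>])
          show "integrable (power_tail s \<delta>) (\<lambda>r. 2 * \<tau> * (indicator {\<delta>..} r * r powr s) + N * (indicator {b / 2..} r * r powr 0))"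
            by (intro Bochner_Integration.integrable_add integrable_mult_right T1(1)[OF s1(1)] T2(1)[OF s1(2)])
          show "AE r in power_tail s \<delta>. \<Psi> r \<le> 2 * \<tau> * (indicator {\<delta>..} r * r powr s) + N * (indicator {b / 2..} r * r powr 0)"
            using AE_power_tail
          proof eventually_elim
            case (elim r)
            then have r: "0 < r" using \<delta> by linarith
            have \<iota>if: "P y * \<iota> r y = P y * (if max \<delta> (d y) \<le> r then 1 else 0)" for y by (simp add: \<iota>_def)
            show ?case
            proof (cases "r < b / 2")
              case True
              \<comment> \<open>The strips in \<open>lim\<close> are open, those of the layer cake
                closed; doubling \<open>r\<close> bridges this and explains the split at
                \<open>b / 2\<close>.\<close>
              have "\<Psi> r \<le> (LINT y|lborel. P y * (if d y < 2 * r then 1 else 0))"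
                unfolding \<Psi>_def \<iota>if
              proof (intro integral_mono iP)
                show "P y * (if max \<delta> (d y) \<le> r then 1 else 0) \<le> P y * (if d y < 2 * r then 1 else 0)" for y
                  using P0[of y] r by auto
              qed measurable
              also have "\<dots> \<le> \<tau> * (2 * r) powr s" using r True by (intro small) auto
              also have "(2 * r) powr s = 2 powr s * r powr s" by (rule powr_mult)
              also have "\<tau> * (2 powr s * r powr s) \<le> \<tau> * (2 * r powr s)"
                using \<tau> s powr_mono[of s 1 2] by (intro mult_left_mono mult_right_mono) auto
              finally show ?thesis using True elim by simp
            next
              case False
              have "\<Psi> r \<le> N" unfolding \<Psi>_def \<iota>if N_def
              proof (intro integral_mono iP P)
                show "P y * (if max \<delta> (d y) \<le> r then 1 else 0) \<le> P y" for y using P0[of y] by auto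
              qed measurable
              moreover have "0 \<le> 2 * \<tau> * (indicator {\<delta>..} r * r powr s)" using \<tau> by simp
              moreover have "N * (indicator {b / 2..} r * r powr 0) = N" using False r by simp
              ultimately show ?thesis by linarith
            qed
          qed
        qed
        also have "\<dots> = 2 * \<tau> * (LINT r|power_tail s \<delta>. indicator {\<delta>..} r * r powr s) + N * (LINT r|power_tail s \<delta>. indicator {b / 2..} r * r powr 0)"
          by (simp only: Bochner_Integration.integral_add Bochner_Integration.integral_mult_right_zero
              integrable_mult_right T1(1)[OF s1(1)] T2(1)[OF s1(2)])
        also have "\<dots> \<le> 2 * \<tau> * (\<delta> powr (s - 2 * s) / (2 * s - s)) + N * ((b / 2) powr (0 - 2 * s) / (2 * s - 0))"
          using \<tau> N by (intro add_mono mult_left_mono T1(2)[OF s1(1)] T2(2)[OF s1(2)]) auto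
        finally show ?thesis by simp
      qed
      then have "2 * s * \<delta> powr s * (LINT r|power_tail s \<delta>. \<Psi> r) \<le>
          2 * s * \<delta> powr s * (2 * \<tau> * (\<delta> powr (- s) / s) + N * ((b / 2) powr (- 2 * s) / (2 * s)))"
        using s by (intro mult_left_mono) auto
      also have "\<dots> = 4 * \<tau> * (\<delta> powr s * \<delta> powr (- s)) + N * (b / 2) powr (- 2 * s) * \<delta> powr s"
        using s by (simp add: field_simps)
      also have "\<delta> powr s * \<delta> powr (- s) = 1" using \<delta> by (simp flip: powr_add)
      finally show ?thesis by simp
    qed
    then show ?thesis by blast
  qed
  show ?thesis
  proof (rule tendstoI)
    fix e :: real assume e: "0 < e"
    then have "0 < e / 8" by simp
    from bound[OF this] obtain C0 where C0: "\<And>\<delta>. 0 < \<delta> \<Longrightarrow> (LINT y|lborel. P y * weight \<delta> y) \<le> 4 * (e / 8) + C0 * \<delta> powr s"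
      by metis
    have "((\<lambda>\<delta>. 4 * (e / 8) + C0 * \<delta> powr s) \<longlongrightarrow> 4 * (e / 8) + C0 * 0 powr s) (at_right 0)"
      using s by (intro tendsto_intros tendsto_powr') (auto intro!: eventually_mono[OF eventually_at_right_less])
    then have "eventually (\<lambda>\<delta>. 4 * (e / 8) + C0 * \<delta> powr s < e) (at_right 0)"
      by (rule order_tendstoD) (use e in simp)
    then show "eventually (\<lambda>\<delta>. dist (LINT y|lborel. P y * weight \<delta> y) 0 < e) (at_right 0)"
      using eventually_at_right_less[of 0]
    proof eventually_elim
      case (elim \<delta>)
      then show ?case using C0[of \<delta>] S0[of \<delta>] by simp
    qed
  qed
qed

text \<open>Moving the mollifier from \<open>U\<close> onto the Lipschitz function \<open>g\<close>
  changes \<open>g\<close> by at most \<open>L * \<delta>\<close> relative to the mass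
  \<open>Z\<close> of the bump. All terms carry the factor \<open>Z\<close>, which is divided out
  before \<delta> tends to 0.\<close>

lemma subsolution_tested_nonpos:
  fixes U g :: "'a \<Rightarrow> real"
  assumes U: "integrable lborel U" and Um [measurable]: "U \<in> borel_measurable borel" and bdd: "bounded \<Omega>"
    and sub: "\<And>\<delta>. 0 < \<delta> \<Longrightarrow> \<exists>B\<ge>0. \<forall>\<kappa>>0. \<forall>x. 2 * \<delta> < d x \<longrightarrow> A_trunc \<kappa> (mollify \<delta> U) x \<le> B * \<kappa> powr (2 - 2 * s)"
    and lim: "((\<lambda>\<epsilon>. \<epsilon> powr (- s) * (LINT y|lborel. max (U y) 0 * (if d y < \<epsilon> then 1 else 0))) \<longlongrightarrow> 0) (at_right 0)"
    and gm [measurable]: "g \<in> borel_measurable borel" and g: "\<And>x. 0 \<le> g x" "\<And>x. g x \<le> 1" "\<And>x. x \<notin> \<Omega> \<Longrightarrow> g x = 0"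
    and lip: "\<And>x y. \<bar>g x - g y\<bar> \<le> L * dist x y"
  shows "(LINT y|lborel. U y * g y) \<le> 0"
proof -
  have \<Omega>m [measurable]: "\<Omega> \<in> sets borel" using open_dom by simp
  define N where "N = (LINT y|lborel. \<bar>U y\<bar>)"
  obtain C' where C': "0 \<le> C'" and moll: "\<And>\<delta>. 0 < \<delta> \<Longrightarrow> \<delta> \<le> 1 \<Longrightarrow>
      (LINT x|lborel. max (mollify \<delta> U x) 0 * indicator \<Omega> x) \<le>
      C' * (LINT x|lborel. bump \<delta> (x :: 'a)) * (LINT y|lborel. max (U y) 0 * weight \<delta> y)"
    by (rule mollified_positive_part_bound[OF U Um bdd sub], assumption, rule that)
  define S where "S = (\<lambda>\<delta>. LINT y|lborel. max (U y) 0 * weight \<delta> y)"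
  have L: "0 \<le> L"
  proof -
    obtain v :: 'a where "norm v = 1" using vector_choose_size[of 1] by auto
    then show ?thesis using lip[of v 0] by simp
  qed
  have iP: "integrable lborel (\<lambda>y. max (U y) 0)"
    by (rule Bochner_Integration.integrable_bound[OF U]) auto
  have S: "(S \<longlongrightarrow> 0) (at_right 0)"
    unfolding S_def by (rule weighted_integral_tendsto[OF iP _ _ lim]) auto
  have gabs: "\<bar>g x\<bar> \<le> 1" for x using g[of x] by simp
  have iUg: "integrable lborel (\<lambda>y. U y * g y)" by (rule integrable_mult_bounded[OF U _ gabs]) measurable
  have le: "(LINT y|lborel. U y * g y) \<le> C' * S \<delta> + L * \<delta> * N" if \<delta>: "0 < \<delta>" "\<delta> \<le> 1" for \<delta>
  proof -
    define Z where "Z = (LINT x|lborel. bump \<delta> (x :: 'a))"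
    have Z: "0 < Z" unfolding Z_def by (rule integral_bump_pos[OF \<delta>(1)])
    note I = mollify_integral[OF \<delta>(1) U Um gm gabs]
    define G where "G = (\<lambda>y. LINT x|lborel. bump \<delta> (y - x) * g x)"
    have G: "\<bar>G y - Z * g y\<bar> \<le> Z * (L * \<delta>)" for y
    proof -
      note ib = integral_bump_reflect[OF \<delta>(1), of y]
      have ig: "integrable lborel (\<lambda>x. bump \<delta> (y - x) * g x)"
        by (rule integrable_mult_bounded[OF ib(1) _ gabs]) measurable
      have ic: "integrable lborel (\<lambda>x. bump \<delta> (y - x) * c)" for c by (intro integrable_mult_left ib)
      have "G y - Z * g y = (LINT x|lborel. bump \<delta> (y - x) * g x - bump \<delta> (y - x) * g y)"
        using ig ic ib(2) by (simp add: G_def Z_def)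
      also have "\<bar>\<dots>\<bar> \<le> (LINT x|lborel. \<bar>bump \<delta> (y - x) * g x - bump \<delta> (y - x) * g y\<bar>)" by (rule integral_abs_bound)
      also have "\<dots> \<le> (LINT x|lborel. bump \<delta> (y - x) * (L * \<delta>))"
      proof (intro integral_mono integrable_abs Bochner_Integration.integrable_diff ig ic)
        fix x
        have "\<bar>bump \<delta> (y - x) * g x - bump \<delta> (y - x) * g y\<bar> = bump \<delta> (y - x) * \<bar>g x - g y\<bar>"
          by (simp add: bump_nonneg abs_mult flip: right_diff_distrib)
        also have "\<dots> \<le> bump \<delta> (y - x) * (L * \<delta>)"
        proof (cases "norm (y - x) < \<delta>")
          case True
          have "\<bar>g x - g y\<bar> \<le> L * dist x y" by (rule lip)
          also have "\<dots> \<le> L * \<delta>" using True L by (intro mult_left_mono) (auto simp: dist_norm norm_minus_commute)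
          finally show ?thesis by (intro mult_left_mono bump_nonneg)
        next
          case False
          then have "bump \<delta> (y - x) = 0" using \<delta> by (simp add: bump_eq_0_iff)
          then show ?thesis by simp
        qed
        finally show "\<bar>bump \<delta> (y - x) * g x - bump \<delta> (y - x) * g y\<bar> \<le> bump \<delta> (y - x) * (L * \<delta>)" .
      qed
      also have "\<dots> = Z * (L * \<delta>)" using ib(2) by (simp add: Z_def)
      finally show ?thesis .
    qed
    have iUG: "integrable lborel (\<lambda>y. U y * G y)" unfolding G_def by (rule I(2))
    have "Z * (LINT y|lborel. U y * g y) - Z * (L * \<delta>) * N = (LINT y|lborel. Z * (U y * g y) - Z * (L * \<delta>) * \<bar>U y\<bar>)"
      using iUg U by (simp add: N_def)
    also have "\<dots> \<le> (LINT y|lborel. U y * G y)"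
    proof (rule integral_mono[OF _ iUG])
      show "integrable lborel (\<lambda>y. Z * (U y * g y) - Z * (L * \<delta>) * \<bar>U y\<bar>)"
        using iUg U by (intro Bochner_Integration.integrable_diff integrable_mult_right integrable_abs)
      fix y
      have "U y * (Z * g y - G y) \<le> \<bar>U y\<bar> * \<bar>Z * g y - G y\<bar>" by (metis abs_ge_self abs_mult)
      also have "\<dots> \<le> \<bar>U y\<bar> * (Z * (L * \<delta>))" using G[of y] by (intro mult_left_mono) (auto simp: abs_minus_commute)
      finally show "Z * (U y * g y) - Z * (L * \<delta>) * \<bar>U y\<bar> \<le> U y * G y" by (simp add: algebra_simps)
    qed
    also have "\<dots> = (LINT x|lborel. mollify \<delta> U x * g x)" unfolding G_def by (rule I(3)[symmetric])
    also have "\<dots> \<le> (LINT x|lborel. max (mollify \<delta> U x) 0 * indicator \<Omega> x)"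
    proof (rule integral_mono[OF I(1)])
      have "integrable lborel (\<lambda>x. max (mollify \<delta> U x) 0)"
        using measurable_mollify[OF Um, of \<delta>]
        by (intro Bochner_Integration.integrable_bound[OF integrable_mollify[OF \<delta>(1) U Um]]) auto
      then show "integrable lborel (\<lambda>x. max (mollify \<delta> U x) 0 * indicator \<Omega> x)"
        by (rule integrable_mult_bounded[of _ _ _ 1]) (auto simp: indicator_def)
      show "mollify \<delta> U x * g x \<le> max (mollify \<delta> U x) 0 * indicator \<Omega> x" for x
      proof (cases "x \<in> \<Omega>")
        case True
        have "mollify \<delta> U x * g x \<le> max (mollify \<delta> U x) 0 * g x" using g by (intro mult_right_mono) auto
        also have "\<dots> \<le> max (mollify \<delta> U x) 0 * 1" using g by (intro mult_left_mono) auto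
        finally show ?thesis using True by simp
      qed (simp add: g)
    qed
    also have "\<dots> \<le> C' * Z * S \<delta>" unfolding Z_def S_def by (rule moll[OF \<delta>])
    finally have "Z * (LINT y|lborel. U y * g y) \<le> Z * (C' * S \<delta> + L * \<delta> * N)" by (simp add: algebra_simps)
    then show ?thesis using Z by simp
  qed
  have "((\<lambda>\<delta>. C' * S \<delta> + L * \<delta> * N) \<longlongrightarrow> C' * 0 + L * 0 * N) (at_right 0)"
    by (intro tendsto_intros S)
  then have "((\<lambda>\<delta>. C' * S \<delta> + L * \<delta> * N) \<longlongrightarrow> 0) (at_right 0)" by simp
  moreover have "eventually (\<lambda>\<delta>. (LINT y|lborel. U y * g y) \<le> C' * S \<delta> + L * \<delta> * N) (at_right 0)"
    using eventually_at_right_real[of 0 1] by (auto elim!: eventually_mono intro!: le)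
  ultimately show ?thesis by (rule tendsto_lowerbound) simp
qed

text \<open>Lipschitz functions of the distance to a compact \<open>T\<close> decrease to its
  indicator, so the integral of \<open>U\<close> over \<open>T\<close> is nonpositive. Inner
  regularity of the set where \<open>U > 0\<close> then forces that set to be null.\<close>

lemma AE_nonpos_of_tested:
  fixes U :: "'a \<Rightarrow> real"
  assumes U: "integrable lborel U" and Um [measurable]: "U \<in> borel_measurable borel" and bdd: "bounded \<Omega>"
    and U0: "\<And>y. y \<notin> \<Omega> \<Longrightarrow> U y = 0"
    and test: "\<And>g L. g \<in> borel_measurable borel \<Longrightarrow> (\<And>x. 0 \<le> g x) \<Longrightarrow> (\<And>x. g x \<le> 1) \<Longrightarrow> (\<And>x. x \<notin> \<Omega> \<Longrightarrow> g x = 0) \<Longrightarrow>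
      (\<And>x y. \<bar>g x - g y\<bar> \<le> L * dist x y) \<Longrightarrow> (LINT y|lborel. U y * g y) \<le> 0"
  shows "AE x in lborel. U x \<le> 0"
proof -
  have compact_le: "(LINT y|lborel. U y * indicator T y) \<le> 0" if T: "compact T" "T \<subseteq> \<Omega>" "T \<noteq> {}" for T
  proof -
    have cT: "closed T" using T compact_imp_closed by blast
    obtain x0 where x0: "x0 \<in> T" "\<And>x. x \<in> T \<Longrightarrow> d x0 \<le> d x"
      using continuous_attains_inf[OF T(1,3), of d] continuous_on_infdist[OF continuous_on_id, of T "- \<Omega>"] by auto
    define e where "e = d x0"
    have e: "0 < e" using x0 T infdist_pos by (auto simp: e_def)
    have far: "e \<le> infdist x T" if "x \<notin> \<Omega>" for x
    proof -
      have "e \<le> dist x k" if "k \<in> T" for k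
      proof -
        have "d k \<le> dist k x" using \<open>x \<notin> \<Omega>\<close> by (intro infdist_le) simp
        then show ?thesis using x0(2)[OF that] by (simp add: e_def dist_commute)
      qed
      then show ?thesis using T unfolding infdist_def by (simp add: cINF_greatest)
    qed
    define g where "g = (\<lambda>n x. max 0 (1 - real n * infdist x T))"
    have gm [measurable]: "g n \<in> borel_measurable borel" for n
      unfolding g_def by (intro borel_measurable_continuous_onI continuous_intros continuous_on_infdist)
    have g01: "0 \<le> g n x" "g n x \<le> 1" for n x
      using infdist_nonneg[of x T] by (auto simp: g_def)
    \<comment> \<open>From \<open>m0\<close> on, the approximating functions vanish outside the
      domain, because \<open>T\<close> has distance at least \<open>e\<close> from the
      complement.\<close>
    obtain m0 :: nat where m0: "1 / e < real m0" using reals_Archimedean2 by blast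
    have neg: "(LINT y|lborel. U y * g n y) \<le> 0" if n: "m0 \<le> n" for n
    proof (rule test[OF gm g01(1) g01(2)])
      fix x assume "x \<notin> \<Omega>"
      have "1 \<le> real m0 * e" using m0 e by (simp add: field_simps)
      also have "\<dots> \<le> real n * infdist x T" using n far[OF \<open>x \<notin> \<Omega>\<close>] e by (intro mult_mono) auto
      finally show "g n x = 0" by (simp add: g_def)
    next
      fix x y
      have "\<bar>g n x - g n y\<bar> \<le> \<bar>real n * infdist x T - real n * infdist y T\<bar>" unfolding g_def by linarith
      also have "\<dots> = real n * \<bar>infdist x T - infdist y T\<bar>" by (simp add: abs_mult flip: right_diff_distrib)
      also have "\<dots> \<le> real n * dist x y" by (intro mult_left_mono infdist_triangle_abs) simp
      finally show "\<bar>g n x - g n y\<bar> \<le> real n * dist x y" .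
    qed
    have "(\<lambda>n. LINT y|lborel. U y * g n y) \<longlonglongrightarrow> (LINT y|lborel. U y * indicator T y)"
    proof (rule integral_dominated_convergence)
      show "integrable lborel (\<lambda>y. \<bar>U y\<bar>)" using U by simp
      show "AE y in lborel. norm (U y * g n y) \<le> \<bar>U y\<bar>" for n
        using g01[of n] by (auto simp: abs_mult intro!: mult_left_le)
      show "AE y in lborel. (\<lambda>n. U y * g n y) \<longlonglongrightarrow> U y * indicator T y"
      proof (rule AE_I2, rule tendsto_mult[OF tendsto_const])
        fix y
        show "(\<lambda>n. g n y) \<longlonglongrightarrow> indicator T y"
        proof (cases "y \<in> T")
          case True
          then show ?thesis by (simp add: g_def)
        next
          case False
          then have p: "0 < infdist y T" using infdist_pos_not_in_closed[OF cT T(3)] by simp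
          obtain m :: nat where m: "1 / infdist y T < real m" using reals_Archimedean2 by blast
          have "g n y = 0" if "m \<le> n" for n
          proof -
            have "1 \<le> real m * infdist y T" using m p by (simp add: field_simps)
            also have "\<dots> \<le> real n * infdist y T" using that p by (intro mult_right_mono) auto
            finally show ?thesis by (simp add: g_def)
          qed
          then have "eventually (\<lambda>n. g n y = 0) sequentially" by (auto simp: eventually_sequentially)
          then show ?thesis using False by (simp add: tendsto_eventually)
        qed
      qed
      show "(\<lambda>y. U y * indicator T y) \<in> borel_measurable lborel" using cT by simp
    qed measurable
    then show ?thesis by (rule LIMSEQ_le_const2) (use neg in auto)
  qed
  define P where "P = {x. 0 < U x}"
  have Pm [measurable]: "P \<in> sets borel" unfolding P_def by measurable
  have P\<Omega>: "P \<subseteq> \<Omega>" using U0 by (force simp: P_def)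
  have "emeasure lebesgue P \<le> 0"
  proof (rule ennreal_le_epsilon)
    fix \<epsilon> :: real assume \<epsilon>: "0 < \<epsilon>"
    have "P \<in> sets lebesgue" by simp
    then obtain T where T: "closed T" "T \<subseteq> P" "P - T \<in> lmeasurable" "emeasure lebesgue (P - T) < ennreal \<epsilon>"
      using sets_lebesgue_inner_closed \<epsilon> by metis
    have "compact T" using T P\<Omega> bdd by (meson bounded_subset compact_eq_bounded_closed order_trans)
    have Tm [measurable]: "T \<in> sets borel" using T by simp
    \<comment> \<open>On \<open>T\<close> the function \<open>U\<close> is strictly positive, so a
      nonpositive integral leaves only a null set.\<close>
    have Tn: "emeasure lebesgue T = 0"
    proof (cases "T = {}")
      case False
      have iT: "integrable lborel (\<lambda>y. U y * indicator T y)"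
        by (rule integrable_mult_bounded[OF U, of _ 1]) (auto simp: indicator_def)
      have nn: "0 \<le> U y * indicator T y" for y using T by (auto simp: indicator_def P_def)
      have "(LINT y|lborel. U y * indicator T y) \<le> 0"
        using \<open>compact T\<close> T P\<Omega> False by (intro compact_le) auto
      moreover have "0 \<le> (LINT y|lborel. U y * indicator T y)" by (intro integral_nonneg_AE AE_I2 nn)
      ultimately have "(LINT y|lborel. U y * indicator T y) = 0" by linarith
      then have "AE y in lborel. U y * indicator T y = 0"
        by (subst (asm) integral_nonneg_eq_0_iff_AE[OF iT]) (simp_all add: nn)
      then have "AE y in lborel. y \<notin> T"
      proof (rule AE_mp, intro AE_I2 impI)
        fix y assume "U y * indicator T y = 0"
        then show "y \<notin> T" using T(2) by (auto simp: P_def)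
      qed
      then have "T \<in> null_sets lborel" by (subst AE_iff_null_sets) auto
      then show ?thesis by (simp add: null_sets_def)
    qed simp
    have "emeasure lebesgue P \<le> emeasure lebesgue ((P - T) \<union> T)"
      by (intro emeasure_mono) auto
    also have "\<dots> \<le> emeasure lebesgue (P - T) + emeasure lebesgue T"
      by (intro emeasure_subadditive) auto
    also have "\<dots> \<le> 0 + ennreal \<epsilon>" using T Tn by simp
    finally show "emeasure lebesgue P \<le> 0 + ennreal \<epsilon>" .
  qed
  then have "emeasure lborel P = 0" by simp
  then have "P \<in> null_sets lborel" by (intro null_setsI) auto
  then have "AE x in lborel. x \<notin> P" by (rule AE_not_in)
  then show ?thesis by (rule AE_mp) (auto simp: P_def not_less)
qed

end

theorem theorem1p1:
  fixes s :: real and \<Omega> :: "'a::euclidean_space set" and \<mu> :: "'a measure"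
    and u :: "'a \<Rightarrow> real" and C :: real
  assumes s: "0 < s" "s < 1"
    and dom: "bounded \<Omega>" "lipschitz_domain \<Omega>" "uniform_exterior_ball \<Omega>"
    and mu: "sphere_measure \<mu>"
    and nondeg: "0 < C" "\<forall>\<omega>\<in>sphere 0 1. C \<le> (LINT \<theta>|\<mu>. \<bar>\<omega> \<bullet> \<theta>\<bar> powr (2 * s))"
    and L1: "set_integrable lebesgue \<Omega> u"
    and L1w: "integrable (density lebesgue (\<lambda>x. ennreal (nu_star s \<mu> \<Omega> x))) u"
    and h1: "\<And>\<eta>. test_fun \<Omega> \<eta> \<Longrightarrow> (\<forall>x. 0 \<le> \<eta> x) \<Longrightarrow>
               (LINT x|lebesgue. u x * A_op s \<mu> \<eta> x) \<le> 0"
    and h2: "AE x in lebesgue. x \<notin> \<Omega> \<longrightarrow> u x \<le> 0"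
    and h3: "((\<lambda>\<epsilon>. \<epsilon> powr (- s) *
               (LINT x : {x\<in>\<Omega>. infdist x (- \<Omega>) < \<epsilon>} | lebesgue. max (u x) 0)) \<longlongrightarrow> 0)
             (at_right 0)"
  shows "AE x in lebesgue. x \<in> \<Omega> \<longrightarrow> u x \<le> 0"
proof -
  have op: "open \<Omega>" using dom(2) by (simp add: lipschitz_domain_def)
  then have \<Omega>m [measurable]: "\<Omega> \<in> sets borel" by simp
  obtain \<rho> where \<rho>: "0 < \<rho>" and expansion: "\<And>x. x \<in> \<Omega> \<Longrightarrow> \<exists>e. norm e = 1 \<and>
      (\<forall>h. infdist (x + h) (- \<Omega>) \<le> max 0 (infdist x (- \<Omega>) + e \<bullet> h + (norm h)\<^sup>2 / (2 * \<rho>)))"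
    by (rule exterior_ball_distance_expansion[OF dom(1) op dom(3)], rule that)
  obtain R where R: "0 < R" "\<And>x. x \<in> \<Omega> \<Longrightarrow> norm x < R"
    using dom(1) unfolding bounded_pos_less by metis
  \<comment> \<open>A point of the complement: it bounds the distance function and rules out the
    empty set, for which \<open>infdist\<close> takes the default value \<open>0\<close>.\<close>
  obtain a :: 'a where a: "norm a = R" using vector_choose_size[of R] R by auto
  have a\<Omega>: "a \<in> - \<Omega>" using R(2)[of a] a by auto
  have bound: "infdist x (- \<Omega>) \<le> 2 * R" for x
  proof (cases "x \<in> \<Omega>")
    case True
    have "infdist x (- \<Omega>) \<le> dist x a" by (rule infdist_le[OF a\<Omega>])
    also have "\<dots> \<le> norm x + norm a" unfolding dist_norm by (rule norm_triangle_ineq4)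
    finally show ?thesis using R(2)[OF True] a by simp
  next
    case False
    then show ?thesis using R(1) by simp
  qed
  have pos: "0 < infdist x (- \<Omega>)" if "x \<in> \<Omega>" for x
    using that a\<Omega> op by (intro infdist_pos_not_in_closed) auto
  interpret distance_barrier s \<mu> \<Omega> \<rho> "2 * R" C
    by unfold_locales (use s mu op \<rho> R(1) nondeg expansion bound pos in auto)

  \<comment> \<open>The hypotheses concern \<open>lebesgue\<close>, while translations and Fubini
    are used for \<open>lborel\<close>. The Borel representative \<open>U\<close> is made to vanish
    everywhere outside the domain, not just almost everywhere.\<close>
  define w where "w = (\<lambda>x. indicator \<Omega> x * u x)"
  have iw: "integrable lebesgue w" using L1 by (simp add: set_integrable_def w_def)
  obtain U' where U'm [measurable]: "U' \<in> borel_measurable lborel" and U': "AE x in lborel. w x = U' x"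
    using completion_ex_borel_measurable_real[OF borel_measurable_integrable[OF iw]] by auto
  define U where "U = (\<lambda>x. indicator \<Omega> x * U' x)"
  have Um [measurable]: "U \<in> borel_measurable borel" unfolding U_def using U'm by simp
  have Uw: "AE x in lborel. w x = U x"
    using U' by eventually_elim (simp add: U_def w_def split: split_indicator split_indicator_asm)
  have U0: "U y = 0" if "y \<notin> \<Omega>" for y using that by (simp add: U_def)
  have Ul: "U \<in> borel_measurable lebesgue" by (simp add: measurable_completion)
  have "integrable lebesgue U"
    using iw integrable_cong_AE[OF borel_measurable_integrable[OF iw] Ul AE_completion[OF Uw]] by simp
  then have U: "integrable lborel U" by (simp add: integrable_completion)
  have Uu: "AE y in lebesgue. y \<in> \<Omega> \<longrightarrow> U y = u y"
    using AE_completion[OF Uw] by eventually_elim (auto simp: w_def)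
  have sub: "\<exists>B\<ge>0. \<forall>\<kappa>>0. \<forall>x. 2 * \<delta> < infdist x (- \<Omega>) \<longrightarrow> A_trunc \<kappa> (mollify \<delta> U) x \<le> B * \<kappa> powr (2 - 2 * s)"
    if \<delta>: "0 < \<delta>" for \<delta>
  proof (intro exI conjI allI impI)
    show "0 \<le> bump_const \<delta> * (LINT y|lborel. \<bar>U y\<bar>)"
      using s by (simp add: bump_const_def)
    fix \<kappa> :: real and x assume k: "0 < \<kappa>" and x: "2 * \<delta> < infdist x (- \<Omega>)"
    have "cball x (2 * \<delta>) \<subseteq> \<Omega>"
    proof
      fix y assume y: "y \<in> cball x (2 * \<delta>)"
      show "y \<in> \<Omega>"
      proof (rule ccontr)
        assume "y \<notin> \<Omega>"
        then have "infdist x (- \<Omega>) \<le> dist x y" by (intro infdist_le) simp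
        then show False using x y by simp
      qed
    qed
    then have "A_trunc \<kappa> (\<lambda>x. LINT y|lborel. U y * bump \<delta> (y - x)) x \<le>
        bump_const \<delta> * \<kappa> powr (2 - 2 * s) * (LINT y|lborel. \<bar>U y\<bar>)"
      using op \<delta> U Um U0 Uu L1w h1 h2 k by (intro mollified_subsolution)
    moreover have "mollify \<delta> U = (\<lambda>x. LINT y|lborel. U y * bump \<delta> (y - x))"
      by (simp add: mollify_def fun_eq_iff)
    ultimately show "A_trunc \<kappa> (mollify \<delta> U) x \<le> bump_const \<delta> * (LINT y|lborel. \<bar>U y\<bar>) * \<kappa> powr (2 - 2 * s)"
      by (simp only: mult_ac)
  qed
  \<comment> \<open>Points outside the domain have distance \<open>0\<close> and enter the strip on
    the right, but the positive part of \<open>U\<close> vanishes there.\<close>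
  have eq: "(LINT x : {x\<in>\<Omega>. infdist x (- \<Omega>) < \<epsilon>} | lebesgue. max (u x) 0) =
      (LINT y|lborel. max (U y) 0 * (if infdist y (- \<Omega>) < \<epsilon> then 1 else 0))" for \<epsilon>
  proof -
    have m1: "(\<lambda>y. max (U y) 0 * (if infdist y (- \<Omega>) < \<epsilon> then 1 else 0)) \<in> borel_measurable borel"
      by measurable
    have um: "u \<in> borel_measurable lebesgue" using borel_measurable_integrable[OF L1w] by simp
    have "{x\<in>\<Omega>. infdist x (- \<Omega>) < \<epsilon>} \<in> sets borel" by measurable
    then have S: "{x\<in>\<Omega>. infdist x (- \<Omega>) < \<epsilon>} \<in> sets lebesgue" by simp
    have "(LINT x : {x\<in>\<Omega>. infdist x (- \<Omega>) < \<epsilon>} | lebesgue. max (u x) 0) =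
        (LINT y|lebesgue. max (U y) 0 * (if infdist y (- \<Omega>) < \<epsilon> then 1 else 0))"
      unfolding set_lebesgue_integral_def
    proof (rule integral_cong_AE)
      show "(\<lambda>x. indicat_real {x \<in> \<Omega>. infdist x (- \<Omega>) < \<epsilon>} x *\<^sub>R max (u x) 0) \<in> borel_measurable lebesgue"
        using um S by (intro borel_measurable_scaleR borel_measurable_indicator borel_measurable_max) auto
      show "(\<lambda>y. max (U y) 0 * (if infdist y (- \<Omega>) < \<epsilon> then 1 else 0)) \<in> borel_measurable lebesgue"
        using m1 by (simp add: measurable_completion)
      show "AE y in lebesgue. indicat_real {x \<in> \<Omega>. infdist x (- \<Omega>) < \<epsilon>} y *\<^sub>R max (u y) 0 =
          max (U y) 0 * (if infdist y (- \<Omega>) < \<epsilon> then 1 else 0)"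
        using Uu by eventually_elim (use U0 in \<open>auto simp: indicator_def\<close>)
    qed
    also have "\<dots> = (LINT y|lborel. max (U y) 0 * (if infdist y (- \<Omega>) < \<epsilon> then 1 else 0))"
      using m1 by (intro integral_completion) simp
    finally show ?thesis .
  qed
  have "AE x in lborel. U x \<le> 0"
    by (rule AE_nonpos_of_tested[OF U Um dom(1) U0], assumption,
        rule subsolution_tested_nonpos[OF U Um dom(1) sub h3[unfolded eq]])
  then have "AE x in lebesgue. U x \<le> 0" by (rule AE_completion)
  with Uu show ?thesis by eventually_elim auto
qed

end
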